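(* Let the family of random variables $\{n/N_n\}_{n\in\mathbb N}$ be weakly relatively compact. Let the normalizing constants have the form $$b_{n,k}=(\sigma_n\sqrt k)^{-1},\quad d_n=(\sigma_n\sqrt n)^{-1},\quad \mathbf a_{n,k}=(\sigma_n k)^{-1}\sqrt n\,\mathbf a_n,\quad \mathbf c_n=(\sigma_n\sqrt n)^{-1}\mathbf b_n\qquad(n,k\in\mathbb N),$$ where $\sigma_n>0$ and $\mathbf a_n,\mathbf b_n\in\mathbb R^m$ are such that $\mathbf a_n\to\mathbf a$ and $\mathbf b_n\to\mathbf b$ as $n\to\infty$ with some $\mathbf a,\mathbf b\in\mathbb R^m$. Assume that the statistic $\mathbf T_{n,k}$ is asymptotically normal in the following sense: with some symmetric positive definite matrix $\Sigma$, for any $T\in(0,\infty)$ $$\lim_{n\to\infty}\mathsf E\sup_{\|\mathbf t\|\le T}\big|h_{n,N_n}(\mathbf t)-\exp\{-\tfrac12\mathbf t^\top\Sigma\mathbf t\}\big|=0,$$ where $h_{n,k}(\mathbf t)$, $\mathbf t\in\mathbb R^m$, is the characteristic function of the random vector $$\mathbf Y_{n,k}=b_{n,k}^{-1}(\mathbf T_{n,k}-\theta_n-\mathbf a_{n,k})=\sigma_n\sqrt k\,(\mathbf T_{n,k}-\theta_n)-\sqrt{n/k}\,\mathbf a_n.$$ Then the distribution of the statistic $\mathbf T_{n,N_n}$ constructed from the sample with random size $N_n$ weakly converges, as $n\to\infty$, to an $m$-dimensional generalized hyperbolic distribution: $$\mathcal L\big(\sigma_n\sqrt n\,(\mathbf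 T_{n,N_n}-\theta_n)-\mathbf b_n\big)\Longrightarrow GH_{\nu,\mu,\alpha,\Sigma^{-1}\mathbf a,\mathbf b,\Sigma}$$ if and only if $$\mathcal L\big(n^{-1}N_n\big)\Longrightarrow GIG_{-\nu,\lambda,\mu}$$ with $\lambda=\sqrt{\alpha^2-\langle\mathbf a,\Sigma\mathbf a\rangle}$.
   Context: Fix $m,r\in\mathbb N=\{1,2,\dots\}$. All random variables and vectors are defined on one probability space $(\Omega,\mathfrak F,\mathsf P)$; $\mathsf E$ is expectation, $\langle\cdot,\cdot\rangle$ and $\|\cdot\|$ are the Euclidean scalar product and norm, $\mathcal L(\cdot)$ denotes the distribution of a random element and $\Longrightarrow$ weak convergence. A family of random variables is weakly relatively compact if each sequence of its elements contains a weakly convergent subsequence (equivalently, it is tight). $\{\mathbf X_{n,j}\}_{j\ge1}$, $n\in\mathbb N$, is a double array of row-wise independent, not necessarily identically distributed random vectors with values in $\mathbb R^r$. For $n,k\in\mathbb N$, $\mathbf T_{n,k}=\mathbf T_{n,k}(\mathbf X_{n,1},\dots,\mathbf X_{n,k})$ is a statistic, i.e. a measurable function of $\mathbf X_{n,1},\dots,\mathbf X_{n,k}$ with values in $\mathbb R^m$. The $\theta_n$, $n\in\mathbb N$, are (non-random) vectors in $\mathbb R^m$. $\{N_n\}_{n\in\mathbb N}$ is a family of integer random variables with values in $\{1,2,\dots\}$ such that for each $n,k\in\mathbb N$ the random variable $N_n$ and the random vector $\mathbf T_{n,k}-\theta_n$ are independent. The random vector $\mathbf T_{n,N_n}$ is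 defined by $\mathbf T_{n,N_n}(\omega)=\mathbf T_{n,N_n(\omega)}(\mathbf X_{n,1}(\omega),\dots,\mathbf X_{n,N_n(\omega)}(\omega))$, $\omega\in\Omega$, and $h_{n,N_n}(\mathbf t)$ is $h_{n,k}(\mathbf t)$ with $k=N_n$ substituted. $N_{\mathbf c,\Sigma}$ denotes the $m$-dimensional normal distribution with mean vector $\mathbf c$ and covariance matrix $\Sigma$. For $\mathbf c,\mathbf d\in\mathbb R^m$ and a probability measure $G$ on $[0,\infty)$, $N_{\mathbf c+z\mathbf d,\,z\Sigma}\circ G$ is the normal variance-mean mixture $F(d\mathbf x)=\int_0^\infty N_{\mathbf c+z\mathbf d,\,z\Sigma}(d\mathbf x)\,G(dz)$. The generalized inverse Gaussian distribution $GIG_{\nu,\mu,\lambda}$, also written $GIG(\nu,\mu,\lambda)$, has the density $$p_{GIG}(x;\nu,\mu,\lambda)=\frac{\lambda^{\nu/2}}{2\mu^{\nu/2}K_\nu(\sqrt{\mu\lambda})}\,x^{\nu-1}\exp\Big\{-\frac12\Big(\frac{\mu}{x}+\lambda x\Big)\Big\},\quad x>0,$$ where $\nu\in\mathbb R$; $\mu>0,\ \lambda\ge0$ if $\nu<0$; $\mu>0,\ \lambda>0$ if $\nu=0$; $\mu\ge0,\ \lambda>0$ if $\nu>0$; and $K_\nu(z)=\frac12\int_0^\infty y^{\nu-1}\exp\{-\frac z2(y+\frac1y)\}\,dy$, $\mathrm{Re}\,z>0$, is the modified Bessel function of the third kind with index $\nu$. The class contains the gamma distributions ($\mu=0$, $\nu>0$)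 and the inverse gamma distributions ($\lambda=0$, $\nu<0$). For a positive definite $(m\times m)$-matrix $\Sigma$ with $\det(\Sigma)=1$ and $\mathbf d,\mathbf c\in\mathbb R^m$, the $m$-dimensional generalized hyperbolic distribution is defined as $$GH_{\nu,\mu,\alpha,\mathbf d,\mathbf c,\Sigma}=N_{\mathbf c+z\Sigma\mathbf d,\,z\Sigma}\circ GIG\big(\nu,\mu,\sqrt{\alpha^2-\langle\mathbf d,\Sigma\mathbf d\rangle}\big),$$ where $\nu\in\mathbb R$, $\alpha,\mu\in[0,\infty)$ and: $\mu>0$, $0\le\langle\mathbf d,\Sigma\mathbf d\rangle\le\alpha^2$ if $\nu<0$; $\mu>0$, $0\le\langle\mathbf d,\Sigma\mathbf d\rangle<\alpha^2$ if $\nu=0$; $\mu\ge0$, $0\le\langle\mathbf d,\Sigma\mathbf d\rangle<\alpha^2$ if $\nu>0$.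
   Formalization: The limit law is proved with location −b instead of b, and with λ = sqrt(α² − ⟨a,Σ⁻¹a⟩) instead of sqrt(α² − ⟨a,Σa⟩); as printed the equivalence fails, e.g. for a = 0, b = 1 with normal sample means, or for Σ = diag(2,1/2), a = (1,0), b = 0. *)

theory Defs
  imports "HOL-Probability.Probability"
begin

section \<open>Laws of random vectors and weak convergence\<close>

definition char_fun :: "(real ^ 'm) measure \<Rightarrow> real ^ 'm \<Rightarrow> complex" where
  "char_fun M t = (CLINT x|M. iexp (t \<bullet> x))"

text \<open>The library's \<open>weak_conv_m\<close> is defined through distribution functions and covers
  only the real line; it is used for the real-valued laws.\<close>

definition weakly_converges :: "(nat \<Rightarrow> 'a::topological_space measure) \<Rightarrow> 'a measure \<Rightarrow> bool" where
  "weakly_converges L M \<longleftrightarrow>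
     (\<forall>f :: 'a \<Rightarrow> real. continuous_on UNIV f \<and> bounded (range f) \<longrightarrow>
        (\<lambda>n. LINT x|L n. f x) \<longlonglongrightarrow> (LINT x|M. f x))"

text \<open>The sequence \<open>s\<close> of indices is arbitrary: it may repeat members of the family.\<close>

definition weakly_relatively_compact :: "nat set \<Rightarrow> (nat \<Rightarrow> real measure) \<Rightarrow> bool" where
  "weakly_relatively_compact I L \<longleftrightarrow>
     (\<forall>s :: nat \<Rightarrow> nat. range s \<subseteq> I \<longrightarrow>
        (\<exists>r Q. strict_mono (r :: nat \<Rightarrow> nat) \<and> real_distribution Q \<and>
               weak_conv_m (\<lambda>k. L (s (r k))) Q))"

text \<open>The library's \<open>indep_var\<close> requires both variables to have the same type.\<close>

definition indep_rvs ::
    "'w measure \<Rightarrow> 'a measure \<Rightarrow> ('w \<Rightarrow> 'a) \<Rightarrow> 'b measure \<Rightarrow> ('w \<Rightarrow> 'b) \<Rightarrow> bool" where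
  "indep_rvs M S U S' V \<longleftrightarrow>
     U \<in> measurable M S \<and> V \<in> measurable M S' \<and>
     prob_space.indep_set M {U -` A \<inter> space M | A. A \<in> sets S}
                            {V -` B \<inter> space M | B. B \<in> sets S'}"

section \<open>Normal variance-mean mixtures and the generalized hyperbolic law\<close>

definition pos_def_matrix :: "real ^ 'm ^ 'm \<Rightarrow> bool" where
  "pos_def_matrix S \<longleftrightarrow> transpose S = S \<and> (\<forall>x. x \<noteq> 0 \<longrightarrow> 0 < x \<bullet> (S *v x))"

text \<open>Meaningful for positive definite \<open>S\<close> and for \<open>S = 0\<close>; no other covariance matrix
  arises as \<open>z\<Sigma>\<close> with \<open>z \<ge> 0\<close> and \<open>\<Sigma>\<close> positive definite.\<close>

definition multi_normal :: "real ^ 'm \<Rightarrow> real ^ 'm ^ 'm \<Rightarrow> (real ^ 'm) measure" where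
  "multi_normal c S =
     (if S = 0 then return borel c
      else density lborel (\<lambda>x. ennreal
        (exp (- ((x - c) \<bullet> (matrix_inv S *v (x - c))) / 2) / sqrt ((2 * pi) ^ CARD('m) * det S))))"

text \<open>The law \<open>A \<mapsto> \<integral> multi_normal (c + z d) (z S) A dG(z)\<close>, the integral being over
  \<open>z \<ge> 0\<close>.\<close>

definition normal_vm_mixture ::
    "real ^ 'm \<Rightarrow> real ^ 'm \<Rightarrow> real ^ 'm ^ 'm \<Rightarrow> real measure \<Rightarrow> (real ^ 'm) measure" where
  "normal_vm_mixture c d S G =
     restrict_space G {0..} \<bind> (\<lambda>z. multi_normal (c + z *\<^sub>R d) (z *\<^sub>R S))"

definition bessel_K :: "real \<Rightarrow> real \<Rightarrow> real" where
  "bessel_K \<nu> z = (1 / 2) * (LBINT y:{0<..}. y powr (\<nu> - 1) * exp (- (z / 2) * (y + 1 / y)))"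

text \<open>For \<open>\<mu> = 0\<close> (with \<open>\<nu> > 0\<close>) and for \<open>lam = 0\<close> (with \<open>\<nu> < 0\<close>) the normalizing constant
  is the limit of the generic one, by \<open>K\<^sub>\<nu>(z) \<sim> \<Gamma>(\<bar>\<nu>\<bar>) (2/z)\<^bsup>\<bar>\<nu>\<bar>\<^esup> / 2\<close> as \<open>z \<rightarrow> 0\<close>;
  these are the gamma and the inverse gamma laws.\<close>

definition gig_const :: "real \<Rightarrow> real \<Rightarrow> real \<Rightarrow> real" where
  "gig_const \<nu> \<mu> lam =
     (if \<mu> = 0 then (lam / 2) powr \<nu> / Gamma \<nu>
      else if lam = 0 then (\<mu> / 2) powr (- \<nu>) / Gamma (- \<nu>)
      else lam powr (\<nu> / 2) / (2 * \<mu> powr (\<nu> / 2) * bessel_K \<nu> (sqrt (\<mu> * lam))))"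

definition gig_density :: "real \<Rightarrow> real \<Rightarrow> real \<Rightarrow> real \<Rightarrow> real" where
  "gig_density \<nu> \<mu> lam x =
     (if 0 < x then gig_const \<nu> \<mu> lam * x powr (\<nu> - 1) * exp (- (\<mu> / x + lam * x) / 2) else 0)"

definition GIG :: "real \<Rightarrow> real \<Rightarrow> real \<Rightarrow> real measure" where
  "GIG \<nu> \<mu> lam = density lborel (\<lambda>x. ennreal (gig_density \<nu> \<mu> lam x))"

definition gh_parameters :: "real \<Rightarrow> real \<Rightarrow> real \<Rightarrow> real ^ 'm \<Rightarrow> real ^ 'm ^ 'm \<Rightarrow> bool" where
  "gh_parameters \<nu> \<mu> \<alpha> d S \<longleftrightarrow>
     pos_def_matrix S \<and> det S = 1 \<and> 0 \<le> \<alpha> \<and> 0 \<le> \<mu> \<and>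
     (\<nu> < 0 \<longrightarrow> 0 < \<mu> \<and> d \<bullet> (S *v d) \<le> \<alpha>\<^sup>2) \<and>
     (\<nu> = 0 \<longrightarrow> 0 < \<mu> \<and> d \<bullet> (S *v d) < \<alpha>\<^sup>2) \<and>
     (0 < \<nu> \<longrightarrow> d \<bullet> (S *v d) < \<alpha>\<^sup>2)"

definition GH ::
    "real \<Rightarrow> real \<Rightarrow> real \<Rightarrow> real ^ 'm \<Rightarrow> real ^ 'm \<Rightarrow> real ^ 'm ^ 'm \<Rightarrow> (real ^ 'm) measure" where
  "GH \<nu> \<mu> \<alpha> d c S = normal_vm_mixture c (S *v d) S (GIG \<nu> \<mu> (sqrt (\<alpha>\<^sup>2 - d \<bullet> (S *v d))))"

section \<open>Statistics and their normalization\<close>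

text \<open>\<open>T n k\<close> is a function of \<open>k\<close> observations, encoded as functions on \<open>{1..k}\<close>.\<close>

definition stat ::
    "(nat \<Rightarrow> nat \<Rightarrow> (nat \<Rightarrow> 'x) \<Rightarrow> 'y) \<Rightarrow> (nat \<Rightarrow> nat \<Rightarrow> 'w \<Rightarrow> 'x) \<Rightarrow> nat \<Rightarrow> nat \<Rightarrow> 'w \<Rightarrow> 'y" where
  "stat T X n k \<omega> = T n k (\<lambda>j\<in>{1..k}. X n j \<omega>)"

definition scale_b :: "(nat \<Rightarrow> real) \<Rightarrow> nat \<Rightarrow> nat \<Rightarrow> real" where
  "scale_b \<sigma> n k = inverse (\<sigma> n * sqrt (real k))"

definition shift_a :: "(nat \<Rightarrow> real) \<Rightarrow> (nat \<Rightarrow> real ^ 'm) \<Rightarrow> nat \<Rightarrow> nat \<Rightarrow> real ^ 'm" where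
  "shift_a \<sigma> a n k = (inverse (\<sigma> n * real k) * sqrt (real n)) *\<^sub>R a n"

definition scale_d :: "(nat \<Rightarrow> real) \<Rightarrow> nat \<Rightarrow> real" where
  "scale_d \<sigma> n = inverse (\<sigma> n * sqrt (real n))"

definition shift_c :: "(nat \<Rightarrow> real) \<Rightarrow> (nat \<Rightarrow> real ^ 'm) \<Rightarrow> nat \<Rightarrow> real ^ 'm" where
  "shift_c \<sigma> b n = inverse (\<sigma> n * sqrt (real n)) *\<^sub>R b n"

definition Y_vec ::
    "(nat \<Rightarrow> nat \<Rightarrow> (nat \<Rightarrow> 'x) \<Rightarrow> real ^ 'm) \<Rightarrow> (nat \<Rightarrow> nat \<Rightarrow> 'w \<Rightarrow> 'x) \<Rightarrow> (nat \<Rightarrow> real ^ 'm) \<Rightarrow>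
     (nat \<Rightarrow> real) \<Rightarrow> (nat \<Rightarrow> real ^ 'm) \<Rightarrow> nat \<Rightarrow> nat \<Rightarrow> 'w \<Rightarrow> real ^ 'm" where
  "Y_vec T X \<theta> \<sigma> a n k \<omega> =
     inverse (scale_b \<sigma> n k) *\<^sub>R (stat T X n k \<omega> - \<theta> n - shift_a \<sigma> a n k)"

text \<open>In closed form: \<open>Y = \<sigma>\<^sub>n \<surd>k (T - \<theta>) - \<surd>(n/k) a\<^sub>n\<close>, and normalizing with \<open>scale_d\<close> and
  \<open>shift_c\<close> gives \<open>\<sigma>\<^sub>n \<surd>n (T - \<theta>) - b\<^sub>n\<close>.\<close>

lemma Y_vec_closed_form:
  assumes "0 < \<sigma> n" "1 \<le> k"
  shows "Y_vec T X \<theta> \<sigma> a n k \<omega> =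
    (\<sigma> n * sqrt (real k)) *\<^sub>R (stat T X n k \<omega> - \<theta> n) - sqrt (real n / real k) *\<^sub>R a n"
proof -
  have k: "0 < real k" using assms by simp
  have "(\<sigma> n * sqrt (real k)) * (inverse (\<sigma> n * real k) * sqrt (real n)) = sqrt (real n / real k)"
    using assms k by (simp add: field_simps real_sqrt_divide flip: power2_eq_square)
  then show ?thesis
    by (simp add: Y_vec_def scale_b_def shift_a_def scaleR_diff_right)
qed

lemma random_size_closed_form:
  assumes "0 < \<sigma> n" "1 \<le> n"
  shows "inverse (scale_d \<sigma> n) *\<^sub>R (u - \<theta> n - shift_c \<sigma> b n) =
    (\<sigma> n * sqrt (real n)) *\<^sub>R (u - \<theta> n) - b n"
proof -
  have "(\<sigma> n * sqrt (real n)) * inverse (\<sigma> n * sqrt (real n)) = 1"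
    using assms by (intro right_inverse) simp
  then show ?thesis
    by (simp add: scale_d_def shift_c_def scaleR_diff_right del: inverse_mult_distrib)
qed

end

theory Submission
  imports Defs "HOL-Complex_Analysis.Complex_Analysis"
begin

text \<open>
  Put \<open>U\<^sub>n = n / N\<^sub>n\<close>, \<open>Z\<^sub>n = \<sigma>\<^sub>n \<surd>n (T - \<theta>\<^sub>n) - b\<^sub>n\<close> and
  \<open>s(t) = \<langle>t, \<Sigma>t\<rangle> / 2 - i \<langle>t, a\<rangle>\<close>. Since \<open>\<sigma>\<^sub>n \<surd>n (T - \<theta>\<^sub>n) = \<surd>U\<^sub>n Y + U\<^sub>n a\<^sub>n\<close> and \<open>Y\<close> is nearly
  \<open>N(0, \<Sigma>)\<close>, conditioning on \<open>N\<^sub>n\<close> shows that the characteristic function of \<open>Z\<^sub>n\<close> at \<open>t\<close> differs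
  from \<open>exp(- i \<langle>t, b\<^sub>n\<rangle>) E exp(- s(t) U\<^sub>n)\<close> by a quantity tending to zero. The approximation is uniform
  only on balls, and \<open>\<surd>U\<^sub>n t\<close> stays in a ball with probability close to one because \<open>U\<^sub>n\<close> is tight;
  this is \<open>char_fun_random_size_bound\<close>. The characteristic function of the generalized hyperbolic law is
  \<open>exp(- i \<langle>t, b\<rangle>) \<integral> exp(- s(t) z) dG(z)\<close> with \<open>G = GIG(\<nu>, \<mu>, lam)\<close> (\<open>char_fun_normal_vm_mixture\<close>).
  So everything reduces to comparing the law of \<open>U\<^sub>n\<close> with \<open>G\<close>, and \<open>G\<close> is the law of the reciprocal
  of a \<open>GIG(- \<nu>, lam, \<mu>)\<close> variable (\<open>GIG_reciprocal\<close>).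

  If \<open>N\<^sub>n / n\<close> converges to \<open>GIG(- \<nu>, lam, \<mu>)\<close>, then \<open>E exp(- s(t) U\<^sub>n)\<close> converges to
  \<open>\<integral> exp(- s(t) z) dG(z)\<close>, because \<open>Re s(t) \<ge> 0\<close> makes the integrand bounded and continuous; the
  multivariate continuity theorem \<open>char_fun_tendsto_imp_weakly_converges\<close> turns this into weak convergence
  of \<open>Z\<^sub>n\<close>.

  Conversely, convergence of \<open>Z\<^sub>n\<close> gives \<open>E exp(- s(t) U\<^sub>n) \<longlonglongrightarrow> \<integral> exp(- s(t) z) dG(z)\<close> for all \<open>t\<close>.
  Along a ray \<open>t = r e\<close> the points \<open>s(t)\<close> trace half of a parabola inside the right half-plane. The
  Laplace transform of a law on \<open>[0, \<infinity>)\<close> is holomorphic there, so its values on that curve determine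
  it, and its boundary values are the characteristic function of the law
  (\<open>laplace_parabola_unique\<close>). Every subsequential limit of the tight sequence \<open>U\<^sub>n\<close> is therefore \<open>G\<close>,
  and taking reciprocals gives the convergence of \<open>N\<^sub>n / n\<close>.
\<close>

section \<open>Linear images of Lebesgue measure and factorization of covariance matrices\<close>

lemma Basis_cart_eq: "(Basis :: (real ^ 'n) set) = (\<lambda>i. axis i 1) ` UNIV"
  by (auto simp: Basis_vec_def)

lemma inj_axis_1: "inj (\<lambda>i::'n::finite. axis i (1::real))"
  by (auto simp: inj_on_def axis_eq_axis)

lemma prod_Basis_cart: "(\<Prod>b\<in>(Basis :: (real ^ 'n) set). f b) = (\<Prod>i\<in>UNIV. f (axis i 1))"
  unfolding Basis_cart_eq by (subst prod.reindex[OF inj_axis_1]) simp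

lemma sum_Basis_cart: "(\<Sum>b\<in>(Basis :: (real ^ 'n) set). f b) = (\<Sum>i\<in>UNIV. f (axis i 1))"
  unfolding Basis_cart_eq by (subst sum.reindex[OF inj_axis_1]) simp

lemma inner_sum_Basis:
  "b \<in> Basis \<Longrightarrow> (\<Sum>i\<in>Basis. f i *\<^sub>R i) \<bullet> b = f b"
  by (simp add: inner_sum_left inner_Basis if_distrib[where f="\<lambda>x. _ * x"] cong: if_cong)

text \<open>Integrating first along \<open>e\<close>, a shear is for each value of the remaining coordinates a translation of the line.\<close>

lemma lborel_shear:
  fixes e u :: "'a::euclidean_space"
  assumes e: "e \<in> Basis" and u: "u \<in> Basis" and eu: "e \<noteq> u"
  shows "distr lborel borel (\<lambda>x. x + (x \<bullet> u) *\<^sub>R e) = lborel"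
proof (rule lborel_eqI[symmetric])
  fix l r :: 'a assume le: "\<And>b. b \<in> Basis \<Longrightarrow> l \<bullet> b \<le> r \<bullet> b"
  let ?B = "Basis - {e}"
  define g where "g b = (indicator {l \<bullet> b<..<r \<bullet> b} :: real \<Rightarrow> ennreal)" for b
  have g[measurable]: "g b \<in> borel_measurable borel" for b by (simp add: g_def)
  interpret product_sigma_finite "\<lambda>_::'a. lborel :: real measure" ..
  have ins: "insert e ?B = Basis" using e by auto
  have eq: "indicator (box l r) (x + (x \<bullet> u) *\<^sub>R e) = g e (x \<bullet> e + x \<bullet> u) * (\<Prod>b\<in>?B. g b (x \<bullet> b))" for x
  proof -
    have "indicator (box l r) y = (\<Prod>b\<in>Basis. g b (y \<bullet> b))" for y
      by (auto simp: g_def indicator_def box_def)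
    moreover have "(\<Prod>b\<in>Basis. g b ((x + (x \<bullet> u) *\<^sub>R e) \<bullet> b)) =
        g e ((x + (x \<bullet> u) *\<^sub>R e) \<bullet> e) * (\<Prod>b\<in>?B. g b ((x + (x \<bullet> u) *\<^sub>R e) \<bullet> b))"
      using e by (simp add: prod.remove)
    moreover have "(\<Prod>b\<in>?B. g b ((x + (x \<bullet> u) *\<^sub>R e) \<bullet> b)) = (\<Prod>b\<in>?B. g b (x \<bullet> b))"
      using e by (intro prod.cong) (auto simp: inner_add_left inner_not_same_Basis)
    ultimately show ?thesis using e by (simp add: inner_add_left inner_Basis)
  qed
  have "emeasure (distr lborel borel (\<lambda>x. x + (x \<bullet> u) *\<^sub>R e)) (box l r)
     = (\<integral>\<^sup>+x. indicator (box l r) (x + (x \<bullet> u) *\<^sub>R e) \<partial>lborel)"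
    using nn_integral_distr[of "\<lambda>x. x + (x \<bullet> u) *\<^sub>R e" lborel borel "indicator (box l r)"] by simp
  also have "\<dots> = (\<integral>\<^sup>+x. g e (x \<bullet> e + x \<bullet> u) * (\<Prod>b\<in>?B. g b (x \<bullet> b)) \<partial>lborel)"
    by (simp add: eq)
  also have "\<dots> = (\<integral>\<^sup>+f. g e (f e + f u) * (\<Prod>b\<in>?B. g b (f b)) \<partial>(\<Pi>\<^sub>M b\<in>Basis. lborel))"
    using e u by (subst lborel_eq, subst nn_integral_distr)
      (auto intro!: nn_integral_cong prod.cong simp: inner_sum_Basis)
  also have "\<dots> = (\<integral>\<^sup>+f. (\<integral>\<^sup>+y. g e ((f(e := y)) e + (f(e := y)) u) * (\<Prod>b\<in>?B. g b ((f(e := y)) b)) \<partial>lborel) \<partial>(\<Pi>\<^sub>M b\<in>?B. lborel))"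
    using e u by (intro product_nn_integral_insert[of ?B e, unfolded ins]) auto
  also have "\<dots> = (\<integral>\<^sup>+f. (\<integral>\<^sup>+y. g e (f u + 1 * y) * (\<Prod>b\<in>?B. g b (f b)) \<partial>lborel) \<partial>(\<Pi>\<^sub>M b\<in>?B. lborel))"
    using eu by (intro nn_integral_cong arg_cong2[where f="(*)"] prod.cong) (auto simp: add.commute)
  also have "\<dots> = (\<integral>\<^sup>+f. (\<integral>\<^sup>+y. g e y \<partial>lborel) * (\<Prod>b\<in>?B. g b (f b)) \<partial>(\<Pi>\<^sub>M b\<in>?B. lborel))"
  proof (intro nn_integral_cong)
    fix f :: "'a \<Rightarrow> real"
    have "(\<integral>\<^sup>+y. g e (f u + 1 * y) \<partial>lborel) = (\<integral>\<^sup>+y. g e y \<partial>lborel)"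
      using nn_integral_real_affine[of "g e" 1 "f u"] by simp
    then show "(\<integral>\<^sup>+y. g e (f u + 1 * y) * (\<Prod>b\<in>?B. g b (f b)) \<partial>lborel)
        = (\<integral>\<^sup>+y. g e y \<partial>lborel) * (\<Prod>b\<in>?B. g b (f b))"
      by (simp add: nn_integral_multc)
  qed
  also have "\<dots> = (\<integral>\<^sup>+y. g e y \<partial>lborel) * (\<Prod>b\<in>?B. \<integral>\<^sup>+y. g b y \<partial>lborel)"
    by (subst nn_integral_cmult) (auto simp: product_nn_integral_prod)
  also have "\<dots> = (\<Prod>b\<in>Basis. \<integral>\<^sup>+y. g b y \<partial>lborel)"
    using e by (simp add: prod.remove)
  also have "\<dots> = (\<Prod>b\<in>Basis. ennreal ((r - l) \<bullet> b))"
    using le by (intro prod.cong) (auto simp: g_def inner_diff_left)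
  also have "\<dots> = (\<Prod>b\<in>Basis. (r - l) \<bullet> b)"
    using le by (intro prod_ennreal) (auto simp: inner_diff_left)
  finally show "emeasure (distr lborel borel (\<lambda>x. x + (x \<bullet> u) *\<^sub>R e)) (box l r) = (\<Prod>b\<in>Basis. (r - l) \<bullet> b)" .
qed simp

text \<open>Induction over elementary matrices: permutations and diagonal maps carry boxes to boxes, singular factors
  are excluded by the determinant, and the remaining generators are shears.\<close>

lemma lborel_linear_image:
  fixes f :: "real ^ 'n \<Rightarrow> real ^ 'n"
  assumes "linear f" "det (matrix f) \<noteq> 0"
  shows "lborel = density (distr lborel borel f) (\<lambda>_. \<bar>det (matrix f)\<bar>)"
proof -
  have "det (matrix f) \<noteq> 0 \<longrightarrow> lborel = density (distr lborel borel f) (\<lambda>_. \<bar>det (matrix f)\<bar>)"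
  proof (rule induct_linear_elementary[OF assms(1)])
    fix f g :: "real ^ 'n \<Rightarrow> real ^ 'n"
    assume lin: "linear f" "linear g"
      and f: "det (matrix f) \<noteq> 0 \<longrightarrow> lborel = density (distr lborel borel f) (\<lambda>_. \<bar>det (matrix f)\<bar>)"
      and g: "det (matrix g) \<noteq> 0 \<longrightarrow> lborel = density (distr lborel borel g) (\<lambda>_. \<bar>det (matrix g)\<bar>)"
    have m[measurable]: "f \<in> borel_measurable borel" "g \<in> borel_measurable borel"
      using lin by (auto intro!: borel_measurable_continuous_onI linear_continuous_on linear_conv_bounded_linear[THEN iffD1])
    show "det (matrix (f \<circ> g)) \<noteq> 0 \<longrightarrow> lborel = density (distr lborel borel (f \<circ> g)) (\<lambda>_. \<bar>det (matrix (f \<circ> g))\<bar>)"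
    proof
      assume "det (matrix (f \<circ> g)) \<noteq> 0"
      then have nz: "det (matrix f) \<noteq> 0" "det (matrix g) \<noteq> 0"
        and d: "det (matrix (f \<circ> g)) = det (matrix f) * det (matrix g)"
        using lin by (auto simp: matrix_compose det_mul)
      have "density (distr lborel borel (f \<circ> g)) (\<lambda>_. \<bar>det (matrix (f \<circ> g))\<bar>)
        = density (density (distr (distr lborel borel g) borel f) (\<lambda>_. \<bar>det (matrix g)\<bar>)) (\<lambda>_. \<bar>det (matrix f)\<bar>)"
        by (subst density_density_eq) (auto simp: distr_distr d abs_mult ennreal_mult mult.commute)
      also have "density (distr (distr lborel borel g) borel f) (\<lambda>_. \<bar>det (matrix g)\<bar>)
        = distr (density (distr lborel borel g) (\<lambda>_. \<bar>det (matrix g)\<bar>)) borel f"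
        by (subst density_distr) auto
      also have "\<dots> = distr lborel borel f" using g nz by simp
      also have "density (distr lborel borel f) (\<lambda>_. \<bar>det (matrix f)\<bar>) = lborel" using f nz by simp
      finally show "lborel = density (distr lborel borel (f \<circ> g)) (\<lambda>_. \<bar>det (matrix (f \<circ> g))\<bar>)" ..
    qed
  next
    fix f :: "real ^ 'n \<Rightarrow> real ^ 'n" and i assume "\<And>x. f x $ i = 0"
    then have "det (matrix f) = 0"
      by (intro det_zero_row(2)[of i]) (simp add: row_def matrix_def vec_eq_iff)
    then show "det (matrix f) \<noteq> 0 \<longrightarrow> lborel = density (distr lborel borel f) (\<lambda>_. \<bar>det (matrix f)\<bar>)" by simp
  next
    fix c :: "'n \<Rightarrow> real"
    let ?f = "\<lambda>x::real^'n. \<chi> i. c i * x $ i"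
    have d: "det (matrix ?f) = prod c UNIV"
      by (subst det_diagonal) (auto simp: matrix_def axis_def)
    show "det (matrix ?f) \<noteq> 0 \<longrightarrow> lborel = density (distr lborel borel ?f) (\<lambda>_. \<bar>det (matrix ?f)\<bar>)"
    proof
      assume "det (matrix ?f) \<noteq> 0"
      then have nz: "c i \<noteq> 0" for i using d by auto
      define c' where "c' b = (\<chi> i. c i) \<bullet> b" for b
      have c': "c' (axis i 1) = c i" for i by (simp add: c'_def inner_axis)
      have "(\<Sum>j\<in>Basis. (c' j * (x \<bullet> j)) *\<^sub>R j) = (\<Sum>i\<in>UNIV. (c i * x $ i) *\<^sub>R axis i 1)" for x
        by (simp add: sum_Basis_cart c' inner_axis)
      then have f: "?f = (\<lambda>x. 0 + (\<Sum>j\<in>Basis. (c' j * (x \<bullet> j)) *\<^sub>R j))"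
        using basis_expansion[of "\<chi> i. c i * x $ i" for x] by (simp add: scalar_mult_eq_scaleR)
      have "(\<Prod>j\<in>(Basis :: (real^'n) set). \<bar>c' j\<bar>) = \<bar>prod c UNIV\<bar>"
        by (simp add: prod_Basis_cart c' abs_prod)
      then show "lborel = density (distr lborel borel ?f) (\<lambda>_. \<bar>det (matrix ?f)\<bar>)"
        unfolding d unfolding f using nz
        by (subst lborel_affine_euclidean[of c' 0]) (auto simp: Basis_cart_eq c' prod_ennreal)
    qed
  next
    fix m n :: 'n assume mn: "m \<noteq> n"
    let ?p = "Transposition.transpose m n"
    let ?f = "\<lambda>x::real^'n. \<chi> i. x $ ?p i"
    have "matrix ?f = (\<chi> i. mat 1 $ ?p i)"
      by (auto simp: matrix_def vec_eq_iff axis_def mat_def)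
    moreover have "det (\<chi> i. (mat 1 :: real^'n^'n) $ ?p i) = of_int (sign ?p) * det (mat 1 :: real^'n^'n)"
      by (rule det_permute_rows) (simp add: permutes_swap_id)
    ultimately have d: "\<bar>det (matrix ?f)\<bar> = 1" using mn by (simp add: sign_swap_id)
    have m: "?f \<in> borel_measurable borel"
      by (intro borel_measurable_continuous_onI continuous_intros)
    have "lborel = distr lborel borel ?f"
    proof (rule lborel_eqI)
      fix l u :: "real^'n" assume le: "\<And>b. b \<in> Basis \<Longrightarrow> l \<bullet> b \<le> u \<bullet> b"
      then have le': "l $ i \<le> u $ i" for i using le[of "axis i 1"] by (simp add: inner_axis)
      have "?f -` box l u = box (?f l) (?f u)"
      proof (intro set_eqI)
        fix x :: "real^'n"
        have "(\<forall>i. l $ i < x $ ?p i \<and> x $ ?p i < u $ i) \<longleftrightarrow> (\<forall>i. l $ ?p i < x $ i \<and> x $ i < u $ ?p i)"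
          by (metis transpose_involutory)
        then show "x \<in> ?f -` box l u \<longleftrightarrow> x \<in> box (?f l) (?f u)"
          by (simp add: mem_box_cart)
      qed
      then have "emeasure (distr lborel borel ?f) (box l u) = emeasure lborel (box (?f l) (?f u))"
        using m by (simp add: emeasure_distr)
      also have "\<dots> = (\<Prod>b\<in>Basis. (?f u - ?f l) \<bullet> b)"
        by (intro emeasure_lborel_box) (auto simp: Basis_vec_def inner_axis le')
      also have "\<dots> = (\<Prod>i\<in>UNIV. u $ ?p i - l $ ?p i)"
        by (simp add: prod_Basis_cart inner_axis)
      also have "\<dots> = (\<Prod>i\<in>UNIV. u $ i - l $ i)"
        using prod.reindex_bij_betw[OF permutes_imp_bij[OF permutes_swap_id], of m UNIV n "\<lambda>i. u $ i - l $ i"]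
        by simp
      also have "\<dots> = (\<Prod>b\<in>Basis. (u - l) \<bullet> b)"
        by (simp add: prod_Basis_cart inner_axis)
      finally show "emeasure (distr lborel borel ?f) (box l u) = (\<Prod>b\<in>Basis. (u - l) \<bullet> b)" .
    qed simp
    then show "det (matrix ?f) \<noteq> 0 \<longrightarrow> lborel = density (distr lborel borel ?f) (\<lambda>_. \<bar>det (matrix ?f)\<bar>)"
      using d by (simp add: density_1)
  next
    fix m n :: 'n assume mn: "m \<noteq> n"
    let ?f = "\<lambda>x::real^'n. \<chi> i. if i = m then x $ m + x $ n else x $ i"
    have "matrix ?f = (\<chi> k. if k = m then row m (mat 1) + 1 *s row n (mat 1) else row k (mat 1))"
      by (auto simp: matrix_def vec_eq_iff axis_def mat_def row_def)
    then have d: "det (matrix ?f) = 1"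
      using det_row_operation[OF mn, of "mat 1 :: real^'n^'n" 1] by simp
    have f: "?f = (\<lambda>x. x + (x \<bullet> axis n 1) *\<^sub>R axis m 1)"
      by (simp add: inner_axis) (simp add: vec_eq_iff axis_def fun_eq_iff)
    have "distr lborel borel ?f = lborel"
      unfolding f using mn by (intro lborel_shear) (auto simp: axis_in_Basis_iff axis_eq_axis)
    then show "det (matrix ?f) \<noteq> 0 \<longrightarrow> lborel = density (distr lborel borel ?f) (\<lambda>_. \<bar>det (matrix ?f)\<bar>)"
      using d by (simp add: density_1)
  qed
  then show ?thesis using assms by simp
qed

text \<open>Gram-Schmidt for the scalar product \<open>\<langle>x, S y\<rangle>\<close>: fewer than \<open>m\<close> vectors \<open>S v\<^sub>i\<close> do not span, so some
  \<open>x \<noteq> 0\<close> is orthogonal to all of them, and it can be normalized because \<open>S\<close> is positive definite.\<close>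

lemma pos_def_orthonormal_family:
  fixes S :: "real ^ 'm ^ 'm" and I :: "'m set"
  assumes S: "pos_def_matrix S"
  shows "\<exists>v. \<forall>i\<in>I. \<forall>j\<in>I. v i \<bullet> (S *v v j) = (if i = j then 1 else 0)"
proof (induction I rule: finite_induct[OF finite])
  case 1 show ?case by simp
next
  case (2 k I)
  then obtain v where v: "\<And>i j. i \<in> I \<Longrightarrow> j \<in> I \<Longrightarrow> v i \<bullet> (S *v v j) = (if i = j then 1 else 0)"
    by metis
  have sym: "x \<bullet> (S *v y) = y \<bullet> (S *v x)" for x y
    using S by (metis dot_lmul_matrix inner_commute pos_def_matrix_def transpose_matrix_vector)
  let ?D = "(\<lambda>i. S *v v i) ` I"
  have "dim ?D \<le> card I" by (intro order_trans[OF dim_le_card'] card_image_le) auto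
  also have "card I < card (insert k I)" using 2 by simp
  also have "\<dots> \<le> CARD('m)" by (intro card_mono) auto
  finally have "dim ?D < DIM(real ^ 'm)" by simp
  then obtain x where x: "x \<noteq> 0" "\<And>y. y \<in> span ?D \<Longrightarrow> orthogonal x y"
    using orthogonal_to_subspace_exists[of ?D] by metis
  define q where "q = x \<bullet> (S *v x)"
  have q: "q > 0" using S x(1) by (auto simp: pos_def_matrix_def q_def)
  define w where "w = (1 / sqrt q) *\<^sub>R x"
  have ww: "w \<bullet> (S *v w) = 1"
    using q by (simp add: w_def matrix_vector_mult_scaleR flip: q_def)
  have wv: "w \<bullet> (S *v v i) = 0" if "i \<in> I" for i
    using x(2)[of "S *v v i"] that by (auto simp: w_def orthogonal_def intro: span_base)
  have vw: "v i \<bullet> (S *v w) = 0" if "i \<in> I" for i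
    using wv[OF that] sym[of "v i" w] by simp
  show ?case
    by (rule exI[of _ "v(k := w)"]) (use v ww wv vw 2 in auto)
qed

text \<open>If the columns of \<open>V\<close> are orthonormal for the form \<open>S\<close>, then \<open>V\<^sup>T S V = 1\<close>, hence
  \<open>S = (S V) (S V)\<^sup>T\<close>. The factor turns a standard normal vector into one with covariance \<open>S\<close>.\<close>

lemma pos_def_factorization:
  fixes S :: "real ^ 'm ^ 'm"
  assumes S: "pos_def_matrix S"
  shows "\<exists>W :: real ^ 'm ^ 'm. S = W ** transpose W"
proof -
  obtain v where v: "\<And>i j::'m. v i \<bullet> (S *v v j) = (if i = j then 1 else 0)"
    using pos_def_orthonormal_family[OF S, of UNIV] by auto
  define V :: "real ^ 'm ^ 'm" where "V = (\<chi> r c. v c $ r)"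
  let ?A = "S ** V"
  have "transpose V ** ?A = mat 1"
    using v by (simp add: vec_eq_iff matrix_matrix_mult_def matrix_vector_mult_def inner_vec_def V_def transpose_def mat_def)
  then have "?A ** transpose V = mat 1" using matrix_left_right_inverse by blast
  then have "transpose (?A ** transpose V) = mat 1" by (simp add: transpose_mat)
  then have "V ** transpose ?A = mat 1" by (simp add: matrix_transpose_mul)
  then have "S = ?A ** transpose ?A" by (metis matrix_mul_assoc matrix_mul_rid)
  then show ?thesis ..
qed

section \<open>Multivariate normal laws\<close>

lemma matrix_inv_right: "invertible A \<Longrightarrow> A ** matrix_inv A = mat 1"
  and matrix_inv_left: "invertible A \<Longrightarrow> matrix_inv A ** A = mat 1"
  for A :: "real ^ 'n ^ 'n"
  unfolding invertible_def matrix_inv_def by (metis (mono_tags, lifting) someI_ex)+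

definition std_gaussian :: "(real ^ 'm) measure" where
  "std_gaussian = density lborel (\<lambda>x. ennreal (exp (- (x \<bullet> x) / 2) / sqrt ((2 * pi) ^ CARD('m))))"

lemma space_std_gaussian[simp]: "space std_gaussian = UNIV"
  and sets_std_gaussian[simp, measurable_cong]: "sets std_gaussian = sets borel"
  by (simp_all add: std_gaussian_def)

text \<open>The density splits over coordinates, which reduces mass and characteristic function to dimension one.\<close>

lemma std_gaussian_density_prod:
  fixes x :: "real ^ 'm"
  shows "exp (- (x \<bullet> x) / 2) / sqrt ((2 * pi) ^ CARD('m)) = (\<Prod>b\<in>Basis. std_normal_density (x \<bullet> b))"
proof -
  have "(\<Prod>b\<in>Basis. std_normal_density (x \<bullet> b)) = (\<Prod>b\<in>(Basis :: (real^'m) set). 1 / sqrt (2 * pi)) * (\<Prod>b\<in>Basis. exp (- (x \<bullet> b)\<^sup>2 / 2))"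
    by (simp only: std_normal_density_def prod.distrib)
  also have "(\<Prod>b\<in>Basis. exp (- (x \<bullet> b)\<^sup>2 / 2)) = exp (- (x \<bullet> x) / 2)"
    by (subst euclidean_inner[of x x]) (simp add: sum_divide_distrib power2_eq_square flip: exp_sum sum_negf)
  also have "(\<Prod>b\<in>(Basis :: (real^'m) set). 1 / sqrt (2 * pi)) = 1 / sqrt ((2 * pi) ^ CARD('m))"
    by (simp only: prod_constant DIM_cart DIM_real mult_1_right power_one_over real_sqrt_power)
  finally show ?thesis by simp
qed

lemma prob_space_std_gaussian: "prob_space (std_gaussian :: (real ^ 'm) measure)"
proof
  have "emeasure (std_gaussian :: (real ^ 'm) measure) UNIV
      = (\<integral>\<^sup>+x. (\<Prod>b\<in>Basis. ennreal (std_normal_density (x \<bullet> b))) \<partial>(lborel :: (real ^ 'm) measure))"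
    unfolding std_gaussian_def std_gaussian_density_prod
    by (subst emeasure_density) (auto simp: prod_ennreal)
  also have "\<dots> = (\<Prod>b\<in>(Basis :: (real ^ 'm) set). \<integral>\<^sup>+x. std_normal_density x \<partial>lborel)"
    by (rule nn_integral_lborel_prod) auto
  also have "(\<integral>\<^sup>+x. std_normal_density x \<partial>lborel) = 1"
    by (subst nn_integral_eq_integral) auto
  finally show "emeasure (std_gaussian :: (real ^ 'm) measure) (space std_gaussian) = 1" by simp
qed

lemma char_fun_std_gaussian:
  fixes t :: "real ^ 'm"
  shows "char_fun std_gaussian t = of_real (exp (- (t \<bullet> t) / 2))"
proof -
  interpret product_sigma_finite "\<lambda>_::real ^ 'm. lborel :: real measure" ..
  let ?g = "\<lambda>b y. std_normal_density y *\<^sub>R iexp ((t \<bullet> b) * y)"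
  have int: "integrable lborel (?g b)" for b
    by (rule Bochner_Integration.integrable_bound[OF integrable_normal_density[of 1 0]]) auto
  have "char_fun std_gaussian t =
      (\<integral>x. (\<Prod>b\<in>Basis. std_normal_density (x \<bullet> b)) *\<^sub>R iexp (t \<bullet> x) \<partial>lborel)"
    unfolding char_fun_def std_gaussian_def std_gaussian_density_prod
    by (subst integral_density) (auto intro!: prod_nonneg)
  also have "\<dots> = (\<integral>x. (\<Prod>b\<in>Basis. ?g b (x \<bullet> b)) \<partial>lborel)"
  proof (intro Bochner_Integration.integral_cong refl)
    fix x :: "real ^ 'm"
    have "iexp (t \<bullet> x) = (\<Prod>b\<in>Basis. iexp ((t \<bullet> b) * (x \<bullet> b)))"
      by (subst euclidean_inner[of t x]) (simp add: exp_sum sum_distrib_left)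
    then show "(\<Prod>b\<in>Basis. std_normal_density (x \<bullet> b)) *\<^sub>R iexp (t \<bullet> x) = (\<Prod>b\<in>Basis. ?g b (x \<bullet> b))"
      by (simp add: scaleR_conv_of_real prod.distrib)
  qed
  also have "\<dots> = (\<integral>f. (\<Prod>b\<in>Basis. ?g b (f b)) \<partial>(\<Pi>\<^sub>M b\<in>Basis. lborel))"
    by (subst lborel_eq, subst integral_distr)
      (auto intro!: Bochner_Integration.integral_cong prod.cong simp: inner_sum_Basis)
  also have "\<dots> = (\<Prod>b\<in>Basis. \<integral>y. ?g b y \<partial>lborel)"
    using int by (intro product_integral_prod) auto
  also have "\<dots> = (\<Prod>b\<in>Basis. char std_normal_distribution (t \<bullet> b))"
    unfolding char_def by (intro prod.cong refl, subst integral_density) auto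
  also have "\<dots> = (\<Prod>b\<in>Basis. of_real (exp (- (t \<bullet> b)\<^sup>2 / 2)))"
    by (simp add: char_std_normal_distribution)
  also have "\<dots> = of_real (\<Prod>b\<in>Basis. exp (- (t \<bullet> b)\<^sup>2 / 2))" by simp
  also have "(\<Prod>b\<in>Basis. exp (- (t \<bullet> b)\<^sup>2 / 2)) = exp (- (t \<bullet> t) / 2)"
    by (subst euclidean_inner[of t t]) (simp add: sum_divide_distrib power2_eq_square flip: exp_sum sum_negf)
  finally show ?thesis .
qed

lemma borel_measurable_matrix_vector[measurable]:
  fixes W :: "real ^ 'n ^ 'm"
  shows "(\<lambda>y. W *v y) \<in> borel_measurable borel"
  by (intro borel_measurable_continuous_onI linear_continuous_on linear_conv_bounded_linear[THEN iffD1] matrix_vector_mul_linear)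

text \<open>Change of variables \<open>x = c + W y\<close>: the Jacobian \<open>\<bar>det W\<bar>\<close> equals \<open>\<surd>(det S)\<close> and the quadratic form of
  \<open>S\<^sup>-\<^sup>1\<close> at \<open>W y\<close> is \<open>\<langle>y, y\<rangle>\<close>.\<close>

lemma multi_normal_eq_distr:
  fixes W :: "real ^ 'm ^ 'm"
  assumes S: "pos_def_matrix S" and W: "S = W ** transpose W"
  shows "multi_normal c S = distr std_gaussian borel (\<lambda>y. c + W *v y)"
proof -
  let ?T = "\<lambda>y. c + W *v y"
  let ?h = "\<lambda>x. exp (- ((x - c) \<bullet> (matrix_inv S *v (x - c))) / 2) / sqrt ((2 * pi) ^ CARD('m) * det S)"
  have inj: "x = 0" if "S *v x = 0" for x
    using S that by (metis inner_zero_right less_irrefl pos_def_matrix_def)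
  then have invS: "invertible S"
    using invertible_left_inverse matrix_left_invertible_ker by blast
  then have "det S \<noteq> 0" by (simp add: invertible_det_nz)
  moreover have detS: "det S = (det W)\<^sup>2" by (simp add: W det_mul power2_eq_square)
  ultimately have detW: "det W \<noteq> 0" by auto
  then have invW: "invertible W" by (simp add: invertible_det_nz)
  have S0: "S \<noteq> 0" using inj[of 1] by auto
  have quad: "(W *v y) \<bullet> (matrix_inv S *v (W *v y)) = y \<bullet> y" for y
  proof -
    let ?z = "matrix_inv S *v (W *v y)"
    have "S *v ?z = W *v y"
      using matrix_inv_right[OF invS] by (simp add: matrix_vector_mul_assoc matrix_mul_assoc)
    then have "W *v (transpose W *v ?z) = W *v y" by (metis W matrix_vector_mul_assoc)
    then have "transpose W *v ?z = y"
      using invW by (metis matrix_inv_left matrix_vector_mul_assoc matrix_vector_mul_lid)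
    then show ?thesis by (metis dot_lmul_matrix inner_commute transpose_matrix_vector)
  qed
  have T: "?T \<in> borel_measurable borel" by measurable
  have lb: "lborel = density (distr lborel borel ?T) (\<lambda>_. \<bar>det W\<bar>)"
  proof -
    have "lborel = distr lborel borel ((+) c)" by (simp add: lborel_distr_plus)
    also have "\<dots> = distr (density (distr lborel borel ((*v) W)) (\<lambda>_. \<bar>det W\<bar>)) borel ((+) c)"
      using lborel_linear_image[OF matrix_vector_mul_linear, of W] detW by simp
    also have "\<dots> = density (distr (distr lborel borel ((*v) W)) borel ((+) c)) (\<lambda>_. \<bar>det W\<bar>)"
      by (subst density_distr) auto
    also have "distr (distr lborel borel ((*v) W)) borel ((+) c) = distr lborel borel ?T"
      by (subst distr_distr) (auto simp: comp_def)
    finally show ?thesis .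
  qed
  have "multi_normal c S = density lborel (\<lambda>x. ennreal (?h x))" using S0 by (simp add: multi_normal_def)
  also have "\<dots> = density (density (distr lborel borel ?T) (\<lambda>_. \<bar>det W\<bar>)) (\<lambda>x. ennreal (?h x))"
    using lb by simp
  also have "\<dots> = density (distr lborel borel ?T) (\<lambda>x. ennreal \<bar>det W\<bar> * ennreal (?h x))"
    by (subst density_density_eq) auto
  also have "\<dots> = distr (density lborel (\<lambda>y. ennreal \<bar>det W\<bar> * ennreal (?h (?T y)))) borel ?T"
    by (subst density_distr) auto
  also have "(\<lambda>y. ennreal \<bar>det W\<bar> * ennreal (?h (?T y))) =
      (\<lambda>y. ennreal (exp (- (y \<bullet> y) / 2) / sqrt ((2 * pi) ^ CARD('m))))"
    using detW by (simp add: fun_eq_iff quad detS real_sqrt_mult flip: ennreal_mult')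
  finally show ?thesis by (simp add: std_gaussian_def)
qed

lemma char_fun_affine_gaussian:
  fixes W :: "real ^ 'm ^ 'm"
  shows "(\<integral>y. iexp (t \<bullet> (c + r *\<^sub>R (W *v y))) \<partial>std_gaussian) =
     exp (\<i> * of_real (t \<bullet> c) - of_real (r\<^sup>2 * (t \<bullet> ((W ** transpose W) *v t)) / 2))"
proof -
  let ?u = "r *\<^sub>R (transpose W *v t)"
  have tW: "t \<bullet> (W *v y) = (transpose W *v t) \<bullet> y" for y
    by (simp add: dot_lmul_matrix transpose_matrix_vector)
  have "t \<bullet> (c + r *\<^sub>R (W *v y)) = t \<bullet> c + ?u \<bullet> y" for y
    by (simp add: inner_add_right tW)
  then have "(\<integral>y. iexp (t \<bullet> (c + r *\<^sub>R (W *v y))) \<partial>std_gaussian) = (\<integral>y. iexp (t \<bullet> c) * iexp (?u \<bullet> y) \<partial>std_gaussian)"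
    by (simp add: distrib_left exp_add)
  also have "\<dots> = iexp (t \<bullet> c) * char_fun std_gaussian ?u" by (simp add: char_fun_def)
  also have "char_fun std_gaussian ?u = of_real (exp (- (?u \<bullet> ?u) / 2))" by (rule char_fun_std_gaussian)
  also have "?u \<bullet> ?u = r\<^sup>2 * (t \<bullet> ((W ** transpose W) *v t))"
    using tW[of "transpose W *v t"] by (simp add: power2_eq_square matrix_vector_mul_assoc[symmetric])
  finally show ?thesis
    by (simp only: exp_diff divide_inverse[of "iexp _"] exp_of_real exp_minus of_real_inverse minus_divide_left[symmetric])
qed

section \<open>The continuity theorem for characteristic functions on \<open>\<real>\<^sup>m\<close>\<close>

lemma cmod_char_fun_le_1:
  assumes "prob_space Q"
  shows "cmod (char_fun Q t) \<le> 1"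
proof -
  interpret prob_space Q by fact
  have "cmod (char_fun Q t) \<le> (\<integral>x. cmod (iexp (t \<bullet> x)) \<partial>Q)"
    unfolding char_fun_def by (rule integral_norm_bound)
  then show ?thesis by (simp add: prob_space)
qed

lemma borel_measurable_char_fun:
  fixes Q :: "(real ^ 'm) measure"
  assumes "prob_space Q" and [measurable_cong]: "sets Q = sets borel"
  shows "char_fun Q \<in> borel_measurable borel"
proof -
  interpret prob_space Q by fact
  show ?thesis unfolding char_fun_def by measurable
qed

text \<open>A Gaussian kernel is itself a characteristic function, of a Gaussian vector \<open>y\<close>; by Fubini its mean under
  \<open>Q\<close> depends on \<open>Q\<close> only through \<open>char_fun Q\<close>.\<close>

lemma gaussian_kernel_char_fun:
  fixes Q :: "(real ^ 'm) measure"
  assumes Q: "prob_space Q" and sets[measurable_cong]: "sets Q = sets borel" and e: "0 < e"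
  shows "complex_of_real (\<integral>z. exp (- (norm (x - z))\<^sup>2 / (2 * e\<^sup>2)) \<partial>Q) =
    (\<integral>y. iexp ((x \<bullet> y) / e) * char_fun Q (- (1 / e) *\<^sub>R y) \<partial>std_gaussian)"
proof -
  interpret Q: prob_space Q by fact
  interpret G: prob_space "std_gaussian :: (real ^ 'm) measure" by (rule prob_space_std_gaussian)
  interpret P: pair_prob_space Q "std_gaussian :: (real ^ 'm) measure" ..
  let ?F = "\<lambda>(z, y). iexp (((1 / e) *\<^sub>R (x - z)) \<bullet> y)"
  have int: "integrable (Q \<Otimes>\<^sub>M std_gaussian) ?F"
    by (rule P.integrable_const_bound[of _ 1]) (auto simp: split_beta)
  have k: "complex_of_real (exp (- (norm (x - z))\<^sup>2 / (2 * e\<^sup>2))) = (\<integral>y. ?F (z, y) \<partial>std_gaussian)" for z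
  proof -
    have "(\<integral>y. ?F (z, y) \<partial>std_gaussian) = char_fun std_gaussian ((1 / e) *\<^sub>R (x - z))"
      by (simp add: char_fun_def)
    also have "((1 / e) *\<^sub>R (x - z)) \<bullet> ((1 / e) *\<^sub>R (x - z)) = (norm (x - z))\<^sup>2 / e\<^sup>2"
      by (simp add: power2_norm_eq_inner power2_eq_square[of e])
    then have "char_fun std_gaussian ((1 / e) *\<^sub>R (x - z)) = complex_of_real (exp (- (norm (x - z))\<^sup>2 / (2 * e\<^sup>2)))"
      unfolding char_fun_std_gaussian by simp
    finally show ?thesis ..
  qed
  have "complex_of_real (\<integral>z. exp (- (norm (x - z))\<^sup>2 / (2 * e\<^sup>2)) \<partial>Q) = (\<integral>z. (\<integral>y. ?F (z, y) \<partial>std_gaussian) \<partial>Q)"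
    by (simp only: k flip: integral_complex_of_real)
  also have "\<dots> = (\<integral>y. (\<integral>z. ?F (z, y) \<partial>Q) \<partial>std_gaussian)"
    using P.Fubini_integral[of "\<lambda>z y. ?F (z, y)"] int by (simp add: split_beta)
  also have "\<dots> = (\<integral>y. iexp ((x \<bullet> y) / e) * char_fun Q (- (1 / e) *\<^sub>R y) \<partial>std_gaussian)"
  proof (intro Bochner_Integration.integral_cong refl)
    fix y :: "real ^ 'm"
    have "?F (z, y) = iexp ((x \<bullet> y) / e) * iexp ((- (1 / e) *\<^sub>R y) \<bullet> z)" for z
      by (simp add: exp_add[symmetric] inner_diff_left inner_commute[of y z] diff_divide_distrib right_diff_distrib)
    then show "(\<integral>z. ?F (z, y) \<partial>Q) = iexp ((x \<bullet> y) / e) * char_fun Q (- (1 / e) *\<^sub>R y)"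
      by (simp add: char_fun_def)
  qed
  finally show ?thesis .
qed

text \<open>After the substitution \<open>x = z + e y\<close> and Fubini, \<open>Q\<close> enters only through the kernel averages that
  \<open>gaussian_kernel_char_fun\<close> expresses by \<open>char_fun Q\<close>.\<close>

lemma gaussian_smoothing:
  fixes f :: "real ^ 'm \<Rightarrow> real"
  assumes Q: "prob_space Q" and sets[measurable_cong]: "sets Q = sets borel" and e: "0 < e"
    and f: "integrable lborel f"
  shows "(\<integral>z. (\<integral>y. f (z + e *\<^sub>R y) \<partial>std_gaussian) \<partial>Q) =
    (\<integral>x. f x * (\<integral>z. exp (- (norm (x - z))\<^sup>2 / (2 * e\<^sup>2)) \<partial>Q) \<partial>lborel) / (e ^ CARD('m) * sqrt ((2 * pi) ^ CARD('m)))"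
proof -
  interpret Q: prob_space Q by fact
  interpret P: pair_sigma_finite Q "lborel :: (real ^ 'm) measure" ..
  have fm[measurable]: "f \<in> borel_measurable borel" using f by auto
  let ?C = "e ^ CARD('m) * sqrt ((2 * pi) ^ CARD('m))"
  let ?k = "\<lambda>z x. exp (- (norm (x - z))\<^sup>2 / (2 * e\<^sup>2))"
  have inner: "(\<integral>y. f (z + e *\<^sub>R y) \<partial>std_gaussian) = (\<integral>x. f x * ?k z x \<partial>lborel) / ?C" for z :: "real ^ 'm"
  proof -
    have "(\<integral>x. f x * ?k z x \<partial>lborel) =
      (\<integral>x. f x * ?k z x \<partial>density (distr lborel borel (\<lambda>x. z + e *\<^sub>R x)) (\<lambda>_. \<bar>e\<bar> ^ DIM(real ^ 'm)))"
      using e by (subst lborel_affine[of e z]) auto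
    also have "\<dots> = (\<integral>y. e ^ CARD('m) * (f (z + e *\<^sub>R y) * ?k z (z + e *\<^sub>R y)) \<partial>lborel)"
      using e by (subst integral_density, simp, simp, simp) (subst integral_distr, auto)
    also have "\<dots> = e ^ CARD('m) * (\<integral>y. f (z + e *\<^sub>R y) * exp (- (y \<bullet> y) / 2) \<partial>lborel)"
      using e by (simp add: power_mult_distrib power2_norm_eq_inner)
    finally have *: "(\<integral>x. f x * ?k z x \<partial>lborel) = e ^ CARD('m) * (\<integral>y. f (z + e *\<^sub>R y) * exp (- (y \<bullet> y) / 2) \<partial>lborel)" .
    have "(\<integral>y. f (z + e *\<^sub>R y) \<partial>std_gaussian) =
        (\<integral>y. f (z + e *\<^sub>R y) * exp (- (y \<bullet> y) / 2) / sqrt ((2 * pi) ^ CARD('m)) \<partial>lborel)"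
      unfolding std_gaussian_def by (subst integral_density) (auto simp: mult_ac)
    then show ?thesis unfolding * using e by simp
  qed
  have int: "integrable (Q \<Otimes>\<^sub>M lborel) (\<lambda>(z, x). f x * ?k z x)"
  proof (rule Bochner_Integration.integrable_bound)
    show "integrable (Q \<Otimes>\<^sub>M lborel) (\<lambda>(z, x). f x)"
    proof (rule P.Fubini_integrable)
      show "integrable Q (\<lambda>z. \<integral>x. norm (case (z, x) of (z, x) \<Rightarrow> f x) \<partial>lborel)" by simp
    qed (use f in auto)
    show "AE p in Q \<Otimes>\<^sub>M lborel. norm (case p of (z, x) \<Rightarrow> f x * ?k z x) \<le> norm (case p of (z, x) \<Rightarrow> f x)"
      by (intro AE_I2) (auto simp: split_beta abs_mult intro!: mult_left_le)
  qed measurable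
  have "(\<integral>z. (\<integral>y. f (z + e *\<^sub>R y) \<partial>std_gaussian) \<partial>Q) = (\<integral>z. (\<integral>x. f x * ?k z x \<partial>lborel) \<partial>Q) / ?C"
    by (simp add: inner)
  also have "(\<integral>z. (\<integral>x. f x * ?k z x \<partial>lborel) \<partial>Q) = (\<integral>x. (\<integral>z. f x * ?k z x \<partial>Q) \<partial>lborel)"
    using P.Fubini_integral[OF int] by simp
  finally show ?thesis by simp
qed

lemma std_gaussian_tail:
  assumes "0 < \<eta>"
  obtains R where "0 < R" "measure (std_gaussian :: (real ^ 'm) measure) {y. R \<le> norm y} < \<eta>"
proof -
  interpret G: prob_space "std_gaussian :: (real ^ 'm) measure" by (rule prob_space_std_gaussian)
  have "(\<lambda>n. measure (std_gaussian :: (real ^ 'm) measure) {y. real n \<le> norm y}) \<longlonglongrightarrow> measure (std_gaussian :: (real ^ 'm) measure) (\<Inter>n. {y. real n \<le> norm y})"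
    by (rule G.finite_Lim_measure_decseq) (auto simp: decseq_def)
  also have "(\<Inter>n. {y :: real ^ 'm. real n \<le> norm y}) = {}"
    by (auto simp: set_eq_iff not_le intro: reals_Archimedean2)
  finally have "(\<lambda>n. measure (std_gaussian :: (real ^ 'm) measure) {y. real n \<le> norm y}) \<longlonglongrightarrow> 0" by simp
  then have "\<forall>\<^sub>F n in sequentially. measure (std_gaussian :: (real ^ 'm) measure) {y. real n \<le> norm y} < \<eta>"
    using assms by (rule order_tendstoD)
  then have "\<forall>\<^sub>F n in sequentially. 0 < n \<and> measure (std_gaussian :: (real ^ 'm) measure) {y. real n \<le> norm y} < \<eta>"
    using eventually_gt_at_top[of 0] by eventually_elim simp
  then obtain n where "0 < n" "measure (std_gaussian :: (real ^ 'm) measure) {y. real n \<le> norm y} < \<eta>"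
    by (auto simp: eventually_sequentially)
  then show ?thesis using that[of "real n"] by simp
qed

lemma compact_support_imp_uniformly_continuous:
  fixes f :: "'a::euclidean_space \<Rightarrow> real"
  assumes f: "continuous_on UNIV f" and R: "\<And>x. R < norm x \<Longrightarrow> f x = 0"
  shows "uniformly_continuous_on UNIV f"
  unfolding uniformly_continuous_on_def
proof (intro allI impI)
  fix \<eta> :: real assume \<eta>: "0 < \<eta>"
  have "uniformly_continuous_on (cball 0 (R + 1)) f"
    by (rule compact_uniformly_continuous) (auto intro: continuous_on_subset[OF f])
  then obtain d where d: "d > 0" "\<And>x y. x \<in> cball 0 (R + 1) \<Longrightarrow> y \<in> cball 0 (R + 1) \<Longrightarrow> dist y x < d \<Longrightarrow> dist (f y) (f x) < \<eta>"
    using \<eta> unfolding uniformly_continuous_on_def by metis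
  show "\<exists>d>0. \<forall>x\<in>UNIV. \<forall>x'\<in>UNIV. dist x' x < d \<longrightarrow> dist (f x') (f x) < \<eta>"
  proof (intro exI[of _ "min d 1"] conjI ballI impI)
    fix x x' :: 'a assume xx: "dist x' x < min d 1"
    have n: "\<bar>norm x - norm x'\<bar> < 1"
      using xx norm_triangle_ineq3[of x x'] by (simp add: dist_norm norm_minus_commute)
    show "dist (f x') (f x) < \<eta>"
    proof (cases "norm x \<le> R + 1 \<and> norm x' \<le> R + 1")
      case True then show ?thesis using d(2)[of x x'] xx by simp
    next
      case False
      then have "R < norm x" "R < norm x'" using n by auto
      then show ?thesis using R \<eta> by simp
    qed
  qed (use d in auto)
qed

text \<open>The error is uniform in \<open>z\<close>; hence smoothing changes all means \<open>\<integral> f dQ\<close> by at most \<open>\<eta>\<close>, whatever \<open>Q\<close> is.\<close>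

lemma gaussian_smoothing_uniform:
  fixes f :: "real ^ 'm \<Rightarrow> real"
  assumes f: "uniformly_continuous_on UNIV f" and B: "\<And>x. \<bar>f x\<bar> \<le> B" and \<eta>: "0 < \<eta>"
  obtains e where "0 < e" "\<And>z. \<bar>(\<integral>y. f (z + e *\<^sub>R y) \<partial>std_gaussian) - f z\<bar> \<le> \<eta>"
proof -
  interpret G: prob_space "std_gaussian :: (real ^ 'm) measure" by (rule prob_space_std_gaussian)
  have cf: "continuous_on UNIV f" using f by (rule uniformly_continuous_imp_continuous)
  then have [measurable]: "f \<in> borel_measurable borel" by (rule borel_measurable_continuous_onI)
  have B0: "0 \<le> B" using B[of 0] by simp
  obtain d where d: "d > 0" "\<And>x y. dist y x < d \<Longrightarrow> dist (f y) (f x) < \<eta> / 2"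
    using f \<eta> unfolding uniformly_continuous_on_def by (metis UNIV_I half_gt_zero)
  obtain R where R: "0 < R" "measure (std_gaussian :: (real ^ 'm) measure) {y. R \<le> norm y} < \<eta> / (4 * (B + 1))"
    using std_gaussian_tail[of "\<eta> / (4 * (B + 1))"] \<eta> B0 by auto
  let ?T = "{y :: real ^ 'm. R \<le> norm y}"
  show ?thesis
  proof (rule that[of "d / R"])
    show "0 < d / R" using d R by simp
    fix z :: "real ^ 'm"
    let ?e = "d / R"
    have int: "integrable std_gaussian (\<lambda>y. f (z + ?e *\<^sub>R y))"
      by (rule G.integrable_const_bound[of _ B]) (use B in auto)
    have "\<bar>(\<integral>y. f (z + ?e *\<^sub>R y) \<partial>std_gaussian) - f z\<bar> = \<bar>\<integral>y. f (z + ?e *\<^sub>R y) - f z \<partial>std_gaussian\<bar>"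
      using int G.prob_space by simp
    also have "\<dots> \<le> (\<integral>y. \<bar>f (z + ?e *\<^sub>R y) - f z\<bar> \<partial>std_gaussian)"
      by (rule integral_abs_bound)
    also have "\<dots> \<le> (\<integral>y. \<eta> / 2 + 2 * B * indicator ?T y \<partial>std_gaussian)"
    proof (rule integral_mono)
      show "integrable std_gaussian (\<lambda>y. \<bar>f (z + ?e *\<^sub>R y) - f z\<bar>)" using int by simp
      show "integrable std_gaussian (\<lambda>y :: real ^ 'm. \<eta> / 2 + 2 * B * indicator ?T y)"
        by (rule G.integrable_const_bound[of _ "\<eta> / 2 + 2 * B"]) (use B0 \<eta> in \<open>auto simp: indicator_def\<close>)
      fix y :: "real ^ 'm"
      show "\<bar>f (z + ?e *\<^sub>R y) - f z\<bar> \<le> \<eta> / 2 + 2 * B * indicator ?T y"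
      proof (cases "R \<le> norm y")
        case True then show ?thesis using B[of z] B[of "z + ?e *\<^sub>R y"] \<eta> by simp
      next
        case False
        then have "dist (z + ?e *\<^sub>R y) z < d" using d R by (simp add: dist_norm field_simps)
        from d(2)[OF this] False show ?thesis by (simp add: dist_real_def)
      qed
    qed
    also have "\<dots> = \<eta> / 2 + 2 * B * measure (std_gaussian :: (real ^ 'm) measure) ?T"
      using G.prob_space G.integrable_const_bound[of "indicator ?T :: _ \<Rightarrow> real" 1]
      by (subst Bochner_Integration.integral_add) auto
    also have "\<dots> \<le> \<eta> / 2 + 2 * B * (\<eta> / (4 * (B + 1)))"
      using R B0 by (intro add_left_mono mult_left_mono) auto
    also have "\<dots> \<le> \<eta>" using \<eta> B0 by (simp add: field_simps)
    finally show "\<bar>(\<integral>y. f (z + ?e *\<^sub>R y) \<partial>std_gaussian) - f z\<bar> \<le> \<eta>" .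
  qed
qed

text \<open>For smoothed \<open>f\<close> the means converge by dominated convergence, as \<open>f\<close> is integrable and the kernel
  averages converge pointwise; the smoothing error is uniform over the sequence.\<close>

lemma char_fun_tendsto_imp_compact_support_tendsto:
  fixes f :: "real ^ 'm \<Rightarrow> real"
  assumes L: "\<And>n. prob_space (L n)" "\<And>n. sets (L n) = sets borel"
    and P: "prob_space P" "sets P = sets borel"
    and conv: "\<And>t. (\<lambda>n. char_fun (L n) t) \<longlonglongrightarrow> char_fun P t"
    and f: "continuous_on UNIV f" and R: "\<And>x. R < norm x \<Longrightarrow> f x = 0"
  shows "(\<lambda>n. \<integral>x. f x \<partial>L n) \<longlonglongrightarrow> (\<integral>x. f x \<partial>P)"
proof (rule LIMSEQ_I)
  fix \<eta> :: real assume \<eta>: "0 < \<eta>"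
  interpret G: prob_space "std_gaussian :: (real ^ 'm) measure" by (rule prob_space_std_gaussian)
  have fm[measurable]: "f \<in> borel_measurable borel" using f by (rule borel_measurable_continuous_onI)
  have "bounded (f ` cball 0 R)"
    by (intro compact_imp_bounded compact_continuous_image continuous_on_subset[OF f]) auto
  then obtain B where B0: "B > 0" and "\<forall>y\<in>f ` cball 0 R. norm y \<le> B"
    unfolding bounded_pos by blast
  then have B': "\<And>x. x \<in> cball 0 R \<Longrightarrow> \<bar>f x\<bar> \<le> B" by auto
  have B: "\<bar>f x\<bar> \<le> B" for x using B'[of x] R[of x] B0 by (cases "norm x \<le> R") auto
  have intf: "integrable lborel f"
  proof (rule Bochner_Integration.integrable_bound[of _ "\<lambda>x. B * indicator (cball 0 R) x"])
    show "integrable lborel (\<lambda>x :: real ^ 'm. B * indicator (cball 0 R) x)"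
      by (intro integrable_mult_right integrable_real_indicator emeasure_bounded_finite) auto
    show "AE x in lborel. norm (f x) \<le> norm (B * indicator (cball 0 R) x :: real)"
      using B R B0 by (intro AE_I2) (auto simp: indicator_def)
  qed simp
  have "uniformly_continuous_on UNIV f"
    by (rule compact_support_imp_uniformly_continuous[OF f R])
  then obtain e where e: "0 < e" "\<And>z. \<bar>(\<integral>y. f (z + e *\<^sub>R y) \<partial>std_gaussian) - f z\<bar> \<le> \<eta> / 4"
    using gaussian_smoothing_uniform[where f=f and B=B and \<eta>="\<eta> / 4"] B \<eta>
    by (metis divide_pos_pos zero_less_numeral)
  define S where "S z = (\<integral>y. f (z + e *\<^sub>R y) \<partial>std_gaussian)" for z
  have Sm[measurable]: "S \<in> borel_measurable borel" unfolding S_def by measurable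
  have SB: "\<bar>S z\<bar> \<le> B + \<eta> / 4" for z unfolding S_def using e(2)[of z] B[of z] by linarith
  have Sf: "\<bar>S x - f x\<bar> \<le> \<eta> / 4" for x unfolding S_def by (rule e(2))
  have diff: "\<bar>(\<integral>x. S x \<partial>Q) - (\<integral>x. f x \<partial>Q)\<bar> \<le> \<eta> / 4"
    if Q: "prob_space Q" "sets Q = sets borel" for Q
  proof -
    interpret Q: prob_space Q by fact
    note [measurable_cong] = Q(2)
    have i: "integrable Q S" "integrable Q f"
      using Q.integrable_const_bound[of S "B + \<eta> / 4"] Q.integrable_const_bound[of f B] SB B by auto
    have "\<bar>(\<integral>x. S x \<partial>Q) - (\<integral>x. f x \<partial>Q)\<bar> = \<bar>\<integral>x. S x - f x \<partial>Q\<bar>" using i by simp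
    also have "\<dots> \<le> (\<integral>x. \<bar>S x - f x\<bar> \<partial>Q)" by (rule integral_abs_bound)
    also have "\<dots> \<le> (\<integral>x. \<eta> / 4 \<partial>Q)" using i Sf by (intro integral_mono) auto
    finally show ?thesis using Q.prob_space by simp
  qed
  let ?A = "\<lambda>Q x. \<integral>z. exp (- (norm (x - z))\<^sup>2 / (2 * e\<^sup>2)) \<partial>(Q :: (real ^ 'm) measure)"
  have A1: "\<bar>?A Q x\<bar> \<le> 1" and Am: "?A Q \<in> borel_measurable borel"
    if Q: "prob_space Q" "sets Q = sets borel" for Q x
  proof -
    interpret Q: prob_space Q by fact
    note [measurable_cong] = Q(2)
    show "?A Q \<in> borel_measurable borel" by measurable
    have "\<bar>?A Q x\<bar> \<le> (\<integral>z. \<bar>exp (- (norm (x - z))\<^sup>2 / (2 * e\<^sup>2))\<bar> \<partial>Q)" by (rule integral_abs_bound)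
    also have "\<dots> \<le> (\<integral>z. 1 \<partial>Q)"
      by (intro integral_mono Q.integrable_const_bound[of _ 1]) auto
    finally show "\<bar>?A Q x\<bar> \<le> 1" using Q.prob_space by simp
  qed
  have Aconv: "(\<lambda>n. ?A (L n) x) \<longlonglongrightarrow> ?A P x" for x
  proof -
    note [measurable] = borel_measurable_char_fun[OF L] borel_measurable_char_fun[OF P]
    have "(\<lambda>n. \<integral>y. iexp ((x \<bullet> y) / e) * char_fun (L n) (- (1 / e) *\<^sub>R y) \<partial>std_gaussian)
      \<longlonglongrightarrow> (\<integral>y. iexp ((x \<bullet> y) / e) * char_fun P (- (1 / e) *\<^sub>R y) \<partial>std_gaussian)"
      by (rule integral_dominated_convergence[where w="\<lambda>_. 1"])
         (auto intro!: tendsto_intros conv simp: norm_mult cmod_char_fun_le_1[OF L(1)])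
    then have "(\<lambda>n. complex_of_real (?A (L n) x)) \<longlonglongrightarrow> complex_of_real (?A P x)"
      by (simp only: gaussian_kernel_char_fun[OF L e(1)] gaussian_kernel_char_fun[OF P e(1)])
    then show ?thesis by (simp only: tendsto_of_real_iff)
  qed
  have "(\<lambda>n. \<integral>x. f x * ?A (L n) x \<partial>lborel) \<longlonglongrightarrow> (\<integral>x. f x * ?A P x \<partial>lborel)"
  proof (rule integral_dominated_convergence[where w="\<lambda>x. \<bar>f x\<bar>"])
    show "AE x in lborel. norm (f x * ?A (L n) x) \<le> \<bar>f x\<bar>" for n
      using A1[OF L] by (intro AE_I2) (auto simp: abs_mult intro!: mult_left_le)
    show "AE x in lborel. (\<lambda>n. f x * ?A (L n) x) \<longlonglongrightarrow> f x * ?A P x"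
      by (intro AE_I2 tendsto_mult_left Aconv)
  qed (use intf Am[OF L] Am[OF P] in auto)
  then have "(\<lambda>n. \<integral>x. S x \<partial>L n) \<longlonglongrightarrow> (\<integral>x. S x \<partial>P)"
    unfolding S_def gaussian_smoothing[OF L e(1) intf] gaussian_smoothing[OF P e(1) intf]
    using e(1) by (intro tendsto_divide) auto
  then obtain N where N: "\<And>n. n \<ge> N \<Longrightarrow> \<bar>(\<integral>x. S x \<partial>L n) - (\<integral>x. S x \<partial>P)\<bar> < \<eta> / 4"
    using \<eta> by (metis LIMSEQ_D divide_pos_pos real_norm_def zero_less_numeral)
  show "\<exists>N. \<forall>n\<ge>N. norm ((\<integral>x. f x \<partial>L n) - (\<integral>x. f x \<partial>P)) < \<eta>"
  proof (intro exI[of _ N] allI impI)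
    fix n assume "N \<le> n"
    from N[OF this] diff[OF L, of n] diff[OF P]
    show "norm ((\<integral>x. f x \<partial>L n) - (\<integral>x. f x \<partial>P)) < \<eta>"
      using \<eta> unfolding real_norm_def by linarith
  qed
qed

text \<open>Passage from compactly supported to bounded test functions. No tightness has to be proved beforehand: the
  cut-offs \<open>\<kappa> K\<close> have compact support, so their means converge, and since \<open>P\<close> has total mass one they
  show that little mass of \<open>L n\<close> lies outside a large ball.\<close>

theorem char_fun_tendsto_imp_weakly_converges:
  fixes L :: "nat \<Rightarrow> (real ^ 'm) measure"
  assumes L: "\<And>n. prob_space (L n)" "\<And>n. sets (L n) = sets borel"
    and P: "prob_space P" "sets P = sets borel"
    and conv: "\<And>t. (\<lambda>n. char_fun (L n) t) \<longlonglongrightarrow> char_fun P t"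
  shows "weakly_converges L P"
  unfolding weakly_converges_def
proof (intro allI impI, elim conjE)
  fix f :: "real ^ 'm \<Rightarrow> real" assume f: "continuous_on UNIV f" and "bounded (range f)"
  then obtain B where B: "\<And>x. \<bar>f x\<bar> \<le> B" and B0: "B > 0" unfolding bounded_pos by auto
  have fm[measurable]: "f \<in> borel_measurable borel" using f by (rule borel_measurable_continuous_onI)
  define \<kappa> where "\<kappa> K x = max 0 (min 1 (K + 1 - norm x))" for K :: real and x :: "real ^ 'm"
  have c\<kappa>: "continuous_on UNIV (\<kappa> K)" for K unfolding \<kappa>_def by (intro continuous_intros)
  then have \<kappa>m[measurable]: "\<kappa> K \<in> borel_measurable borel" for K by (rule borel_measurable_continuous_onI)
  have \<kappa>01: "0 \<le> \<kappa> K x" "\<kappa> K x \<le> 1" for K x by (auto simp: \<kappa>_def)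
  have \<kappa>0: "\<kappa> K x = 0" if "K + 1 < norm x" for K x using that by (simp add: \<kappa>_def)
  have trunc: "\<bar>(\<integral>x. f x \<partial>Q) - (\<integral>x. f x * \<kappa> K x \<partial>Q)\<bar> \<le> B * (1 - (\<integral>x. \<kappa> K x \<partial>Q))"
    if Q: "prob_space Q" "sets Q = sets borel" for Q K
  proof -
    interpret Q: prob_space Q by fact
    note [measurable_cong] = Q(2)
    have i\<kappa>: "integrable Q (\<kappa> K)" by (rule Q.integrable_const_bound[of _ 1]) (use \<kappa>01 in auto)
    have "\<bar>f x * \<kappa> K x\<bar> \<le> B * 1" for x
      unfolding abs_mult using B[of x] \<kappa>01[of K x] B0 by (intro mult_mono) auto
    then have i: "integrable Q f" "integrable Q (\<lambda>x. f x * \<kappa> K x)"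
      using B by (auto intro!: Q.integrable_const_bound[of _ B])
    have "\<bar>(\<integral>x. f x \<partial>Q) - (\<integral>x. f x * \<kappa> K x \<partial>Q)\<bar> = \<bar>\<integral>x. f x * (1 - \<kappa> K x) \<partial>Q\<bar>"
      using i by (simp add: right_diff_distrib)
    also have "\<dots> \<le> (\<integral>x. \<bar>f x * (1 - \<kappa> K x)\<bar> \<partial>Q)" by (rule integral_abs_bound)
    also have "\<dots> \<le> (\<integral>x. B * (1 - \<kappa> K x) \<partial>Q)"
    proof (rule integral_mono)
      show "integrable Q (\<lambda>x. \<bar>f x * (1 - \<kappa> K x)\<bar>)" using i by (simp add: right_diff_distrib)
      show "integrable Q (\<lambda>x. B * (1 - \<kappa> K x))" using i\<kappa> by simp
      show "\<bar>f x * (1 - \<kappa> K x)\<bar> \<le> B * (1 - \<kappa> K x)" for x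
        using B \<kappa>01[of K x] by (auto simp: abs_mult intro!: mult_right_mono)
    qed
    also have "\<dots> = B * (1 - (\<integral>x. \<kappa> K x \<partial>Q))" using i\<kappa> Q.prob_space by simp
    finally show ?thesis .
  qed
  interpret P: prob_space P by (rule P(1))
  note [measurable_cong] = P(2)
  have lim1: "(\<lambda>k. \<integral>x. \<kappa> (real k) x \<partial>P) \<longlonglongrightarrow> (\<integral>x. 1 \<partial>P)"
  proof (rule integral_dominated_convergence[where w="\<lambda>_. 1"])
    show "AE x in P. (\<lambda>k. \<kappa> (real k) x) \<longlonglongrightarrow> 1"
    proof (intro AE_I2 tendsto_eventually)
      fix x :: "real ^ 'm"
      obtain k0 :: nat where "norm x < real k0" using reals_Archimedean2 by blast
      then show "\<forall>\<^sub>F k in sequentially. \<kappa> (real k) x = 1"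
        unfolding eventually_sequentially by (intro exI[of _ k0]) (auto simp: \<kappa>_def)
    qed
  qed (use \<kappa>01 in auto)
  show "(\<lambda>n. \<integral>x. f x \<partial>L n) \<longlonglongrightarrow> (\<integral>x. f x \<partial>P)"
  proof (rule LIMSEQ_I)
    fix \<eta> :: real assume \<eta>: "0 < \<eta>"
    have "\<forall>\<^sub>F k in sequentially. 1 - \<eta> / (4 * B) < (\<integral>x. \<kappa> (real k) x \<partial>P)"
      using \<eta> B0 by (intro order_tendstoD(1)[OF lim1]) (simp add: P.prob_space)
    then obtain k where k: "1 - \<eta> / (4 * B) < (\<integral>x. \<kappa> (real k) x \<partial>P)"
      by (auto simp: eventually_sequentially)
    have c1: "(\<lambda>n. \<integral>x. \<kappa> (real k) x \<partial>L n) \<longlonglongrightarrow> (\<integral>x. \<kappa> (real k) x \<partial>P)"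
      by (rule char_fun_tendsto_imp_compact_support_tendsto[OF L P conv c\<kappa> \<kappa>0])
    have c2: "(\<lambda>n. \<integral>x. f x * \<kappa> (real k) x \<partial>L n) \<longlonglongrightarrow> (\<integral>x. f x * \<kappa> (real k) x \<partial>P)"
      by (rule char_fun_tendsto_imp_compact_support_tendsto[OF L P conv, of _ "real k + 1"])
         (auto intro!: continuous_intros f c\<kappa> simp: \<kappa>0)
    have "\<forall>\<^sub>F n in sequentially. 1 - \<eta> / (4 * B) < (\<integral>x. \<kappa> (real k) x \<partial>L n)"
      by (rule order_tendstoD(1)[OF c1 k])
    moreover have "\<forall>\<^sub>F n in sequentially. \<bar>(\<integral>x. f x * \<kappa> (real k) x \<partial>L n) - (\<integral>x. f x * \<kappa> (real k) x \<partial>P)\<bar> < \<eta> / 2"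
      using tendstoD[OF c2, of "\<eta> / 2"] \<eta> by (simp add: dist_real_def)
    ultimately have "\<forall>\<^sub>F n in sequentially. norm ((\<integral>x. f x \<partial>L n) - (\<integral>x. f x \<partial>P)) < \<eta>"
    proof eventually_elim
      case (elim n)
      have "B * (1 - (\<integral>x. \<kappa> (real k) x \<partial>L n)) < \<eta> / 4" "B * (1 - (\<integral>x. \<kappa> (real k) x \<partial>P)) < \<eta> / 4"
        using elim(1) k B0 by (auto simp: field_simps)
      with trunc[OF L, of n "real k"] trunc[OF P, of "real k"] elim(2) show ?case
        unfolding real_norm_def by linarith
    qed
    then show "\<exists>N. \<forall>n\<ge>N. norm ((\<integral>x. f x \<partial>L n) - (\<integral>x. f x \<partial>P)) < \<eta>"
      by (auto simp: eventually_sequentially)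
  qed
qed

lemma weakly_converges_imp_char_fun_tendsto:
  fixes L :: "nat \<Rightarrow> (real ^ 'm) measure"
  assumes "weakly_converges L P"
    and L: "\<And>n. prob_space (L n)" "\<And>n. sets (L n) = sets borel"
    and P: "prob_space P" "sets P = sets borel"
  shows "(\<lambda>n. char_fun (L n) t) \<longlonglongrightarrow> char_fun P t"
proof -
  have eq: "char_fun Q t = Complex (\<integral>x. cos (t \<bullet> x) \<partial>Q) (\<integral>x. sin (t \<bullet> x) \<partial>Q)"
    if Q: "prob_space Q" "sets Q = sets borel" for Q :: "(real ^ 'm) measure"
  proof -
    interpret Q: prob_space Q by fact
    note [measurable_cong] = Q(2)
    have "integrable Q (\<lambda>x. iexp (t \<bullet> x))" by (rule Q.integrable_const_bound[of _ 1]) auto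
    then show ?thesis
      unfolding char_fun_def by (simp add: complex_eq_iff Re_exp Im_exp flip: integral_Re integral_Im)
  qed
  have "continuous_on UNIV (\<lambda>x. cos (t \<bullet> x))" "continuous_on UNIV (\<lambda>x. sin (t \<bullet> x))"
    by (intro continuous_intros)+
  moreover have "bounded (range (\<lambda>x. cos (t \<bullet> x)))" "bounded (range (\<lambda>x. sin (t \<bullet> x)))"
    by (auto intro!: boundedI[of _ 1])
  ultimately have "(\<lambda>n. \<integral>x. cos (t \<bullet> x) \<partial>L n) \<longlonglongrightarrow> (\<integral>x. cos (t \<bullet> x) \<partial>P)"
       "(\<lambda>n. \<integral>x. sin (t \<bullet> x) \<partial>L n) \<longlonglongrightarrow> (\<integral>x. sin (t \<bullet> x) \<partial>P)"
    using assms(1) unfolding weakly_converges_def by blast+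
  then show ?thesis unfolding eq[OF L] eq[OF P] by (rule tendsto_Complex)
qed

section \<open>Normal variance-mean mixtures\<close>

text \<open>At \<open>z = 0\<close> both sides are the point mass at \<open>c\<close>.\<close>

lemma multi_normal_scaled_eq_distr:
  fixes W :: "real ^ 'm ^ 'm"
  assumes S: "pos_def_matrix S" and W: "S = W ** transpose W" and z: "0 \<le> z"
  shows "multi_normal c (z *\<^sub>R S) = distr std_gaussian borel (\<lambda>y. c + sqrt z *\<^sub>R (W *v y))"
proof (cases "z = 0")
  case True
  interpret prob_space "std_gaussian :: (real ^ 'm) measure" by (rule prob_space_std_gaussian)
  show ?thesis using True by (simp add: multi_normal_def)
next
  case False
  then have z: "0 < z" using z by simp
  have "pos_def_matrix (z *\<^sub>R S)"
    using S z by (auto simp: pos_def_matrix_def transpose_scalar scaleR_matrix_vector_assoc[symmetric])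
  moreover have "z *\<^sub>R S = (sqrt z *\<^sub>R W) ** transpose (sqrt z *\<^sub>R W)"
    using z by (simp add: W transpose_scalar matrix_scalar_ac scalar_matrix_assoc[symmetric])
  ultimately show ?thesis
    by (simp add: multi_normal_eq_distr scaleR_matrix_vector_assoc)
qed

text \<open>One map of an independent pair \<open>(z, y)\<close> realizes all components of the mixture at once, which makes
  Fubini available.\<close>

lemma normal_vm_mixture_eq_distr:
  fixes W :: "real ^ 'm ^ 'm"
  assumes S: "pos_def_matrix S" and W: "S = W ** transpose W"
    and G: "prob_space G" "sets G = sets borel" "AE z in G. 0 \<le> z"
  shows "normal_vm_mixture c d S G =
    distr (G \<Otimes>\<^sub>M std_gaussian) borel (\<lambda>(z, y). c + z *\<^sub>R d + sqrt z *\<^sub>R (W *v y))"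
proof (rule measure_eqI)
  let ?L = "restrict_space G {0..}"
  let ?F = "\<lambda>z y. c + z *\<^sub>R d + sqrt z *\<^sub>R (W *v y)"
  interpret G: prob_space G by fact
  interpret N: prob_space "std_gaussian :: (real ^ 'm) measure" by (rule prob_space_std_gaussian)
  note [measurable_cong] = G(2)
  have spG: "space G = UNIV" using sets_eq_imp_space_eq[OF G(2)] by simp
  have Fm[measurable]: "case_prod ?F \<in> borel \<Otimes>\<^sub>M borel \<rightarrow>\<^sub>M borel"
    by (simp add: split_beta) measurable
  have Fm': "case_prod ?F \<in> G \<Otimes>\<^sub>M std_gaussian \<rightarrow>\<^sub>M borel" by measurable
  have K: "(\<lambda>z. multi_normal (c + z *\<^sub>R d) (z *\<^sub>R S)) \<in> ?L \<rightarrow>\<^sub>M subprob_algebra borel"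
  proof (subst measurable_cong)
    show "multi_normal (c + z *\<^sub>R d) (z *\<^sub>R S) = distr std_gaussian borel (?F z)" if "z \<in> space ?L" for z
      using that by (intro multi_normal_scaled_eq_distr[OF S W]) (simp add: space_restrict_space)
    have "(\<lambda>z. distr std_gaussian borel (?F z)) \<in> borel \<rightarrow>\<^sub>M subprob_algebra borel"
    proof (rule measurable_distr2)
      show "case_prod ?F \<in> borel \<Otimes>\<^sub>M std_gaussian \<rightarrow>\<^sub>M borel" by measurable
      show "(\<lambda>_. std_gaussian) \<in> borel \<rightarrow>\<^sub>M subprob_algebra (std_gaussian :: (real ^ 'm) measure)"
        by (simp add: space_subprob_algebra N.subprob_space_axioms)
    qed
    then show "(\<lambda>z. distr std_gaussian borel (?F z)) \<in> ?L \<rightarrow>\<^sub>M subprob_algebra borel"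
      by (intro measurable_restrict_space1) (simp cong: measurable_cong_sets add: G(2))
  qed
  have ne: "space ?L \<noteq> {}" by (auto simp: space_restrict_space spG intro: exI[of _ 0])
  have sB: "sets (normal_vm_mixture c d S G) = sets borel"
    unfolding normal_vm_mixture_def using K ne by (subst sets_bind[where N=borel]) (auto dest: sets_kernel)
  then show "sets (normal_vm_mixture c d S G) = sets (distr (G \<Otimes>\<^sub>M std_gaussian) borel (\<lambda>(z, y). ?F z y))"
    by simp
  fix A assume "A \<in> sets (normal_vm_mixture c d S G)"
  then have A[measurable]: "A \<in> sets borel" using sB by simp
  have "emeasure (normal_vm_mixture c d S G) A = (\<integral>\<^sup>+z. emeasure (multi_normal (c + z *\<^sub>R d) (z *\<^sub>R S)) A \<partial>?L)"
    unfolding normal_vm_mixture_def by (rule emeasure_bind[OF ne K A])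
  also have "\<dots> = (\<integral>\<^sup>+z. emeasure std_gaussian (?F z -` A) \<partial>?L)"
  proof (intro nn_integral_cong)
    fix z assume "z \<in> space ?L"
    then have "multi_normal (c + z *\<^sub>R d) (z *\<^sub>R S) = distr std_gaussian borel (?F z)"
      by (intro multi_normal_scaled_eq_distr[OF S W]) (simp add: space_restrict_space)
    then show "emeasure (multi_normal (c + z *\<^sub>R d) (z *\<^sub>R S)) A = emeasure std_gaussian (?F z -` A)"
      by (simp add: emeasure_distr)
  qed
  also have "\<dots> = (\<integral>\<^sup>+z. emeasure std_gaussian (?F z -` A) \<partial>G)"
    using G(3) by (subst nn_integral_restrict_space) (auto intro!: nn_integral_cong_AE simp: spG)
  also have "\<dots> = emeasure (G \<Otimes>\<^sub>M std_gaussian) (case_prod ?F -` A \<inter> space (G \<Otimes>\<^sub>M std_gaussian))"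
    using N.emeasure_pair_measure_alt[OF measurable_sets[OF Fm' A]]
    by (auto intro!: nn_integral_cong arg_cong2[where f=emeasure] simp: space_pair_measure spG)
  also have "\<dots> = emeasure (distr (G \<Otimes>\<^sub>M std_gaussian) borel (\<lambda>(z, y). ?F z y)) A"
    by (subst emeasure_distr) auto
  finally show "emeasure (normal_vm_mixture c d S G) A = emeasure (distr (G \<Otimes>\<^sub>M std_gaussian) borel (\<lambda>(z, y). ?F z y)) A" .
qed

lemma
  fixes S :: "real ^ 'm ^ 'm"
  assumes S: "pos_def_matrix S"
    and G: "prob_space G" "sets G = sets borel" "AE z in G. 0 \<le> z"
  shows prob_space_normal_vm_mixture: "prob_space (normal_vm_mixture c d S G)"
    and sets_normal_vm_mixture: "sets (normal_vm_mixture c d S G) = sets borel"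
    and char_fun_normal_vm_mixture:
      "char_fun (normal_vm_mixture c d S G) t =
        iexp (t \<bullet> c) * (\<integral>z. exp (- Complex (t \<bullet> (S *v t) / 2) (- (t \<bullet> d)) * of_real z) \<partial>G)"
proof -
  obtain W :: "real ^ 'm ^ 'm" where W: "S = W ** transpose W" using pos_def_factorization[OF S] ..
  let ?F = "\<lambda>z y. c + z *\<^sub>R d + sqrt z *\<^sub>R (W *v y)"
  interpret G: prob_space G by fact
  interpret N: prob_space "std_gaussian :: (real ^ 'm) measure" by (rule prob_space_std_gaussian)
  interpret P: pair_prob_space G "std_gaussian :: (real ^ 'm) measure" ..
  note [measurable_cong] = G(2)
  have Fm[measurable]: "case_prod ?F \<in> borel \<Otimes>\<^sub>M borel \<rightarrow>\<^sub>M borel"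
    by (simp add: split_beta) measurable
  note eq = normal_vm_mixture_eq_distr[OF S W G, of c d]
  show "prob_space (normal_vm_mixture c d S G)"
    unfolding eq by (rule P.prob_space_distr) measurable
  show "sets (normal_vm_mixture c d S G) = sets borel" unfolding eq by simp
  have "char_fun (normal_vm_mixture c d S G) t = (\<integral>p. iexp (t \<bullet> case_prod ?F p) \<partial>(G \<Otimes>\<^sub>M std_gaussian))"
    unfolding char_fun_def eq by (subst integral_distr) auto
  also have "\<dots> = (\<integral>p. (case p of (z, y) \<Rightarrow> iexp (t \<bullet> ?F z y)) \<partial>(G \<Otimes>\<^sub>M std_gaussian))"
    by (simp add: split_beta)
  also have "\<dots> = (\<integral>z. (\<integral>y. iexp (t \<bullet> ?F z y) \<partial>std_gaussian) \<partial>G)"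
    by (intro P.integral_fst'[symmetric, where f="\<lambda>(z, y). iexp (t \<bullet> ?F z y)", simplified] P.integrable_const_bound[of _ 1]) (auto simp: split_beta)
  also have "\<dots> = (\<integral>z. iexp (t \<bullet> c) * exp (- Complex (t \<bullet> (S *v t) / 2) (- (t \<bullet> d)) * of_real z) \<partial>G)"
  proof (rule integral_cong_AE)
    show "AE z in G. (\<integral>y. iexp (t \<bullet> ?F z y) \<partial>std_gaussian)
        = iexp (t \<bullet> c) * exp (- Complex (t \<bullet> (S *v t) / 2) (- (t \<bullet> d)) * of_real z)"
      using G(3)
    proof eventually_elim
      case (elim z)
      have "(\<integral>y. iexp (t \<bullet> ?F z y) \<partial>std_gaussian) =
          exp (\<i> * of_real (t \<bullet> (c + z *\<^sub>R d)) - of_real ((sqrt z)\<^sup>2 * (t \<bullet> (S *v t)) / 2))"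
        unfolding W by (rule char_fun_affine_gaussian)
      also have "\<i> * of_real (t \<bullet> (c + z *\<^sub>R d)) - of_real ((sqrt z)\<^sup>2 * (t \<bullet> (S *v t)) / 2)
        = \<i> * of_real (t \<bullet> c) + (- Complex (t \<bullet> (S *v t) / 2) (- (t \<bullet> d)) * of_real z)"
        using elim by (simp add: complex_eq_iff inner_add_right)
      finally show ?case by (simp only: exp_add)
    qed
  qed measurable
  finally show "char_fun (normal_vm_mixture c d S G) t =
        iexp (t \<bullet> c) * (\<integral>z. exp (- Complex (t \<bullet> (S *v t) / 2) (- (t \<bullet> d)) * of_real z) \<partial>G)"
    by simp
qed

section \<open>Generalized inverse Gaussian laws\<close>

lemma reciprocal_substitution:
  fixes h :: "real \<Rightarrow> real"
  assumes [measurable]: "h \<in> borel_measurable borel"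
    and h: "has_bochner_integral lborel (\<lambda>x. indicator {0<..} x * h x) I"
  shows "has_bochner_integral lborel (\<lambda>x. indicator {0<..} x * (h (1 / x) / x\<^sup>2)) I"
proof -
  have leb: "has_bochner_integral lborel (\<lambda>x. indicator {0<..} x * f x) I \<longleftrightarrow>
      f absolutely_integrable_on {0<..} \<and> integral {0<..} f = I"
    if [measurable]: "f \<in> borel_measurable borel" for f :: "real \<Rightarrow> real"
    using set_lebesgue_integral_eq_integral(2)[of "{0<..}" f]
    by (auto simp: has_bochner_integral_iff set_integrable_def set_lebesgue_integral_def integrable_completion integral_completion)
  have img: "(\<lambda>x. 1 / x) ` {0<..} = {0::real<..}"
  proof (intro set_eqI iffI)
    fix y :: real assume "y \<in> {0<..}"
    then show "y \<in> (\<lambda>x. 1 / x) ` {0<..}" by (intro image_eqI[of _ _ "1 / y"]) auto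
  qed auto
  have inj: "inj_on (\<lambda>x. 1 / x) {0::real<..}" by (auto simp: inj_on_def)
  have D: "((\<lambda>x. 1 / x) has_field_derivative - (1 / x\<^sup>2)) (at x within {0<..})" if "x \<in> {0<..}" for x :: real
    using that by (auto intro!: derivative_eq_intros simp: power2_eq_square)
  have "(\<lambda>x. \<bar>- (1 / x\<^sup>2)\<bar> * h (1 / x)) absolutely_integrable_on {0<..} \<and> integral {0<..} (\<lambda>x. \<bar>- (1 / x\<^sup>2)\<bar> * h (1 / x)) = I"
    using has_absolute_integral_change_of_variables_1'[OF _ D inj, of h I] h leb[of h] by (simp add: img)
  then show ?thesis by (subst leb) simp_all
qed

text \<open>The factor \<open>exp (- c / y)\<close> is at most \<open>k! y\<^sup>k / c\<^sup>k\<close>; with \<open>k\<close> large enough the kernel is dominated by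
  the integrand of a Gamma function.\<close>

lemma integrable_bessel_kernel:
  fixes z p :: real
  assumes z: "0 < z"
  shows "integrable lborel (\<lambda>y. indicator {0<..} y * (y powr p * exp (- (z / 2) * (y + 1 / y))))"
proof -
  define c where "c = z / 2"
  have c: "0 < c" using z by (simp add: c_def)
  \<comment> \<open>This is what makes \<open>y powr (p + k)\<close> integrable at \<open>0\<close>.\<close>
  obtain k :: nat where k: "- p - 1 < real k" using reals_Archimedean2 by blast
  have "(\<lambda>t. complex_of_real t powr (of_real (p + k + 1) - 1) / of_real (exp (c * t))) absolutely_integrable_on {0<..}"
    using k c by (intro absolutely_integrable_Gamma_integral) auto
  then have "integrable lebesgue (\<lambda>t. norm (indicator {0<..} t *\<^sub>R (complex_of_real t powr (of_real (p + k + 1) - 1) / of_real (exp (c * t)))))"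
    unfolding set_integrable_def by (rule integrable_norm)
  also have "(\<lambda>t. norm (indicator {0<..} t *\<^sub>R (complex_of_real t powr (of_real (p + k + 1) - 1) / of_real (exp (c * t)))))
     = (\<lambda>t. indicator {0<..} t * (t powr (p + k) * exp (- c * t)))"
    by (auto simp: fun_eq_iff indicator_def norm_divide norm_powr_real_powr exp_minus field_simps)
  finally have "integrable lborel (\<lambda>t. indicator {0<..} t * (t powr (p + k) * exp (- c * t)))"
    by (simp add: integrable_completion)
  then have "integrable lborel (\<lambda>t. (fact k / c ^ k) * (indicator {0<..} t * (t powr (p + k) * exp (- c * t))))"
    by simp
  then show ?thesis
  proof (rule Bochner_Integration.integrable_bound)
    show "AE y in lborel. norm (indicator {0<..} y * (y powr p * exp (- (z / 2) * (y + 1 / y))) :: real)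
        \<le> norm ((fact k / c ^ k) * (indicator {0<..} y * (y powr (p + k) * exp (- c * y))))"
    proof (rule AE_I2)
      fix y :: real
      show "norm (indicator {0<..} y * (y powr p * exp (- (z / 2) * (y + 1 / y))) :: real)
        \<le> norm ((fact k / c ^ k) * (indicator {0<..} y * (y powr (p + k) * exp (- c * y))))"
      proof (cases "0 < y")
        case y: True
        have "(c / y) ^ k / fact k \<le> exp (c / y)"
        proof -
          have "(c / y) ^ k / fact k \<le> (\<Sum>n<Suc k. (c / y) ^ n / fact n)"
            using c y by (intro member_le_sum) auto
          also have "\<dots> = (\<Sum>n<Suc k. (c / y) ^ n /\<^sub>R fact n)"
            by (intro sum.cong refl) (simp add: field_simps)
          also have "\<dots> \<le> (\<Sum>n. (c / y) ^ n /\<^sub>R fact n)"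
            using c y by (intro sum_le_suminf summable_exp_generic) auto
          also have "\<dots> = exp (c / y)" by (simp add: exp_def)
          finally show ?thesis .
        qed
        then have "exp (- (c / y)) \<le> fact k / c ^ k * y ^ k"
          using c y by (simp add: exp_minus field_simps)
        then have "y powr p * exp (- c * y) * exp (- (c / y)) \<le> y powr p * exp (- c * y) * (fact k / c ^ k * y ^ k)"
          by (intro mult_left_mono) auto
        also have "y powr p * exp (- c * y) * (fact k / c ^ k * y ^ k) = (fact k / c ^ k) * (y powr (p + k) * exp (- c * y))"
          using y by (simp add: powr_add powr_realpow)
        also have "y powr p * exp (- c * y) * exp (- (c / y)) = y powr p * exp (- (z / 2) * (y + 1 / y))"
          by (simp add: c_def algebra_simps flip: exp_add)
        finally show ?thesis using y c by (simp add: abs_mult)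
      qed simp
    qed
  qed measurable
qed

lemma bessel_K_pos:
  assumes z: "0 < z"
  shows "0 < bessel_K \<nu> z"
proof -
  let ?h = "\<lambda>y. indicator {0<..} y * (y powr (\<nu> - 1) * exp (- (z / 2) * (y + 1 / y))) :: real"
  note int = integrable_bessel_kernel[OF z, of "\<nu> - 1"]
  have "integral\<^sup>L lborel ?h \<noteq> 0"
  proof
    assume "integral\<^sup>L lborel ?h = 0"
    then have "AE y in lborel. ?h y = 0"
      by (subst integral_nonneg_eq_0_iff_AE[OF int, symmetric]) auto
    then have "AE y in lborel. \<not> (y \<in> {1..2::real})" by eventually_elim auto
    then have "emeasure lborel {y \<in> space lborel. y \<in> {1..2::real}} = 0" by (rule emeasure_eq_0_AE)
    then have "emeasure lborel {1..2::real} = 0" by (simp only: space_lborel space_borel UNIV_I simp_thms Collect_mem_eq)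
    then show False by simp
  qed
  moreover have "0 \<le> integral\<^sup>L lborel ?h" by (intro Bochner_Integration.integral_nonneg) auto
  ultimately have "0 < integral\<^sup>L lborel ?h" by linarith
  then show ?thesis by (simp add: bessel_K_def set_lebesgue_integral_def)
qed

lemma reciprocal_powr:
  fixes x p :: real
  assumes "0 < x"
  shows "(1 / x) powr (- p - 1) / x\<^sup>2 = x powr (p - 1)"
proof -
  have "(1 / x) powr (- p - 1) = x powr (- (- p - 1))"
    using assms by (simp only: powr_minus_divide powr_divide less_imp_le zero_le_one powr_one_eq_one)
  moreover have "x\<^sup>2 = x powr 2" using assms by simp
  ultimately show ?thesis by (simp only: powr_diff[symmetric]) simp
qed

lemma bessel_K_minus:
  assumes z: "0 < z"
  shows "bessel_K (- \<nu>) z = bessel_K \<nu> z"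
proof -
  let ?h = "\<lambda>\<nu> y. y powr (\<nu> - 1) * exp (- (z / 2) * (y + 1 / y)) :: real"
  have h: "?h \<nu> (1 / y) / y\<^sup>2 = ?h (- \<nu>) y" if y: "0 < y" for y
  proof -
    have "(1 / y) powr (\<nu> - 1) / y\<^sup>2 = y powr (- \<nu> - 1)"
      using reciprocal_powr[OF y, of "- \<nu>"] by simp
    then show ?thesis using y by (simp add: add.commute field_simps)
  qed
  have "has_bochner_integral lborel (\<lambda>y. indicator {0<..} y * ?h \<nu> y) (integral\<^sup>L lborel (\<lambda>y. indicator {0<..} y * ?h \<nu> y))"
    using integrable_bessel_kernel[OF z] by (rule has_bochner_integral_integrable)
  then have "has_bochner_integral lborel (\<lambda>y. indicator {0<..} y * (?h \<nu> (1 / y) / y\<^sup>2)) (integral\<^sup>L lborel (\<lambda>y. indicator {0<..} y * ?h \<nu> y))"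
    by (intro reciprocal_substitution) measurable
  also have "(\<lambda>y. indicator {0<..} y * (?h \<nu> (1 / y) / y\<^sup>2)) = (\<lambda>y. indicator {0<..} y * ?h (- \<nu>) y)"
    using h by (auto simp: fun_eq_iff indicator_def)
  finally show ?thesis
    by (simp add: bessel_K_def set_lebesgue_integral_def has_bochner_integral_iff)
qed

text \<open>The parameter domain of the family, including the boundary cases \<open>\<mu> = 0\<close> (gamma) and \<open>lam = 0\<close>
  (inverse gamma).\<close>

definition gig_parameters :: "real \<Rightarrow> real \<Rightarrow> real \<Rightarrow> bool" where
  "gig_parameters \<nu> \<mu> lam \<longleftrightarrow> 0 \<le> \<mu> \<and> 0 \<le> lam \<and> (\<nu> \<le> 0 \<longrightarrow> 0 < \<mu>) \<and> (0 \<le> \<nu> \<longrightarrow> 0 < lam)"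

lemma gig_parameters_reciprocal: "gig_parameters \<nu> \<mu> lam \<Longrightarrow> gig_parameters (- \<nu>) lam \<mu>"
  by (auto simp: gig_parameters_def)

lemma borel_measurable_gig_density[measurable]: "gig_density \<nu> \<mu> lam \<in> borel_measurable borel"
  unfolding gig_density_def by measurable

lemma gig_const_reciprocal:
  assumes "gig_parameters \<nu> \<mu> lam"
  shows "gig_const (- \<nu>) lam \<mu> = gig_const \<nu> \<mu> lam"
proof -
  consider "\<mu> = 0" | "lam = 0" "\<mu> \<noteq> 0" | "0 < \<mu>" "0 < lam"
    using assms by (auto simp: gig_parameters_def le_less)
  then show ?thesis
  proof cases
    case 3
    then show ?thesis
      by (simp add: gig_const_def bessel_K_minus mult.commute[of lam] powr_minus field_simps)
  qed (use assms in \<open>auto simp: gig_const_def gig_parameters_def\<close>)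
qed

lemma gig_const_nonneg:
  assumes "gig_parameters \<nu> \<mu> lam"
  shows "0 \<le> gig_const \<nu> \<mu> lam"
proof -
  consider "\<mu> = 0" "0 < \<nu>" | "lam = 0" "\<mu> \<noteq> 0" "\<nu> < 0" | "0 < \<mu>" "0 < lam"
    using assms by (auto simp: gig_parameters_def le_less not_less)
  then show ?thesis
    by cases (auto simp: gig_const_def intro!: divide_nonneg_nonneg mult_nonneg_nonneg less_imp_le[OF bessel_K_pos] less_imp_le[OF Gamma_real_pos])
qed

lemma gig_density_nonneg: "gig_parameters \<nu> \<mu> lam \<Longrightarrow> 0 \<le> gig_density \<nu> \<mu> lam x"
  by (simp add: gig_density_def gig_const_nonneg)

lemma gig_density_reciprocal:
  assumes "gig_parameters \<nu> \<mu> lam" "0 < x"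
  shows "gig_density (- \<nu>) lam \<mu> (1 / x) / x\<^sup>2 = gig_density \<nu> \<mu> lam x"
proof -
  have "gig_density (- \<nu>) lam \<mu> (1 / x) / x\<^sup>2 =
      gig_const \<nu> \<mu> lam * ((1 / x) powr (- \<nu> - 1) / x\<^sup>2) * exp (- (\<mu> / x + lam * x) / 2)"
    using assms by (simp add: gig_density_def gig_const_reciprocal add.commute)
  also have "\<dots> = gig_density \<nu> \<mu> lam x"
    unfolding reciprocal_powr[OF assms(2)] using assms(2) by (simp add: gig_density_def)
  finally show ?thesis .
qed

lemma nn_integral_cmult_real:
  "f \<in> borel_measurable M \<Longrightarrow> 0 \<le> c \<Longrightarrow> (\<integral>\<^sup>+x. ennreal (c * f x) \<partial>M) = ennreal c * (\<integral>\<^sup>+x. ennreal (f x) \<partial>M)"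
  by (simp add: ennreal_mult' nn_integral_cmult)

lemma nn_integral_gamma_density:
  assumes "0 < \<nu>" "0 < lam"
  shows "(\<integral>\<^sup>+x. ennreal (gig_density \<nu> 0 lam x) \<partial>lborel) = 1"
proof -
  let ?c = "lam / 2"
  have G: "0 < Gamma \<nu>" "Gamma \<nu> \<noteq> 0" using Gamma_real_pos[OF assms(1)] by (auto simp del: Gamma_real_pos)
  have pt: "?c * (indicator {0..} (?c * x) * (?c * x) powr (\<nu> - 1) / exp (?c * x)) = Gamma \<nu> * gig_density \<nu> 0 lam x" for x
  proof (cases "0 < x")
    case True
    have "?c * (?c * x) powr (\<nu> - 1) = ?c powr \<nu> * x powr (\<nu> - 1)"
      using assms True by (subst powr_mult) (auto simp: powr_diff)
    then show ?thesis using True assms G by (simp add: gig_density_def gig_const_def exp_minus field_simps)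
  next
    case False
    then show ?thesis using assms by (cases "x = 0") (auto simp: gig_density_def indicator_def zero_le_mult_iff)
  qed
  have "ennreal (Gamma \<nu>) = (\<integral>\<^sup>+t. ennreal (indicator {0..} t * t powr (\<nu> - 1) / exp t) \<partial>lborel)"
    by (rule Gamma_conv_nn_integral_real[OF assms(1)])
  also have "\<dots> = ennreal \<bar>?c\<bar> * (\<integral>\<^sup>+x. ennreal (indicator {0..} (0 + ?c * x) * (0 + ?c * x) powr (\<nu> - 1) / exp (0 + ?c * x)) \<partial>lborel)"
    using assms by (intro nn_integral_real_affine) auto
  also have "\<dots> = (\<integral>\<^sup>+x. ennreal (Gamma \<nu> * gig_density \<nu> 0 lam x) \<partial>lborel)"
    using assms unfolding pt[symmetric] by (subst nn_integral_cmult_real) auto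
  also have "\<dots> = ennreal (Gamma \<nu>) * (\<integral>\<^sup>+x. ennreal (gig_density \<nu> 0 lam x) \<partial>lborel)"
    using G by (intro nn_integral_cmult_real) auto
  finally show ?thesis using G by (simp add: ennreal_mult_cancel_left[of _ 1, simplified] flip: ennreal_mult_cancel_left[of "ennreal (Gamma \<nu>)"])
qed

lemma nn_integral_generic_gig_density:
  assumes "0 < \<mu>" "0 < lam"
  shows "(\<integral>\<^sup>+x. ennreal (gig_density \<nu> \<mu> lam x) \<partial>lborel) = 1"
proof -
  define z where "z = sqrt (\<mu> * lam)"
  \<comment> \<open>The scaling that makes \<open>\<mu> / x\<close> and \<open>lam x\<close> symmetric, as in the integrand of the Bessel function.\<close>
  define s where "s = sqrt (\<mu> / lam)"
  have z: "0 < z" and s: "0 < s" using assms by (auto simp: z_def s_def)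
  have sq: "\<mu> / s = z" "lam * s = z"
    using assms by (auto simp: z_def s_def real_sqrt_mult real_sqrt_divide field_simps)
  have sp: "s powr \<nu> = \<mu> powr (\<nu> / 2) / lam powr (\<nu> / 2)"
    using assms by (simp add: s_def powr_half_sqrt[symmetric] powr_powr powr_divide)
  have K: "0 < bessel_K \<nu> z" by (rule bessel_K_pos[OF z])
  let ?h = "\<lambda>y. indicator {0<..} y * (y powr (\<nu> - 1) * exp (- (z / 2) * (y + 1 / y))) :: real"
  have pt: "s * gig_density \<nu> \<mu> lam (s * y) = (1 / (2 * bessel_K \<nu> z)) * ?h y" for y
  proof (cases "0 < y")
    case y: True
    have e1: "s * (s * y) powr (\<nu> - 1) = s powr \<nu> * y powr (\<nu> - 1)"
      using s y by (subst powr_mult) (auto simp: powr_diff)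
    have e2: "\<mu> / (s * y) + lam * (s * y) = z * (y + 1 / y)"
      by (simp add: sq distrib_left flip: divide_divide_eq_left mult.assoc)
    have e3: "gig_const \<nu> \<mu> lam * s powr \<nu> = 1 / (2 * bessel_K \<nu> z)"
      using assms by (simp add: gig_const_def sp flip: z_def)
    have "s * gig_density \<nu> \<mu> lam (s * y) =
        gig_const \<nu> \<mu> lam * (s * (s * y) powr (\<nu> - 1)) * exp (- (\<mu> / (s * y) + lam * (s * y)) / 2)"
      using s y by (simp add: gig_density_def)
    also have "\<dots> = (gig_const \<nu> \<mu> lam * s powr \<nu>) * (y powr (\<nu> - 1) * exp (- (z * (y + 1 / y)) / 2))"
      unfolding e1 e2 by simp
    finally show ?thesis unfolding e3 using y by simp
  next
    case False
    then show ?thesis using s by (auto simp: gig_density_def zero_less_mult_iff)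
  qed
  have "(\<integral>\<^sup>+x. ennreal (gig_density \<nu> \<mu> lam x) \<partial>lborel) = ennreal \<bar>s\<bar> * (\<integral>\<^sup>+y. ennreal (gig_density \<nu> \<mu> lam (0 + s * y)) \<partial>lborel)"
    using s by (intro nn_integral_real_affine) auto
  also have "\<dots> = (\<integral>\<^sup>+y. ennreal ((1 / (2 * bessel_K \<nu> z)) * ?h y) \<partial>lborel)"
    unfolding pt[symmetric] using s by (subst nn_integral_cmult_real) auto
  also have "\<dots> = ennreal (1 / (2 * bessel_K \<nu> z)) * (\<integral>\<^sup>+y. ennreal (?h y) \<partial>lborel)"
    using K by (intro nn_integral_cmult_real) auto
  also have "(\<integral>\<^sup>+y. ennreal (?h y) \<partial>lborel) = ennreal (2 * bessel_K \<nu> z)"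
    by (subst nn_integral_eq_integral[OF integrable_bessel_kernel[OF z]])
       (auto simp: bessel_K_def set_lebesgue_integral_def)
  finally show ?thesis using K by (simp flip: ennreal_mult)
qed

text \<open>The inverse gamma case is the gamma case after \<open>x \<mapsto> 1 / x\<close>.\<close>

lemma has_bochner_integral_gig_density:
  assumes p: "gig_parameters \<nu> \<mu> lam"
  shows "has_bochner_integral lborel (gig_density \<nu> \<mu> lam) 1"
proof -
  have nn: "has_bochner_integral lborel (gig_density \<nu> \<mu> lam) 1"
    if "(\<integral>\<^sup>+x. ennreal (gig_density \<nu> \<mu> lam x) \<partial>lborel) = 1" "gig_parameters \<nu> \<mu> lam" for \<nu> \<mu> lam
    using that by (intro has_bochner_integral_nn_integral) (auto simp: gig_density_nonneg)
  consider "\<mu> = 0" "0 < \<nu>" "0 < lam" | "lam = 0" "0 < \<mu>" "\<nu> < 0" | "0 < \<mu>" "0 < lam"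
    using p by (auto simp: gig_parameters_def le_less not_less)
  then show ?thesis
  proof cases
    case 1 then show ?thesis using nn[OF _ p] nn_integral_gamma_density by simp
  next
    case 3 then show ?thesis using nn[OF _ p] nn_integral_generic_gig_density by simp
  next
    case 2
    have ind: "indicator {0<..} x * gig_density \<nu>' \<mu>' lam' x = gig_density \<nu>' \<mu>' lam' x" for \<nu>' \<mu>' lam' x
      by (auto simp: gig_density_def indicator_def)
    have "has_bochner_integral lborel (gig_density (- \<nu>) lam \<mu>) 1"
      using nn[OF _ gig_parameters_reciprocal[OF p]] nn_integral_gamma_density[of "- \<nu>" \<mu>] 2 by simp
    then have "has_bochner_integral lborel (\<lambda>x. indicator {0<..} x * (gig_density (- \<nu>) lam \<mu> (1 / x) / x\<^sup>2)) 1"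
      by (intro reciprocal_substitution) (simp_all add: ind)
    also have "(\<lambda>x. indicator {0<..} x * (gig_density (- \<nu>) lam \<mu> (1 / x) / x\<^sup>2)) = gig_density \<nu> \<mu> lam"
      using gig_density_reciprocal[OF p] by (auto simp: fun_eq_iff indicator_def gig_density_def)
    finally show ?thesis .
  qed
qed

lemma prob_space_GIG:
  assumes p: "gig_parameters \<nu> \<mu> lam"
  shows "prob_space (GIG \<nu> \<mu> lam)"
proof
  have "emeasure (GIG \<nu> \<mu> lam) (space (GIG \<nu> \<mu> lam)) = (\<integral>\<^sup>+x. ennreal (gig_density \<nu> \<mu> lam x) \<partial>lborel)"
    by (simp add: GIG_def emeasure_density)
  also have "\<dots> = ennreal 1"
    using has_bochner_integral_gig_density[OF p] gig_density_nonneg[OF p]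
    by (subst nn_integral_eq_integral) (auto simp: has_bochner_integral_iff)
  finally show "emeasure (GIG \<nu> \<mu> lam) (space (GIG \<nu> \<mu> lam)) = 1" by simp
qed

lemma sets_GIG[simp, measurable_cong]: "sets (GIG \<nu> \<mu> lam) = sets borel"
  by (simp add: GIG_def)

lemma AE_GIG_pos: "AE x in GIG \<nu> \<mu> lam. 0 < x"
  unfolding GIG_def by (subst AE_density) (auto simp: gig_density_def)

text \<open>The two densities correspond under \<open>x \<mapsto> 1 / x\<close>; the normalizing constants agree because
  \<open>K\<^sub>\<nu> = K\<^sub>-\<^sub>\<nu>\<close>.\<close>

lemma GIG_reciprocal:
  assumes p: "gig_parameters \<nu> \<mu> lam"
  shows "distr (GIG (- \<nu>) lam \<mu>) borel (\<lambda>x. 1 / x) = GIG \<nu> \<mu> lam"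
proof (rule measure_eqI)
  fix A assume "A \<in> sets (distr (GIG (- \<nu>) lam \<mu>) borel (\<lambda>x. 1 / x))"
  then have A[measurable]: "A \<in> sets borel" by simp
  note p' = gig_parameters_reciprocal[OF p]
  let ?f = "\<lambda>x. gig_density (- \<nu>) lam \<mu> x * indicator A (1 / x)"
  have int: "integrable lborel ?f"
    using has_bochner_integral_gig_density[OF p'] gig_density_nonneg[OF p']
    by (intro Bochner_Integration.integrable_bound[of lborel "gig_density (- \<nu>) lam \<mu>" ?f])
       (auto simp: has_bochner_integral_iff indicator_def)
  have ind: "indicator {0<..} x * ?f x = ?f x" for x
    by (auto simp: gig_density_def indicator_def)
  have "has_bochner_integral lborel (\<lambda>x. indicator {0<..} x * (?f (1 / x) / x\<^sup>2)) (integral\<^sup>L lborel ?f)"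
    using int by (intro reciprocal_substitution) (simp_all only: ind has_bochner_integral_integrable, measurable)
  also have "(\<lambda>x. indicator {0<..} x * (?f (1 / x) / x\<^sup>2)) = (\<lambda>x. gig_density \<nu> \<mu> lam x * indicator A x)"
  proof
    fix x show "indicator {0<..} x * (?f (1 / x) / x\<^sup>2) = gig_density \<nu> \<mu> lam x * indicator A x"
      using gig_density_reciprocal[OF p, of x] by (cases "0 < x") (auto simp: indicator_def gig_density_def[of \<nu>])
  qed
  finally have I: "integrable lborel (\<lambda>x. gig_density \<nu> \<mu> lam x * indicator A x)"
      "(\<integral>x. gig_density \<nu> \<mu> lam x * indicator A x \<partial>lborel) = integral\<^sup>L lborel ?f"
    by (auto simp: has_bochner_integral_iff)
  have "emeasure (distr (GIG (- \<nu>) lam \<mu>) borel (\<lambda>x. 1 / x)) A = (\<integral>\<^sup>+x. ennreal (?f x) \<partial>lborel)"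
    unfolding GIG_def using measurable_sets[OF _ A, of "\<lambda>x. 1 / x" borel]
    by (subst emeasure_distr) (auto simp: emeasure_density intro!: nn_integral_cong split: split_indicator)
  also have "\<dots> = ennreal (integral\<^sup>L lborel ?f)"
    using int gig_density_nonneg[OF p'] by (intro nn_integral_eq_integral) auto
  also have "\<dots> = (\<integral>\<^sup>+x. ennreal (gig_density \<nu> \<mu> lam x * indicator A x) \<partial>lborel)"
    using I gig_density_nonneg[OF p] by (subst nn_integral_eq_integral) auto
  also have "\<dots> = emeasure (GIG \<nu> \<mu> lam) A"
    unfolding GIG_def by (auto simp: emeasure_density intro!: nn_integral_cong split: split_indicator)
  finally show "emeasure (distr (GIG (- \<nu>) lam \<mu>) borel (\<lambda>x. 1 / x)) A = emeasure (GIG \<nu> \<mu> lam) A" .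
qed simp

section \<open>Laplace transforms determined by a parabola\<close>

text \<open>Differentiation under the integral: on \<open>Re w > \<delta>\<close> the difference quotients of \<open>w \<mapsto> exp (- w z)\<close> are
  bounded by \<open>1 / \<delta>\<close> for all \<open>z \<ge> 0\<close>.\<close>

lemma laplace_holomorphic:
  fixes Q :: "real measure"
  assumes Q: "prob_space Q" "sets Q = sets borel" and pos: "AE z in Q. 0 \<le> z"
  shows "(\<lambda>s. \<integral>z. exp (- s * complex_of_real z) \<partial>Q) holomorphic_on {s. 0 < Re s}"
proof -
  interpret prob_space Q by fact
  note [measurable_cong] = Q(2)
  let ?e = "\<lambda>z s. exp (- s * complex_of_real z)"
  let ?F = "\<lambda>s. \<integral>z. ?e z s \<partial>Q"
  have int: "integrable Q (\<lambda>z. ?e z s)" if "0 < Re s" for s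
    by (rule integrable_const_bound[of _ 1]) (use pos that in \<open>auto simp: norm_exp_eq_Re\<close>)
  have "\<exists>D. (?F has_field_derivative D) (at s)" if s: "0 < Re s" for s
  proof
    define \<delta> where "\<delta> = Re s / 2"
    have \<delta>: "0 < \<delta>" "\<delta> < Re s" using s by (auto simp: \<delta>_def)
    define U where "U = {w. \<delta> < Re w}"
    have U: "open U" "convex U" "s \<in> U"
      using \<delta> by (auto simp: U_def open_halfspace_Re_gt convex_halfspace_Re_gt)
    have quot: "norm ((?e z w - ?e z s) / (w - s)) \<le> 1 / \<delta>" if z: "0 \<le> z" and w: "w \<in> U - {s}" for z w
    proof -
      have "norm (?e z w - ?e z s) \<le> 1 / \<delta> * norm (w - s)"
      proof (rule field_differentiable_bound[OF U(2)])
        show "(?e z has_field_derivative (- of_real z * ?e z v)) (at v within U)" for v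
          by (auto intro!: derivative_eq_intros)
        fix v assume v: "v \<in> U"
        have "\<delta> * z \<le> exp (\<delta> * z)" using exp_ge_add_one_self[of "\<delta> * z"] by linarith
        moreover have "exp (\<delta> * z) \<le> exp (Re v * z)" using v z by (auto simp: U_def intro!: mult_right_mono)
        ultimately have "\<delta> * z \<le> exp (Re v * z)" by linarith
        then have "z * exp (- (Re v * z)) \<le> 1 / \<delta>"
          using \<delta> by (simp add: exp_minus field_simps)
        then show "norm (- of_real z * ?e z v) \<le> 1 / \<delta>"
          using z by (simp add: norm_mult norm_exp_eq_Re)
      qed (use w U in auto)
      then show ?thesis using w by (simp add: norm_divide field_simps)
    qed
    have "((\<lambda>w. (?F w - ?F s) / (w - s)) \<longlongrightarrow> (\<integral>z. - of_real z * ?e z s \<partial>Q)) (at s within U)"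
      unfolding tendsto_at_iff_sequentially
    proof (intro allI impI)
      fix X :: "nat \<Rightarrow> complex" assume X: "\<forall>i. X i \<in> U - {s}" "X \<longlonglongrightarrow> s"
      have X0: "0 < Re (X i)" for i using X(1) \<delta> by (auto simp: U_def intro: order.strict_trans)
      have "(\<lambda>i. \<integral>z. (?e z (X i) - ?e z s) / (X i - s) \<partial>Q) \<longlonglongrightarrow> (\<integral>z. - of_real z * ?e z s \<partial>Q)"
      proof (rule integral_dominated_convergence[where w="\<lambda>_. 1 / \<delta>"])
        show "AE z in Q. norm ((?e z (X i) - ?e z s) / (X i - s)) \<le> 1 / \<delta>" for i
          using pos by eventually_elim (use quot X in blast)
        show "AE z in Q. (\<lambda>i. (?e z (X i) - ?e z s) / (X i - s)) \<longlonglongrightarrow> - of_real z * ?e z s"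
        proof (rule AE_I2)
          fix z
          have "(?e z has_field_derivative (- of_real z * ?e z s)) (at s)"
            by (auto intro!: derivative_eq_intros)
          then have "((\<lambda>w. (?e z w - ?e z s) / (w - s)) \<longlongrightarrow> - of_real z * ?e z s) (at s)"
            by (simp add: has_field_derivative_iff)
          then show "(\<lambda>i. (?e z (X i) - ?e z s) / (X i - s)) \<longlonglongrightarrow> - of_real z * ?e z s"
            using X unfolding tendsto_at_iff_sequentially comp_def by auto
        qed
      qed auto
      moreover have "(\<integral>z. (?e z (X i) - ?e z s) / (X i - s) \<partial>Q) = (?F (X i) - ?F s) / (X i - s)" for i
        using int[OF s] int[OF X0] by simp
      ultimately show "((\<lambda>w. (?F w - ?F s) / (w - s)) \<circ> X) \<longlonglongrightarrow> (\<integral>z. - of_real z * ?e z s \<partial>Q)"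
        by (simp only: comp_def)
    qed
    then show "(?F has_field_derivative (\<integral>z. - of_real z * ?e z s \<partial>Q)) (at s)"
      using at_within_open[OF U(3,1)] by (simp add: has_field_derivative_iff)
  qed
  then show ?thesis
    by (auto simp: holomorphic_on_def field_differentiable_def intro: has_field_derivative_at_within)
qed

text \<open>The characteristic function is the boundary value of the Laplace transform at \<open>- i t\<close>, reached through
  points with real part \<open>1 / (n + 1)\<close>.\<close>

lemma char_eq_laplace_limit:
  fixes Q :: "real measure"
  assumes Q: "prob_space Q" "sets Q = sets borel" and pos: "AE z in Q. 0 \<le> z"
  shows "(\<lambda>n. \<integral>z. exp (- Complex (1 / real (Suc n)) (- t) * complex_of_real z) \<partial>Q) \<longlonglongrightarrow> char Q t"
  unfolding char_def
proof (rule integral_dominated_convergence[where w="\<lambda>_. 1"])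
  interpret prob_space Q by fact
  note [measurable_cong] = Q(2)
  show "AE z in Q. norm (exp (- Complex (1 / real (Suc n)) (- t) * complex_of_real z)) \<le> 1" for n
    using pos by eventually_elim (simp add: norm_exp_eq_Re)
  show "AE z in Q. (\<lambda>n. exp (- Complex (1 / real (Suc n)) (- t) * complex_of_real z)) \<longlonglongrightarrow> iexp (t * z)"
  proof (rule AE_I2)
    fix z
    have "(\<lambda>n. exp (- Complex (1 / real (Suc n)) (- t) * complex_of_real z)) \<longlonglongrightarrow> exp (- Complex 0 (- t) * complex_of_real z)"
      using LIMSEQ_inverse_real_of_nat
      by (intro tendsto_intros tendsto_Complex) (simp_all add: inverse_eq_divide)
    also have "- Complex 0 (- t) * complex_of_real z = \<i> * of_real (t * z)" by (simp add: complex_eq_iff)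
    finally show "(\<lambda>n. exp (- Complex (1 / real (Suc n)) (- t) * complex_of_real z)) \<longlonglongrightarrow> iexp (t * z)" .
  qed
  show "(\<lambda>z. iexp (t * z)) \<in> borel_measurable Q" "(\<lambda>z. exp (- Complex (1 / real (Suc n)) (- t) * complex_of_real z)) \<in> borel_measurable Q" for n
    by measurable
  show "integrable Q (\<lambda>_. 1 :: real)" by simp
qed

text \<open>The parabola has limit points inside the right half-plane, so the identity theorem gives equality of the
  Laplace transforms there and, on the boundary, of the characteristic functions.\<close>

theorem laplace_parabola_unique:
  fixes Q P :: "real measure"
  assumes Q: "prob_space Q" "sets Q = sets borel" "AE z in Q. 0 \<le> z"
    and P: "prob_space P" "sets P = sets borel" "AE z in P. 0 \<le> z"
    and k: "0 < k"
    and eq: "\<And>r. 0 < r \<Longrightarrow> (\<integral>z. exp (- Complex (k * r\<^sup>2) (c * r) * complex_of_real z) \<partial>Q) =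
        (\<integral>z. exp (- Complex (k * r\<^sup>2) (c * r) * complex_of_real z) \<partial>P)"
  shows "Q = P"
proof -
  let ?F = "\<lambda>Q s. \<integral>z. exp (- s * complex_of_real z) \<partial>Q"
  let ?S = "{s. 0 < Re s}"
  let ?p = "\<lambda>r. Complex (k * r\<^sup>2) (c * r)"
  have all: "?F Q s - ?F P s = 0" if s: "0 < Re s" for s
  proof (rule analytic_continuation[of "\<lambda>s. ?F Q s - ?F P s" ?S "?p ` {0<..}" "?p 1" s])
    show "(\<lambda>s. ?F Q s - ?F P s) holomorphic_on ?S"
      by (intro holomorphic_on_diff laplace_holomorphic Q P)
    show "connected ?S" by (intro convex_connected convex_halfspace_Re_gt)
    show "?p 1 islimpt ?p ` {0<..}"
      unfolding islimpt_sequential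
    proof (intro exI conjI allI)
      show "?p (1 + 1 / real (Suc n)) \<in> ?p ` {0<..} - {?p 1}" for n
      proof -
        have "?p r \<noteq> ?p 1" if "1 < r" for r :: real
          using one_less_power[OF that, of 2] k by auto
        then have "?p (1 + 1 / real (Suc n)) \<noteq> ?p 1" by simp
        moreover have "?p (1 + 1 / real (Suc n)) \<in> ?p ` {0<..}"
          by (rule imageI) (simp add: add_pos_pos)
        ultimately show ?thesis by blast
      qed
      have "(\<lambda>n. 1 + 1 / real (Suc n)) \<longlonglongrightarrow> 1 + 0"
        by (intro tendsto_add tendsto_const) (use LIMSEQ_inverse_real_of_nat in \<open>simp add: inverse_eq_divide\<close>)
      then have "(\<lambda>n. 1 + 1 / real (Suc n)) \<longlonglongrightarrow> 1" by simp
      then show "(\<lambda>n. ?p (1 + 1 / real (Suc n))) \<longlonglongrightarrow> ?p 1"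
        by (intro tendsto_Complex tendsto_intros)
    qed
  qed (use k s eq in \<open>auto simp: open_halfspace_Re_gt\<close>)
  have "char Q t = char P t" for t
  proof (rule LIMSEQ_unique[OF char_eq_laplace_limit[OF Q]])
    have "?F Q (Complex (1 / real (Suc n)) (- t)) = ?F P (Complex (1 / real (Suc n)) (- t))" for n
      using all[of "Complex (1 / real (Suc n)) (- t)"] by simp
    then show "(\<lambda>n. ?F Q (Complex (1 / real (Suc n)) (- t))) \<longlonglongrightarrow> char P t"
      using char_eq_laplace_limit[OF P, of t] by simp
  qed
  then show ?thesis
    using Q P by (intro Levy_uniqueness) (auto simp: real_distribution_def real_distribution_axioms_def sets_eq_imp_space_eq)
qed

section \<open>Conditioning on a random index\<close>

text \<open>Otherwise there are members of the family with mass more than \<open>\<epsilon>\<close> beyond \<open>0, 1, 2, \<dots>\<close>, and a weak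
  subsequential limit of these would have mass at least \<open>\<epsilon>\<close> at infinity.\<close>

lemma weakly_relatively_compact_imp_upper_tight:
  assumes L: "weakly_relatively_compact {1..} L"
    and dist: "\<And>n. 1 \<le> n \<Longrightarrow> real_distribution (L n)" and \<epsilon>: "0 < \<epsilon>"
  shows "\<exists>K. \<forall>n\<ge>1. measure (L n) {K<..} \<le> \<epsilon>"
proof (rule ccontr)
  assume "\<not> ?thesis"
  then have "\<forall>K::nat. \<exists>n\<ge>1. \<epsilon> < measure (L n) {real K<..}" by (metis not_le)
  then obtain s where s: "\<And>K. 1 \<le> s K" "\<And>K. \<epsilon> < measure (L (s K)) {real K<..}" by metis
  from L s(1) obtain r Q where r: "strict_mono r" and Q: "real_distribution Q"
    and conv: "weak_conv_m (\<lambda>k. L (s (r k))) Q"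
    unfolding weakly_relatively_compact_def by (metis atLeast_iff image_subset_iff)
  interpret Q: real_distribution Q by fact
  have "\<forall>\<^sub>F x in at_top. 1 - \<epsilon> < cdf Q x"
    using Q.cdf_lim_at_top_prob \<epsilon> by (intro order_tendstoD(1)) auto
  then obtain x0 where x0: "\<And>x. x0 \<le> x \<Longrightarrow> 1 - \<epsilon> < cdf Q x" by (auto simp: eventually_at_top_linorder)
  \<comment> \<open>A point without an atom, where the distribution functions converge.\<close>
  have "\<not> {x0..x0 + 1} \<subseteq> {x. measure Q {x} \<noteq> 0}"
    using Q.countable_support countable_subset uncountable_closed_interval[of x0 "x0 + 1"] by auto
  then obtain x where x: "x0 \<le> x" "measure Q {x} = 0" by auto
  then have "isCont (cdf Q) x" by (simp add: Q.isCont_cdf)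
  then have "(\<lambda>k. cdf (L (s (r k))) x) \<longlonglongrightarrow> cdf Q x"
    using conv by (simp add: weak_conv_m_def weak_conv_def)
  then have "\<forall>\<^sub>F k in sequentially. 1 - \<epsilon> < cdf (L (s (r k))) x"
    using x0[OF x(1)] by (rule order_tendstoD)
  moreover have "\<forall>\<^sub>F k in sequentially. x \<le> real k"
    using eventually_ge_at_top[of "nat \<lceil>x\<rceil>"] by eventually_elim linarith
  ultimately obtain k where k: "1 - \<epsilon> < cdf (L (s (r k))) x" "x \<le> real k"
    by (metis (mono_tags, lifting) eventually_conj eventually_happens trivial_limit_sequentially)
  interpret D: real_distribution "L (s (r k))" using s(1) by (rule dist)
  have "k \<le> r k" using r by (rule seq_suble)
  then have "measure (L (s (r k))) {real (r k)<..} \<le> measure (L (s (r k))) {x<..}"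
    using k(2) by (intro D.finite_measure_mono) auto
  also have "\<dots> = 1 - cdf (L (s (r k))) x"
    using D.prob_compl[of "{..x}"] by (simp add: cdf_def Compl_eq_Diff_UNIV[symmetric])
  finally show False using s(2)[of "r k"] k(1) by linarith
qed

text \<open>The measures \<open>B \<mapsto> P(N = k, V \<in> B)\<close> and \<open>B \<mapsto> P(N = k) P(V \<in> B)\<close> coincide.\<close>

lemma integral_indep_event:
  fixes F :: "'b \<Rightarrow> complex"
  assumes M: "prob_space M" and ind: "indep_rvs M (count_space UNIV) N S V"
    and F[measurable]: "F \<in> borel_measurable S"
  shows "(\<integral>\<omega>. indicator {\<omega>. N \<omega> = k} \<omega> *\<^sub>R F (V \<omega>) \<partial>M) = measure M {\<omega> \<in> space M. N \<omega> = k} *\<^sub>R (\<integral>\<omega>. F (V \<omega>) \<partial>M)"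
proof -
  interpret prob_space M by fact
  have [measurable]: "N \<in> M \<rightarrow>\<^sub>M count_space UNIV" "V \<in> M \<rightarrow>\<^sub>M S"
    and iset: "indep_set {N -` A \<inter> space M | A. A \<in> sets (count_space UNIV)} {V -` B \<inter> space M | B. B \<in> sets S}"
    using ind by (auto simp: indep_rvs_def)
  let ?E = "{\<omega> \<in> space M. N \<omega> = k}"
  let ?p = "measure M ?E"
  have E[measurable]: "?E \<in> sets M" by measurable
  have prod: "prob (?E \<inter> (V -` B \<inter> space M)) = ?p * prob (V -` B \<inter> space M)" if "B \<in> sets S" for B
  proof (rule indep_setD[OF iset])
    show "?E \<in> {N -` A \<inter> space M | A. A \<in> sets (count_space UNIV)}" by (auto intro!: exI[of _ "{k}"])
  qed (use that in blast)
  have "distr (density M (indicator ?E)) S V = density (distr M S V) (\<lambda>_. ennreal ?p)"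
  proof (rule measure_eqI)
    fix B assume "B \<in> sets (distr (density M (indicator ?E)) S V)"
    then have B[measurable]: "B \<in> sets S" by simp
    have "emeasure (distr (density M (indicator ?E)) S V) B = emeasure (density M (indicator ?E)) (V -` B \<inter> space M)"
      by (simp add: emeasure_distr)
    also have "\<dots> = (\<integral>\<^sup>+\<omega>. indicator ?E \<omega> * indicator (V -` B \<inter> space M) \<omega> \<partial>M)"
      by (rule emeasure_density) measurable
    also have "\<dots> = (\<integral>\<^sup>+\<omega>. indicator (?E \<inter> (V -` B \<inter> space M)) \<omega> \<partial>M)"
      by (simp only: indicator_inter_arith)
    also have "\<dots> = ennreal ?p * emeasure M (V -` B \<inter> space M)"
      by (subst nn_integral_indicator) (auto simp: emeasure_eq_measure prod[OF B] ennreal_mult)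
    also have "\<dots> = emeasure (density (distr M S V) (\<lambda>_. ennreal ?p)) B"
      by (simp add: emeasure_density_const emeasure_distr)
    finally show "emeasure (distr (density M (indicator ?E)) S V) B = emeasure (density (distr M S V) (\<lambda>_. ennreal ?p)) B" .
  qed simp
  then have eq: "integral\<^sup>L (distr (density M (\<lambda>x. ennreal (indicator ?E x))) S V) F = integral\<^sup>L (density (distr M S V) (\<lambda>_. ennreal ?p)) F"
    by (simp add: ennreal_indicator)
  have "(\<integral>\<omega>. indicator {\<omega>. N \<omega> = k} \<omega> *\<^sub>R F (V \<omega>) \<partial>M) = (\<integral>\<omega>. indicator ?E \<omega> *\<^sub>R F (V \<omega>) \<partial>M)"
    by (intro Bochner_Integration.integral_cong) (auto simp: indicator_def)
  also have "\<dots> = (\<integral>\<omega>. F (V \<omega>) \<partial>density M (\<lambda>x. ennreal (indicator ?E x)))"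
    by (subst integral_density) auto
  also have "\<dots> = integral\<^sup>L (density (distr M S V) (\<lambda>_. ennreal ?p)) F"
    by (subst eq[symmetric], subst integral_distr) auto
  also have "\<dots> = ?p *\<^sub>R (\<integral>\<omega>. F (V \<omega>) \<partial>M)"
    by (subst integral_density) (auto simp: integral_distr)
  finally show ?thesis .
qed

lemma integral_level_sets_tendsto:
  fixes g :: "'w \<Rightarrow> complex"
  assumes M: "prob_space M" and [measurable]: "N \<in> M \<rightarrow>\<^sub>M count_space UNIV" "g \<in> borel_measurable M"
    and g: "\<And>\<omega>. \<omega> \<in> space M \<Longrightarrow> norm (g \<omega>) \<le> 1"
  shows "(\<lambda>K. \<Sum>k<K. \<integral>\<omega>. indicator {\<omega>. N \<omega> = k} \<omega> *\<^sub>R g \<omega> \<partial>M) \<longlonglongrightarrow> (\<integral>\<omega>. g \<omega> \<partial>M)"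
proof -
  interpret prob_space M by fact
  have int: "integrable M (\<lambda>\<omega>. indicator {\<omega>. N \<omega> = k} \<omega> *\<^sub>R g \<omega>)" for k
    by (rule integrable_const_bound[of _ 1]) (use g in \<open>auto simp: indicator_def\<close>)
  have S: "(\<Sum>k<K. indicator {\<omega>. N \<omega> = k} \<omega> *\<^sub>R g \<omega>) = (if N \<omega> < K then g \<omega> else 0)" for K \<omega>
  proof -
    have "(\<Sum>k<K. indicator {\<omega>. N \<omega> = k} \<omega> *\<^sub>R g \<omega>) = (\<Sum>k<K. if k = N \<omega> then g \<omega> else 0)"
      by (intro sum.cong) (auto simp: indicator_def)
    then show ?thesis by simp
  qed
  have "(\<lambda>K. \<integral>\<omega>. (\<Sum>k<K. indicator {\<omega>. N \<omega> = k} \<omega> *\<^sub>R g \<omega>) \<partial>M) \<longlonglongrightarrow> (\<integral>\<omega>. g \<omega> \<partial>M)"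
  proof (rule integral_dominated_convergence[where w="\<lambda>_. 1"])
    show "AE \<omega> in M. (\<lambda>K. \<Sum>k<K. indicator {\<omega>. N \<omega> = k} \<omega> *\<^sub>R g \<omega>) \<longlonglongrightarrow> g \<omega>"
    proof (intro AE_I2 tendsto_eventually)
      fix \<omega>
      show "\<forall>\<^sub>F K in sequentially. (\<Sum>k<K. indicator {\<omega>. N \<omega> = k} \<omega> *\<^sub>R g \<omega>) = g \<omega>"
        using eventually_gt_at_top[of "N \<omega>"] by eventually_elim (simp add: S)
    qed
    show "AE \<omega> in M. norm (\<Sum>k<K. indicator {\<omega>. N \<omega> = k} \<omega> *\<^sub>R g \<omega>) \<le> 1" for K
      using g by (intro AE_I2) (simp add: S)
  qed (use int in auto)
  then show ?thesis using int by (subst (asm) Bochner_Integration.integral_sum) auto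
qed

text \<open>Disintegration over the value of \<open>N\<close>. Independence of \<open>N\<close> from each single \<open>V k\<close> is enough, since each
  event \<open>N = k\<close> sees only \<open>V k\<close>.\<close>

lemma integral_random_index:
  fixes F :: "nat \<Rightarrow> 'b \<Rightarrow> complex"
  assumes M: "prob_space M" and N[measurable]: "N \<in> M \<rightarrow>\<^sub>M count_space UNIV"
    and N1: "\<And>\<omega>. \<omega> \<in> space M \<Longrightarrow> 1 \<le> N \<omega>"
    and ind: "\<And>k. 1 \<le> k \<Longrightarrow> indep_rvs M (count_space UNIV) N S (V k)"
    and F[measurable]: "\<And>k. F k \<in> borel_measurable S" and F1: "\<And>k x. norm (F k x) \<le> 1"
  shows "(\<integral>\<omega>. F (N \<omega>) (V (N \<omega>) \<omega>) \<partial>M) = (\<integral>\<omega>. (\<integral>\<omega>'. F (N \<omega>) (V (N \<omega>) \<omega>') \<partial>M) \<partial>M)"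
proof -
  interpret prob_space M by fact
  \<comment> \<open>Nothing is assumed about \<open>V 0\<close>, which may fail to be measurable.\<close>
  let ?V = "\<lambda>k. if 1 \<le> k then V k else V 1"
  have V: "?V k \<in> M \<rightarrow>\<^sub>M S" for k using ind[of k] ind[of 1] by (auto simp: indep_rvs_def)
  note [measurable] = V
  let ?H = "\<lambda>k. \<integral>\<omega>'. F k (?V k \<omega>') \<partial>M"
  have H1: "norm (?H k) \<le> 1" for k
  proof -
    have "integrable M (\<lambda>\<omega>'. F k (?V k \<omega>'))"
      by (rule integrable_const_bound[of _ 1, OF _ measurable_compose[OF V F]]) (use F1 in simp)
    note int = integrable_norm[OF this]
    have "norm (?H k) \<le> (\<integral>\<omega>'. norm (F k (?V k \<omega>')) \<partial>M)" by (rule integral_norm_bound)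
    also have "\<dots> \<le> (\<integral>\<omega>'. 1 \<partial>M)"
      using F1 by (intro integral_mono int) auto
    finally show ?thesis by (simp add: prob_space)
  qed
  have m1[measurable]: "(\<lambda>\<omega>. F (N \<omega>) (?V (N \<omega>) \<omega>)) \<in> borel_measurable M"
    by (rule measurable_compose_countable[OF _ N]) measurable
  have m2[measurable]: "(\<lambda>\<omega>. ?H (N \<omega>)) \<in> borel_measurable M"
    by (rule measurable_compose[OF N]) simp
  have "(\<integral>\<omega>. indicator {\<omega>. N \<omega> = k} \<omega> *\<^sub>R F (N \<omega>) (?V (N \<omega>) \<omega>) \<partial>M)
      = (\<integral>\<omega>. indicator {\<omega>. N \<omega> = k} \<omega> *\<^sub>R ?H (N \<omega>) \<partial>M)" for k
  proof -
    have "(\<integral>\<omega>. indicator {\<omega>. N \<omega> = k} \<omega> *\<^sub>R F (N \<omega>) (?V (N \<omega>) \<omega>) \<partial>M)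
      = (\<integral>\<omega>. indicator {\<omega>. N \<omega> = k} \<omega> *\<^sub>R F k (?V k \<omega>) \<partial>M)"
    proof (intro Bochner_Integration.integral_cong refl)
      show "indicator {\<omega>. N \<omega> = k} \<omega> *\<^sub>R F (N \<omega>) (?V (N \<omega>) \<omega>) = indicator {\<omega>. N \<omega> = k} \<omega> *\<^sub>R F k (?V k \<omega>)" for \<omega>
        by (cases "N \<omega> = k") simp_all
    qed
    also have "\<dots> = measure M {\<omega> \<in> space M. N \<omega> = k} *\<^sub>R ?H k"
      using ind[of k] ind[of 1] by (intro integral_indep_event[OF M, of _ S]) auto
    also have "\<dots> = (\<integral>\<omega>. indicator {\<omega> \<in> space M. N \<omega> = k} \<omega> *\<^sub>R ?H k \<partial>M)"
    proof -
      have "integrable M (indicator {\<omega> \<in> space M. N \<omega> = k} :: _ \<Rightarrow> real)"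
        by (intro integrable_real_indicator) (auto simp: emeasure_eq_measure)
      then show ?thesis by (simp add: Int_def cong: conj_cong)
    qed
    also have "\<dots> = (\<integral>\<omega>. indicator {\<omega>. N \<omega> = k} \<omega> *\<^sub>R ?H (N \<omega>) \<partial>M)"
    proof (intro Bochner_Integration.integral_cong refl)
      show "indicator {\<omega> \<in> space M. N \<omega> = k} \<omega> *\<^sub>R ?H k = indicator {\<omega>. N \<omega> = k} \<omega> *\<^sub>R ?H (N \<omega>)"
        if "\<omega> \<in> space M" for \<omega>
        using that by (cases "N \<omega> = k") simp_all
    qed
    finally show ?thesis .
  qed
  then have "(\<integral>\<omega>. F (N \<omega>) (?V (N \<omega>) \<omega>) \<partial>M) = (\<integral>\<omega>. ?H (N \<omega>) \<partial>M)"
    using integral_level_sets_tendsto[OF M N m1 F1] integral_level_sets_tendsto[OF M N m2 H1]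
    by (simp add: LIMSEQ_unique)
  also have "(\<integral>\<omega>. F (N \<omega>) (?V (N \<omega>) \<omega>) \<partial>M) = (\<integral>\<omega>. F (N \<omega>) (V (N \<omega>) \<omega>) \<partial>M)"
    using N1 by (intro Bochner_Integration.integral_cong) auto
  also have "(\<integral>\<omega>. ?H (N \<omega>) \<partial>M) = (\<integral>\<omega>. (\<integral>\<omega>'. F (N \<omega>) (V (N \<omega>) \<omega>') \<partial>M) \<partial>M)"
    using N1 by (intro Bochner_Integration.integral_cong) auto
  finally show ?thesis .
qed

lemma cmod_iexp_diff_le: "cmod (iexp x - iexp y) \<le> \<bar>x - y\<bar>"
proof -
  have "iexp x - iexp y = iexp y * (iexp (x - y) - 1)"
    by (simp add: right_diff_distrib exp_diff)
  then have "cmod (iexp x - iexp y) = cmod (iexp (x - y) - 1)" by (simp add: norm_mult)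
  then show ?thesis using iexp_approx1[of "x - y" 0] by simp
qed

text \<open>Given \<open>N = k\<close>, the characteristic function is
  \<open>exp(- i \<langle>t, b\<^sub>n\<rangle>) exp(i U \<langle>t, a\<^sub>n\<rangle>) h\<^sub>k(\<surd>U t)\<close>. Where \<open>U \<le> K\<close>, the argument \<open>\<surd>U t\<close> lies in the ball of
  radius \<open>R\<close>, and replacing \<open>h\<^sub>k\<close> by the Gaussian and \<open>a\<^sub>n\<close> by \<open>a\<close> costs the first two terms; elsewhere
  both integrands are at most one in modulus.\<close>

lemma char_fun_random_size_bound:
  fixes V :: "nat \<Rightarrow> 'w \<Rightarrow> real ^ 'm" and S :: "real ^ 'm ^ 'm" and a a\<^sub>n b\<^sub>n t :: "real ^ 'm"
    and \<sigma> K R :: real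
  assumes M: "prob_space M" and N[measurable]: "N \<in> M \<rightarrow>\<^sub>M count_space UNIV"
    and N1: "\<And>\<omega>. \<omega> \<in> space M \<Longrightarrow> 1 \<le> N \<omega>"
    and ind: "\<And>k. 1 \<le> k \<Longrightarrow> indep_rvs M (count_space UNIV) N borel (V k)"
    and n: "1 \<le> n" and S: "pos_def_matrix S" and K: "0 \<le> K" and R: "sqrt K * norm t \<le> R"
  defines "Y \<equiv> \<lambda>k \<omega>. (\<sigma> * sqrt (real k)) *\<^sub>R V k \<omega> - sqrt (real n / real k) *\<^sub>R a\<^sub>n"
    and "U \<equiv> \<lambda>\<omega>. real n / real (N \<omega>)"
  shows "cmod (char_fun (distr M borel (\<lambda>\<omega>. (\<sigma> * sqrt (real n)) *\<^sub>R V (N \<omega>) \<omega> - b\<^sub>n)) t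
      - iexp (- (t \<bullet> b\<^sub>n)) * (\<integral>\<omega>. exp (- Complex (t \<bullet> (S *v t) / 2) (- (t \<bullet> a)) * of_real (U \<omega>)) \<partial>M))
    \<le> (\<integral>\<omega>. (SUP u\<in>cball 0 R. cmod (char_fun (distr M borel (Y (N \<omega>))) u - of_real (exp (- (u \<bullet> (S *v u)) / 2)))) \<partial>M)
      + K * \<bar>t \<bullet> (a\<^sub>n - a)\<bar> + 4 * measure M {\<omega> \<in> space M. K < U \<omega>}"
proof -
  interpret prob_space M by fact
  have Vm: "V k \<in> borel_measurable M" if "1 \<le> k" for k using ind[OF that] by (simp add: indep_rvs_def)
  let ?V = "\<lambda>k. if 1 \<le> k then V k else V 1"
  have V'm[measurable]: "?V k \<in> borel_measurable M" for k using Vm by auto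
  have VNm[measurable]: "(\<lambda>\<omega>. V (N \<omega>) \<omega>) \<in> borel_measurable M"
  proof (subst measurable_cong)
    show "(\<lambda>\<omega>. ?V (N \<omega>) \<omega>) \<in> borel_measurable M"
      by (rule measurable_compose_countable[OF _ N]) measurable
  qed (use N1 in auto)
  have Ym: "Y k \<in> borel_measurable M" if "1 \<le> k" for k
    using Vm[OF that] unfolding Y_def by measurable
  have Um[measurable]: "U \<in> borel_measurable M" unfolding U_def by measurable
  define h where "h k = char_fun (distr M borel (Y k))" for k
  define g where "g u = complex_of_real (exp (- (u \<bullet> (S *v u)) / 2))" for u :: "real ^ 'm"
  have h1: "cmod (h k u) \<le> 1" if "1 \<le> k" for k u
    unfolding h_def using Ym[OF that] by (intro cmod_char_fun_le_1 prob_space_distr)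
  have quad: "0 \<le> u \<bullet> (S *v u)" for u
    using S by (cases "u = 0") (auto simp: pos_def_matrix_def intro: less_imp_le)
  have g1: "cmod (g u) \<le> 1" for u using quad[of u] by (simp add: g_def)
  let ?sup = "\<lambda>k. SUP u\<in>cball 0 R. cmod (h k u - g u)"
  have hg: "cmod (h k u - g u) \<le> 2" if "1 \<le> k" for k u
    using norm_triangle_ineq4[of "h k u" "g u"] h1[OF that, of u] g1[of u] by linarith
  have R0: "0 \<le> R" using R K by (meson mult_nonneg_nonneg norm_ge_zero order_trans real_sqrt_ge_zero)
  have sup: "cmod (h k u - g u) \<le> ?sup k" if "1 \<le> k" "norm u \<le> R" for k u
    using that hg by (intro cSUP_upper bdd_aboveI2[where M=2]) auto
  have sup2: "?sup k \<le> 2" "0 \<le> ?sup k" if "1 \<le> k" for k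
    using sup[OF that, of 0] R0 hg[OF that] by (auto intro!: cSUP_least intro: order_trans[OF norm_ge_zero])
  let ?s = "Complex (t \<bullet> (S *v t) / 2) (- (t \<bullet> a))"
  let ?I = "\<lambda>\<omega>. iexp (U \<omega> * (t \<bullet> a\<^sub>n)) * h (N \<omega>) (sqrt (U \<omega>) *\<^sub>R t)"
  let ?J = "\<lambda>\<omega>. exp (- ?s * of_real (U \<omega>))"
  have U0: "0 \<le> U \<omega>" for \<omega> by (simp add: U_def)
  have Im[measurable]: "?I \<in> borel_measurable M"
    unfolding U_def by (rule measurable_compose[OF N]) simp
  have Jm[measurable]: "?J \<in> borel_measurable M" by measurable
  have J: "?J \<omega> = iexp (U \<omega> * (t \<bullet> a)) * g (sqrt (U \<omega>) *\<^sub>R t)" for \<omega>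
  proof -
    have "g (sqrt (U \<omega>) *\<^sub>R t) = exp (of_real (- (U \<omega> * (t \<bullet> (S *v t)) / 2)))"
      using U0[of \<omega>] unfolding g_def exp_of_real
      by (simp add: matrix_vector_mult_scaleR flip: mult.assoc)
    moreover have "- ?s * of_real (U \<omega>) = \<i> * of_real (U \<omega> * (t \<bullet> a)) + of_real (- (U \<omega> * (t \<bullet> (S *v t)) / 2))"
      by (simp add: complex_eq_iff)
    ultimately show ?thesis by (simp only: exp_add)
  qed
  have I1: "cmod (?I \<omega>) \<le> 1" if "\<omega> \<in> space M" for \<omega> using h1[OF N1[OF that]] by (simp add: norm_mult)
  have J1: "cmod (?J \<omega>) \<le> 1" for \<omega> using g1 unfolding J by (simp add: norm_mult)
  have intI: "integrable M ?I" "integrable M ?J"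
    by (rule integrable_const_bound[of _ 1, OF _ Im], intro AE_I2 I1, assumption)
       (rule integrable_const_bound[of _ 1, OF _ Jm], intro AE_I2 J1)
  have row: "(\<integral>\<omega>'. iexp (t \<bullet> ((\<sigma> * sqrt (real n)) *\<^sub>R V (N \<omega>) \<omega>' - b\<^sub>n)) \<partial>M) = iexp (- (t \<bullet> b\<^sub>n)) * ?I \<omega>"
    if \<omega>: "\<omega> \<in> space M" for \<omega>
  proof -
    let ?k = "N \<omega>"
    have k: "1 \<le> ?k" by (rule N1[OF \<omega>])
    have sU: "sqrt (U \<omega>) * sqrt (real ?k) = sqrt (real n)" "sqrt (U \<omega>) * sqrt (real n / real ?k) = U \<omega>"
      using k U0[of \<omega>] by (auto simp: U_def simp flip: real_sqrt_mult)
    have "(\<sigma> * sqrt (real n)) *\<^sub>R v = sqrt (U \<omega>) *\<^sub>R ((\<sigma> * sqrt (real ?k)) *\<^sub>R v - sqrt (real n / real ?k) *\<^sub>R a\<^sub>n) + U \<omega> *\<^sub>R a\<^sub>n" for v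
      using sU by (simp add: scaleR_diff_right mult.left_commute)
    note vv = this
    have lin: "t \<bullet> ((\<sigma> * sqrt (real n)) *\<^sub>R V ?k \<omega>' - b\<^sub>n) = - (t \<bullet> b\<^sub>n) + U \<omega> * (t \<bullet> a\<^sub>n) + (sqrt (U \<omega>) *\<^sub>R t) \<bullet> Y ?k \<omega>'" for \<omega>'
      unfolding vv Y_def by (simp add: inner_diff_right inner_add_right right_diff_distrib)
    have "(\<integral>\<omega>'. iexp (t \<bullet> ((\<sigma> * sqrt (real n)) *\<^sub>R V ?k \<omega>' - b\<^sub>n)) \<partial>M)
       = (\<integral>\<omega>'. iexp (- (t \<bullet> b\<^sub>n)) * iexp (U \<omega> * (t \<bullet> a\<^sub>n)) * iexp ((sqrt (U \<omega>) *\<^sub>R t) \<bullet> Y ?k \<omega>') \<partial>M)"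
      unfolding lin by (simp only: of_real_add distrib_left exp_add)
    also have "\<dots> = iexp (- (t \<bullet> b\<^sub>n)) * iexp (U \<omega> * (t \<bullet> a\<^sub>n)) * h ?k (sqrt (U \<omega>) *\<^sub>R t)"
      unfolding h_def char_fun_def using Ym[OF k] by (simp add: integral_distr del: inner_scaleR_left)
    finally show ?thesis by (simp only: mult.assoc)
  qed
  have "char_fun (distr M borel (\<lambda>\<omega>. (\<sigma> * sqrt (real n)) *\<^sub>R V (N \<omega>) \<omega> - b\<^sub>n)) t
      = (\<integral>\<omega>. iexp (t \<bullet> ((\<sigma> * sqrt (real n)) *\<^sub>R V (N \<omega>) \<omega> - b\<^sub>n)) \<partial>M)"
    unfolding char_fun_def by (subst integral_distr) auto
  also have "\<dots> = (\<integral>\<omega>. (\<integral>\<omega>'. iexp (t \<bullet> ((\<sigma> * sqrt (real n)) *\<^sub>R V (N \<omega>) \<omega>' - b\<^sub>n)) \<partial>M) \<partial>M)"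
    using integral_random_index[OF M N N1 ind, where F="\<lambda>k v. iexp (t \<bullet> ((\<sigma> * sqrt (real n)) *\<^sub>R v - b\<^sub>n))"] by simp
  also have "\<dots> = (\<integral>\<omega>. iexp (- (t \<bullet> b\<^sub>n)) * ?I \<omega> \<partial>M)"
    by (intro Bochner_Integration.integral_cong row) auto
  finally have "char_fun (distr M borel (\<lambda>\<omega>. (\<sigma> * sqrt (real n)) *\<^sub>R V (N \<omega>) \<omega> - b\<^sub>n)) t
      - iexp (- (t \<bullet> b\<^sub>n)) * (\<integral>\<omega>. ?J \<omega> \<partial>M) = iexp (- (t \<bullet> b\<^sub>n)) * (\<integral>\<omega>. ?I \<omega> - ?J \<omega> \<partial>M)"
    using intI by (simp only: integral_mult_right_zero Bochner_Integration.integral_diff right_diff_distrib)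
  then have "cmod (char_fun (distr M borel (\<lambda>\<omega>. (\<sigma> * sqrt (real n)) *\<^sub>R V (N \<omega>) \<omega> - b\<^sub>n)) t
      - iexp (- (t \<bullet> b\<^sub>n)) * (\<integral>\<omega>. ?J \<omega> \<partial>M)) = cmod (\<integral>\<omega>. ?I \<omega> - ?J \<omega> \<partial>M)"
    by (simp add: norm_mult)
  also have "\<dots> \<le> (\<integral>\<omega>. cmod (?I \<omega> - ?J \<omega>) \<partial>M)" by (rule integral_norm_bound)
  also have "\<dots> \<le> (\<integral>\<omega>. ?sup (N \<omega>) + K * \<bar>t \<bullet> (a\<^sub>n - a)\<bar> + 4 * indicator {\<omega> \<in> space M. K < U \<omega>} \<omega> \<partial>M)"
  proof (rule integral_mono)
    have "integrable M (\<lambda>\<omega>. ?sup (N \<omega>))"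
    proof (rule integrable_const_bound[of _ 2])
      show "(\<lambda>\<omega>. ?sup (N \<omega>)) \<in> borel_measurable M" by (rule measurable_compose[OF N]) simp
      show "AE \<omega> in M. norm (?sup (N \<omega>)) \<le> 2" using sup2 N1 by (intro AE_I2) simp
    qed
    then show "integrable M (\<lambda>\<omega>. ?sup (N \<omega>) + K * \<bar>t \<bullet> (a\<^sub>n - a)\<bar> + 4 * indicator {\<omega> \<in> space M. K < U \<omega>} \<omega>)"
      by (intro Bochner_Integration.integrable_add integrable_mult_right integrable_real_indicator)
         (auto simp: emeasure_eq_measure)
    show "integrable M (\<lambda>\<omega>. cmod (?I \<omega> - ?J \<omega>))"
      using intI by (intro integrable_norm Bochner_Integration.integrable_diff)
    fix \<omega> assume \<omega>: "\<omega> \<in> space M"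
    have k: "1 \<le> N \<omega>" by (rule N1[OF \<omega>])
    show "cmod (?I \<omega> - ?J \<omega>) \<le> ?sup (N \<omega>) + K * \<bar>t \<bullet> (a\<^sub>n - a)\<bar> + 4 * indicator {\<omega> \<in> space M. K < U \<omega>} \<omega>"
    proof (cases "K < U \<omega>")
      case True
      have "cmod (?I \<omega> - ?J \<omega>) \<le> 2"
        using norm_triangle_ineq4[of "?I \<omega>" "?J \<omega>"] I1[OF \<omega>] J1[of \<omega>] by linarith
      moreover have "0 \<le> K * \<bar>t \<bullet> (a\<^sub>n - a)\<bar>" using K by simp
      ultimately show ?thesis using sup2(2)[OF k] True \<omega> by (simp only: indicator_def mem_Collect_eq) simp
    next
      case False
      let ?u = "sqrt (U \<omega>) *\<^sub>R t"
      have "norm ?u \<le> sqrt K * norm t" using False U0[of \<omega>] by (simp add: mult_right_mono)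
      then have hgs: "cmod (h (N \<omega>) ?u - g ?u) \<le> ?sup (N \<omega>)" using R by (intro sup[OF k]) linarith
      have "?I \<omega> - ?J \<omega> = iexp (U \<omega> * (t \<bullet> a\<^sub>n)) * (h (N \<omega>) ?u - g ?u)
          + (iexp (U \<omega> * (t \<bullet> a\<^sub>n)) - iexp (U \<omega> * (t \<bullet> a))) * g ?u"
        unfolding J by (simp only: right_diff_distrib left_diff_distrib) simp
      then have "cmod (?I \<omega> - ?J \<omega>) \<le> cmod (iexp (U \<omega> * (t \<bullet> a\<^sub>n)) * (h (N \<omega>) ?u - g ?u))
          + cmod ((iexp (U \<omega> * (t \<bullet> a\<^sub>n)) - iexp (U \<omega> * (t \<bullet> a))) * g ?u)"
        using norm_triangle_ineq by metis
      also have "cmod (iexp (U \<omega> * (t \<bullet> a\<^sub>n)) * (h (N \<omega>) ?u - g ?u)) = cmod (h (N \<omega>) ?u - g ?u)"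
        by (simp add: norm_mult)
      also have "cmod ((iexp (U \<omega> * (t \<bullet> a\<^sub>n)) - iexp (U \<omega> * (t \<bullet> a))) * g ?u)
          \<le> \<bar>U \<omega> * (t \<bullet> a\<^sub>n) - U \<omega> * (t \<bullet> a)\<bar> * 1"
        unfolding norm_mult by (intro mult_mono cmod_iexp_diff_le g1) auto
      also have "\<bar>U \<omega> * (t \<bullet> a\<^sub>n) - U \<omega> * (t \<bullet> a)\<bar> * 1 = U \<omega> * \<bar>t \<bullet> (a\<^sub>n - a)\<bar>"
        using U0[of \<omega>] by (simp add: inner_diff_right abs_mult flip: right_diff_distrib)
      also have "\<dots> \<le> K * \<bar>t \<bullet> (a\<^sub>n - a)\<bar>" using False by (intro mult_right_mono) auto
      finally show ?thesis using hgs False by (simp add: indicator_def)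
    qed
  qed
  also have "\<dots> = (\<integral>\<omega>. ?sup (N \<omega>) \<partial>M) + K * \<bar>t \<bullet> (a\<^sub>n - a)\<bar> + 4 * measure M {\<omega> \<in> space M. K < U \<omega>}"
  proof -
    have "integrable M (\<lambda>\<omega>. ?sup (N \<omega>))"
    proof (rule integrable_const_bound[of _ 2])
      show "(\<lambda>\<omega>. ?sup (N \<omega>)) \<in> borel_measurable M" by (rule measurable_compose[OF N]) simp
      show "AE \<omega> in M. norm (?sup (N \<omega>)) \<le> 2" using sup2 N1 by (intro AE_I2) simp
    qed
    moreover have "integrable M (indicator {\<omega> \<in> space M. K < U \<omega>} :: 'w \<Rightarrow> real)"
      by (intro integrable_real_indicator) (auto simp: emeasure_eq_measure)
    ultimately show ?thesis by (simp add: prob_space Int_def cong: conj_cong)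
  qed
  finally show ?thesis unfolding h_def g_def .
qed

section \<open>Weak convergence of nonnegative random variables and their reciprocals\<close>

text \<open>The extension by \<open>0\<close> to the left half-line keeps the function bounded; \<open>0\<close> is the only possible
  discontinuity, which is harmless for laws without an atom there.\<close>

lemma isCont_exp_reciprocal:
  assumes "x \<noteq> 0"
  shows "isCont (\<lambda>x :: real. if 0 < x then exp (- s * complex_of_real (1 / x)) else 0) x"
proof (cases "0 < x")
  case True
  have "\<forall>\<^sub>F y in nhds x. exp (- s * complex_of_real (1 / y)) = (if 0 < y then exp (- s * complex_of_real (1 / y)) else 0)"
    using eventually_nhds_in_open[of "{0<..}" x] True by (auto elim: eventually_mono)
  moreover have "isCont (\<lambda>x. exp (- s * complex_of_real (1 / x))) x"
    using True by (intro continuous_intros) auto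
  ultimately show ?thesis by (subst isCont_cong[symmetric]) auto
next
  case False
  then have "x < 0" using assms by simp
  then have "\<forall>\<^sub>F y in nhds x. (if 0 < y then exp (- s * complex_of_real (1 / y)) else 0) = 0"
    using eventually_nhds_in_open[of "{..<0}" x] by (auto elim: eventually_mono)
  from isCont_cong[OF this] show ?thesis by (simp only: continuous_const)
qed

lemma emeasure_singleton_0:
  assumes "real_distribution P" and pos: "AE x in P. 0 < x"
  shows "emeasure P {0} = 0"
proof -
  interpret real_distribution P by fact
  have "AE x in P. \<not> x = 0" using pos by eventually_elim simp
  then have "emeasure P {x \<in> space P. x = 0} = 0" by (rule emeasure_eq_0_AE)
  then show ?thesis by simp
qed

lemma weak_conv_m_reciprocal_imp_exp_tendsto:
  assumes V: "\<And>n. real_distribution (V n)" "\<And>n. AE x in V n. 0 < x"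
    and P: "real_distribution P" "AE x in P. 0 < x" and conv: "weak_conv_m V P" and s: "0 \<le> Re s"
  shows "(\<lambda>n. \<integral>x. exp (- s * complex_of_real (1 / x)) \<partial>V n) \<longlonglongrightarrow> (\<integral>x. exp (- s * complex_of_real (1 / x)) \<partial>P)"
proof -
  let ?f = "\<lambda>x :: real. if 0 < x then exp (- s * complex_of_real (1 / x)) else 0"
  have eq: "(\<integral>x. exp (- s * complex_of_real (1 / x)) \<partial>Q) = (\<integral>x. ?f x \<partial>Q)"
    if Q: "real_distribution Q" "AE x in Q. 0 < x" for Q
  proof -
    interpret real_distribution Q by fact
    show ?thesis by (rule integral_cong_AE) (use Q(2) in \<open>auto elim: eventually_mono\<close>)
  qed
  interpret P: real_distribution P by fact
  have "{x. \<not> isCont ?f x} \<subseteq> {0}" using isCont_exp_reciprocal by blast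
  then have "emeasure P {x. \<not> isCont ?f x} = 0"
    by (rule emeasure_eq_0[OF _ emeasure_singleton_0[OF P], rotated]) simp
  then have "(\<lambda>n. \<integral>x. ?f x \<partial>V n) \<longlonglongrightarrow> (\<integral>x. ?f x \<partial>P)"
    by (intro weak_conv_imp_bdd_ae_continuous_conv[OF V(1) P(1) conv, where B=1])
       (use s in \<open>auto simp: norm_exp_eq_Re\<close>)
  then show ?thesis unfolding eq[OF V] eq[OF P] .
qed

lemma weak_conv_m_reciprocal:
  assumes U: "\<And>n. real_distribution (U n)"
    and P: "real_distribution P" "AE x in P. 0 < x" and conv: "weak_conv_m U P"
  shows "weak_conv_m (\<lambda>n. distr (U n) borel (\<lambda>x. 1 / x)) (distr P borel (\<lambda>x. 1 / x))"
proof -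
  interpret P: real_distribution P by fact
  interpret U: real_distribution "U n" for n by (rule U)
  have P0: "emeasure P {0} = 0" by (rule emeasure_singleton_0[OF P])
  show ?thesis
  proof (rule integral_bdd_continuous_conv_imp_weak_conv)
    show "real_distribution (distr (U n) borel (\<lambda>x. 1 / x))" for n by simp
    show "real_distribution (distr P borel (\<lambda>x. 1 / x))" by simp
    fix f :: "real \<Rightarrow> real" assume f: "\<And>x. isCont f x" "\<And>x. \<bar>f x\<bar> \<le> 1"
    have fm[measurable]: "f \<in> borel_measurable borel"
      using f(1) by (intro borel_measurable_continuous_onI continuous_at_imp_continuous_on) auto
    have "isCont (\<lambda>x. f (1 / x)) x" if "x \<noteq> 0" for x
      using that by (intro isCont_o2[of _ "\<lambda>x. 1 / x" f] f continuous_intros) auto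
    then have "{x. \<not> isCont (\<lambda>x. f (1 / x)) x} \<subseteq> {0}" by blast
    then have "emeasure P {x. \<not> isCont (\<lambda>x. f (1 / x)) x} = 0"
      by (rule emeasure_eq_0[OF _ P0, rotated]) simp
    then have "(\<lambda>n. \<integral>x. f (1 / x) \<partial>U n) \<longlonglongrightarrow> (\<integral>x. f (1 / x) \<partial>P)"
      by (intro weak_conv_imp_bdd_ae_continuous_conv[OF U P(1) conv, where B=1]) (use f in auto)
    then show "(\<lambda>n. integral\<^sup>L (distr (U n) borel (\<lambda>x. 1 / x)) f) \<longlonglongrightarrow> integral\<^sup>L (distr P borel (\<lambda>x. 1 / x)) f"
      by (simp add: integral_distr)
  qed
qed

text \<open>Composing with \<open>max 0\<close> admits functions that are bounded on \<open>[0, \<infinity>)\<close> only, such as \<open>exp (- s z)\<close>, and it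
  moves the limit law to \<open>[0, \<infinity>)\<close> without first showing that it lives there.\<close>

lemma nonneg_weak_conv_m_imp_tendsto:
  fixes f :: "real \<Rightarrow> 'a :: {banach, second_countable_topology}"
  assumes U: "\<And>n. real_distribution (U n)" "\<And>n. AE z in U n. 0 \<le> z"
    and P: "real_distribution P" and conv: "weak_conv_m U P"
    and f: "\<And>z. isCont f z" "\<And>z. 0 \<le> z \<Longrightarrow> norm (f z) \<le> B"
  shows "(\<lambda>n. \<integral>z. f z \<partial>U n) \<longlonglongrightarrow> (\<integral>z. f z \<partial>distr P borel (max 0))"
proof -
  interpret U: real_distribution "U n" for n by (rule U(1))
  interpret P: real_distribution P by (rule P)
  have [measurable]: "f \<in> borel_measurable borel"
    using f(1) by (intro borel_measurable_continuous_onI continuous_at_imp_continuous_on) auto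
  have "(\<lambda>n. \<integral>z. f (max 0 z) \<partial>U n) \<longlonglongrightarrow> (\<integral>z. f (max 0 z) \<partial>P)"
  proof (rule weak_conv_imp_integral_bdd_continuous_conv[OF U(1) P conv])
    show "isCont (\<lambda>z. f (max 0 z)) z" for z
      by (intro isCont_o2[of _ "max 0" f] f continuous_intros)
    show "norm (f (max 0 z)) \<le> B" for z by (intro f) simp
  qed
  moreover have "(\<integral>z. f (max 0 z) \<partial>U n) = (\<integral>z. f z \<partial>U n)" for n
    by (rule integral_cong_AE) (use U(2)[of n] in \<open>auto elim!: eventually_mono simp: max_def\<close>)
  ultimately show ?thesis by (simp add: integral_distr)
qed

text \<open>Tightness supplies subsequential limits, and each of them is identified by
  \<open>laplace_parabola_unique\<close>.\<close>

lemma laplace_parabola_tendsto_imp_weak_conv_m: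
  fixes U :: "nat \<Rightarrow> real measure"
  assumes U: "\<And>n. real_distribution (U n)" "\<And>n. AE z in U n. 0 \<le> z"
    and tight: "\<And>\<epsilon>. 0 < \<epsilon> \<Longrightarrow> \<exists>K. \<forall>n. measure (U n) {K<..} \<le> \<epsilon>"
    and P: "real_distribution P" "AE z in P. 0 \<le> z" and k: "0 < k"
    and conv: "\<And>r. 0 < r \<Longrightarrow> (\<lambda>n. \<integral>z. exp (- Complex (k * r\<^sup>2) (c * r) * complex_of_real z) \<partial>U n)
        \<longlonglongrightarrow> (\<integral>z. exp (- Complex (k * r\<^sup>2) (c * r) * complex_of_real z) \<partial>P)"
  shows "weak_conv_m U P"
proof (rule tight_subseq_weak_converge[OF U(1) P(1)])
  interpret U: real_distribution "U n" for n by (rule U(1))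
  interpret P: real_distribution P by (rule P(1))
  show "Helly_Selection.tight U"
    unfolding tight_def
  proof (intro conjI allI impI)
    fix \<epsilon> :: real assume "0 < \<epsilon>"
    then obtain K where K: "\<And>n. measure (U n) {K<..} \<le> \<epsilon> / 2" using tight[of "\<epsilon> / 2"] by auto
    show "\<exists>a b. a < b \<and> (\<forall>n. 1 - \<epsilon> < measure (U n) {a<..b})"
    proof (rule exI[of _ "-1"], rule exI[of _ "max K 0"], intro conjI allI)
      fix n
      have "measure (U n) {..-1} = 0"
        using U(2)[of n] by (subst U.prob_eq_0) (auto elim: eventually_mono)
      moreover have "measure (U n) {max K 0<..} \<le> measure (U n) {K<..}" by (intro U.finite_measure_mono) auto
      moreover have "{..-1} \<union> {-1<..max K 0} \<union> {max K 0<..} = (UNIV :: real set)" by auto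
      then have "1 = measure (U n) ({..-1} \<union> {-1<..max K 0} \<union> {max K 0<..})"
        using U.prob_space[of n] by simp
      moreover have "measure (U n) ({..-1} \<union> {-1<..max K 0} \<union> {max K 0<..})
          \<le> measure (U n) ({..-1} \<union> {-1<..max K 0}) + measure (U n) {max K 0<..}"
        by (rule measure_Un_le) auto
      moreover have "measure (U n) ({..-1} \<union> {-1<..max K 0}) \<le> measure (U n) {..-1} + measure (U n) {-1<..max K 0}"
        by (rule measure_Un_le) auto
      ultimately show "1 - \<epsilon> < measure (U n) {-1<..max K 0}" using K[of n] \<open>0 < \<epsilon>\<close> by linarith
    qed simp
  qed (rule U(1))
  fix s \<nu> assume s: "strict_mono s" and \<nu>: "real_distribution \<nu>" and sub: "weak_conv_m (U \<circ> s) \<nu>"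
  interpret N: real_distribution \<nu> by (rule \<nu>)
  have Us: "real_distribution ((U \<circ> s) n)" for n using U(1) by simp
  have Us0: "AE z in (U \<circ> s) n. 0 \<le> z" for n unfolding comp_apply by (rule U(2))
  define Q where "Q = distr \<nu> borel (max 0)"
  have Q: "prob_space Q" "sets Q = sets borel" "AE z in Q. 0 \<le> z"
    unfolding Q_def by (auto intro!: N.prob_space_distr simp: AE_distr_iff)
  have lim: "(\<lambda>n. \<integral>z. f z \<partial>U (s n)) \<longlonglongrightarrow> (\<integral>z. f z \<partial>Q)"
    if "\<And>z. isCont f z" "\<And>z. 0 \<le> z \<Longrightarrow> norm (f z) \<le> 1" for f :: "real \<Rightarrow> complex"
    using nonneg_weak_conv_m_imp_tendsto[OF Us Us0 \<nu> sub that] by (simp add: Q_def)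
  have lim': "(\<lambda>n. \<integral>z. f z \<partial>U (s n)) \<longlonglongrightarrow> (\<integral>z. f z \<partial>Q)"
    if "\<And>z. isCont f z" "\<And>z. 0 \<le> z \<Longrightarrow> norm (f z) \<le> 1" for f :: "real \<Rightarrow> real"
    using nonneg_weak_conv_m_imp_tendsto[OF Us Us0 \<nu> sub that] by (simp add: Q_def)
  have "Q = P"
  proof (rule laplace_parabola_unique[OF Q P.prob_space_axioms P.events_eq_borel P(2) k])
    fix r :: real assume r: "0 < r"
    let ?f = "\<lambda>z. exp (- Complex (k * r\<^sup>2) (c * r) * complex_of_real z)"
    have "(\<lambda>n. \<integral>z. ?f z \<partial>U (s n)) \<longlonglongrightarrow> (\<integral>z. ?f z \<partial>Q)"
      by (rule lim) (use k in \<open>auto simp: norm_exp_eq_Re\<close>)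
    moreover have "(\<lambda>n. \<integral>z. ?f z \<partial>U (s n)) \<longlonglongrightarrow> (\<integral>z. ?f z \<partial>P)"
      using LIMSEQ_subseq_LIMSEQ[OF conv[OF r] s] by (simp add: comp_def)
    ultimately show "(\<integral>z. ?f z \<partial>Q) = (\<integral>z. ?f z \<partial>P)" by (rule LIMSEQ_unique)
  qed
  show "weak_conv_m (U \<circ> s) P"
  proof (rule integral_bdd_continuous_conv_imp_weak_conv[OF Us P(1)])
    fix f :: "real \<Rightarrow> real" assume "\<And>x. isCont f x" "\<And>x. \<bar>f x\<bar> \<le> 1"
    then show "(\<lambda>n. integral\<^sup>L ((U \<circ> s) n) f) \<longlonglongrightarrow> integral\<^sup>L P f"
      using lim'[of f] \<open>Q = P\<close> by simp
  qed
qed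

text \<open>The hypotheses concern indices \<open>n \<ge> 1\<close>, whereas the convergence theorems want a law at every index.\<close>

lemma weakly_converges_Suc: "weakly_converges (\<lambda>n. L (Suc n)) P \<longleftrightarrow> weakly_converges L P"
  unfolding weakly_converges_def by (simp add: filterlim_sequentially_Suc[of "\<lambda>n. LINT x|L n. _ x"])

lemma weak_conv_m_Suc: "weak_conv_m (\<lambda>n. L (Suc n)) P \<longleftrightarrow> weak_conv_m L P"
  unfolding weak_conv_m_def weak_conv_def by (simp add: filterlim_sequentially_Suc[of "\<lambda>n. cdf (L n) _"])

section \<open>Generalized hyperbolic limits for statistics with random sample size\<close>

theorem theorem4:
  fixes M :: "'w measure"
    and X :: "nat \<Rightarrow> nat \<Rightarrow> 'w \<Rightarrow> real ^ 'r"
    and T :: "nat \<Rightarrow> nat \<Rightarrow> (nat \<Rightarrow> real ^ 'r) \<Rightarrow> real ^ 'm"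
    and \<theta> a\<^sub>s b\<^sub>s :: "nat \<Rightarrow> real ^ 'm"
    and a b :: "real ^ 'm"
    and \<sigma> :: "nat \<Rightarrow> real"
    and N :: "nat \<Rightarrow> 'w \<Rightarrow> nat"
    and \<Sigma> :: "real ^ 'm ^ 'm"
    and \<nu> \<mu> \<alpha> lam :: real
  assumes "prob_space M"
    and "\<And>n. 1 \<le> n \<Longrightarrow> prob_space.indep_vars M (\<lambda>_. borel) (X n) {1..}"
    and "\<And>n k. 1 \<le> n \<Longrightarrow> 1 \<le> k \<Longrightarrow> T n k \<in> measurable (Pi\<^sub>M {1..k} (\<lambda>_. borel)) borel"
    and "\<And>n. 1 \<le> n \<Longrightarrow> N n \<in> measurable M (count_space UNIV)"
    and "\<And>n \<omega>. 1 \<le> n \<Longrightarrow> \<omega> \<in> space M \<Longrightarrow> 1 \<le> N n \<omega>"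
    and "\<And>n k. 1 \<le> n \<Longrightarrow> 1 \<le> k \<Longrightarrow>
           indep_rvs M (count_space UNIV) (N n) borel (\<lambda>\<omega>. stat T X n k \<omega> - \<theta> n)"
    and "weakly_relatively_compact {1..} (\<lambda>n. distr M borel (\<lambda>\<omega>. real n / real (N n \<omega>)))"
    and "\<And>n. 1 \<le> n \<Longrightarrow> 0 < \<sigma> n"
    and "a\<^sub>s \<longlonglongrightarrow> a" and "b\<^sub>s \<longlonglongrightarrow> b"
    and "pos_def_matrix \<Sigma>"
    and "\<And>R. 0 < R \<Longrightarrow>
           (\<lambda>n. LINT \<omega>|M. (SUP t\<in>cball 0 R.
              cmod (char_fun (distr M borel (Y_vec T X \<theta> \<sigma> a\<^sub>s n (N n \<omega>))) t
                    - complex_of_real (exp (- (t \<bullet> (\<Sigma> *v t)) / 2))))) \<longlonglongrightarrow> 0"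
    and "gh_parameters \<nu> \<mu> \<alpha> (matrix_inv \<Sigma> *v a) \<Sigma>"
    and "lam = sqrt (\<alpha>\<^sup>2 - a \<bullet> (matrix_inv \<Sigma> *v a))"
  shows "weakly_converges
           (\<lambda>n. distr M borel (\<lambda>\<omega>. (\<sigma> n * sqrt (real n)) *\<^sub>R (stat T X n (N n \<omega>) \<omega> - \<theta> n) - b\<^sub>s n))
           (GH \<nu> \<mu> \<alpha> (matrix_inv \<Sigma> *v a) (- b) \<Sigma>)
         \<longleftrightarrow>
         weak_conv_m (\<lambda>n. distr M borel (\<lambda>\<omega>. real (N n \<omega>) / real n)) (GIG (- \<nu>) lam \<mu>)"
proof -
  note N = assms(4) and N1 = assms(5) and ind = assms(6) and rc = assms(7) and \<sigma> = assms(8)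
    and as = assms(9) and bs = assms(10) and S = assms(11) and an = assms(12) and gh = assms(13) and lam = assms(14)
  interpret prob_space M by fact
  define U where "U n \<omega> = real n / real (N n \<omega>)" for n \<omega>
  define W where "W n \<omega> = real (N n \<omega>) / real n" for n \<omega>
  define Z where "Z n \<omega> = (\<sigma> n * sqrt (real n)) *\<^sub>R (stat T X n (N n \<omega>) \<omega> - \<theta> n) - b\<^sub>s n" for n \<omega>
  define G where "G = GIG \<nu> \<mu> lam"
  define s where "s t = Complex (t \<bullet> (\<Sigma> *v t) / 2) (- (t \<bullet> a))" for t :: "real ^ 'm"
  have Um: "U n \<in> borel_measurable M" if "1 \<le> n" for n using N[OF that] unfolding U_def by measurable
  have Wm: "W n \<in> borel_measurable M" if "1 \<le> n" for n using N[OF that] unfolding W_def by measurable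
  have UW: "1 / U n \<omega> = W n \<omega>" "1 / W n \<omega> = U n \<omega>" for n \<omega> by (simp_all add: U_def W_def)
  have Upos: "0 < U n \<omega>" if "1 \<le> n" "\<omega> \<in> space M" for n \<omega> using N1[OF that] that by (simp add: U_def)
  have Zm: "Z n \<in> borel_measurable M" if n: "1 \<le> n" for n
  proof -
    have V: "(\<lambda>\<omega>. stat T X n (if 1 \<le> k then k else 1) \<omega> - \<theta> n) \<in> borel_measurable M" for k
      using ind[OF n, of "if 1 \<le> k then k else 1"] by (auto simp: indep_rvs_def)
    have "(\<lambda>\<omega>. stat T X n (if 1 \<le> N n \<omega> then N n \<omega> else 1) \<omega> - \<theta> n) \<in> borel_measurable M"
      by (rule measurable_compose_countable[OF V N[OF n]])
    then have "(\<lambda>\<omega>. stat T X n (N n \<omega>) \<omega> - \<theta> n) \<in> borel_measurable M"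
      by (rule measurable_cong[THEN iffD1, rotated]) (use N1[OF n] in auto)
    then show ?thesis unfolding Z_def by measurable
  qed

  have Sinv: "\<Sigma> *v (matrix_inv \<Sigma> *v a) = a"
  proof -
    have "invertible \<Sigma>" using gh by (simp add: invertible_det_nz gh_parameters_def)
    then show ?thesis by (simp add: matrix_vector_mul_assoc matrix_inv_right)
  qed
  have lam': "lam = sqrt (\<alpha>\<^sup>2 - (matrix_inv \<Sigma> *v a) \<bullet> (\<Sigma> *v (matrix_inv \<Sigma> *v a)))"
    by (simp add: lam Sinv inner_commute)
  have p: "gig_parameters \<nu> \<mu> lam"
    using gh unfolding lam' gh_parameters_def gig_parameters_def by (auto simp: not_le)
  have GH: "GH \<nu> \<mu> \<alpha> (matrix_inv \<Sigma> *v a) (- b) \<Sigma> = normal_vm_mixture (- b) a \<Sigma> G"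
    by (simp add: GH_def Sinv G_def lam inner_commute)
  have Gpos: "AE z in G. 0 < z" unfolding G_def by (rule AE_GIG_pos)
  then have "AE z in G. 0 \<le> z" by eventually_elim simp
  then have G: "prob_space G" "sets G = sets borel" "AE z in G. 0 \<le> z"
    using prob_space_GIG[OF p] by (auto simp: G_def)
  have GD: "real_distribution G"
    using G by (simp add: real_distribution_def real_distribution_axioms_def sets_eq_imp_space_eq)
  have Grec: "distr G borel (\<lambda>x. 1 / x) = GIG (- \<nu>) lam \<mu>"
    using GIG_reciprocal[OF gig_parameters_reciprocal[OF p]] by (simp add: G_def)
  have RD: "real_distribution (GIG (- \<nu>) lam \<mu>)"
    using prob_space_GIG[OF gig_parameters_reciprocal[OF p]]
    by (simp add: real_distribution_def real_distribution_axioms_def sets_eq_imp_space_eq)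
  let ?GH = "normal_vm_mixture (- b) a \<Sigma> G"
  note GHP = prob_space_normal_vm_mixture[OF S G, of "- b" a] sets_normal_vm_mixture[OF S G, of "- b" a]
  have chGH: "char_fun ?GH t = iexp (- (t \<bullet> b)) * (\<integral>z. exp (- s t * of_real z) \<partial>G)" for t
    by (simp add: char_fun_normal_vm_mixture[OF S G] s_def)
  have s0: "0 \<le> Re (s t)" for t
    using S by (cases "t = 0") (auto simp: s_def pos_def_matrix_def intro: less_imp_le)

  \<comment> \<open>All laws at index \<open>0\<close> are discarded by the shift: nothing is known about \<open>N 0\<close>.\<close>
  define \<U> where "\<U> n = distr M borel (U (Suc n))" for n
  define \<W> where "\<W> n = distr M borel (W (Suc n))" for n
  define \<Z> where "\<Z> n = distr M borel (Z (Suc n))" for n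
  have \<U>: "real_distribution (\<U> n)" "AE z in \<U> n. 0 \<le> z" for n
    using Um[of "Suc n"] Upos[of "Suc n"] unfolding \<U>_def
    by (auto simp: real_distribution_distr AE_distr_iff less_imp_le)
  have \<W>: "real_distribution (\<W> n)" "AE z in \<W> n. 0 < z" for n
    using Wm[of "Suc n"] Upos[of "Suc n"] unfolding \<W>_def
    by (auto simp: real_distribution_distr AE_distr_iff simp flip: UW(1))
  have \<Z>: "prob_space (\<Z> n)" "sets (\<Z> n) = sets borel" for n
    using Zm[of "Suc n"] by (auto simp: \<Z>_def prob_space_distr)
  have rec: "\<W> n = distr (\<U> n) borel (\<lambda>x. 1 / x)" for n
    using Um[of "Suc n"] by (simp add: \<W>_def \<U>_def distr_distr comp_def UW)
  have upper: "\<exists>K. \<forall>n. measure (\<U> n) {K<..} \<le> \<epsilon>" if "0 < \<epsilon>" for \<epsilon>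
  proof -
    have "\<exists>K. \<forall>n\<ge>1. measure (distr M borel (U n)) {K<..} \<le> \<epsilon>"
      using Um that by (intro weakly_relatively_compact_imp_upper_tight)
        (use rc in \<open>auto simp: U_def[abs_def] intro: real_distribution_distr\<close>)
    then show ?thesis unfolding \<U>_def by (metis le_add1 plus_1_eq_Suc)
  qed

  have asymp: "(\<lambda>n. char_fun (\<Z> n) t - iexp (- (t \<bullet> b\<^sub>s (Suc n))) * (\<integral>z. exp (- s t * of_real z) \<partial>\<U> n)) \<longlonglongrightarrow> 0" for t
  proof (rule tendstoI)
    fix \<epsilon> :: real assume \<epsilon>: "0 < \<epsilon>"
    \<comment> \<open>The tail enters the bound with factor \<open>4\<close>, so it contributes at most \<open>\<epsilon> / 4\<close>.\<close>
    obtain K0 where K0: "\<And>n. measure (\<U> n) {K0<..} \<le> \<epsilon> / 16" using upper[of "\<epsilon> / 16"] \<epsilon> by auto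
    \<comment> \<open>The bound needs \<open>K \<ge> 0\<close> and a radius \<open>R > 0\<close>, hence the maximum and the added \<open>1\<close>.\<close>
    define K where "K = max K0 0"
    define R where "R = sqrt K * norm t + 1"
    have K: "0 \<le> K" "0 < R" "sqrt K * norm t \<le> R" by (auto simp: K_def R_def intro!: add_nonneg_pos)
    let ?E = "\<lambda>n. LINT \<omega>|M. (SUP t\<in>cball 0 R.
              cmod (char_fun (distr M borel (Y_vec T X \<theta> \<sigma> a\<^sub>s n (N n \<omega>))) t
                    - complex_of_real (exp (- (t \<bullet> (\<Sigma> *v t)) / 2))))"
    have bound: "cmod (char_fun (\<Z> n) t - iexp (- (t \<bullet> b\<^sub>s (Suc n))) * (\<integral>z. exp (- s t * of_real z) \<partial>\<U> n))
        \<le> ?E (Suc n) + K * \<bar>t \<bullet> (a\<^sub>s (Suc n) - a)\<bar> + 4 * (\<epsilon> / 16)" for n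
    proof -
      let ?n = "Suc n"
      have n1: "1 \<le> ?n" by simp
      have tail: "measure M {\<omega> \<in> space M. K < real ?n / real (N ?n \<omega>)} \<le> \<epsilon> / 16"
      proof -
        have "measure M {\<omega> \<in> space M. K < real ?n / real (N ?n \<omega>)} = measure (\<U> n) {K<..}"
          unfolding \<U>_def using Um[of ?n] by (subst measure_distr) (auto simp: U_def intro!: arg_cong[where f="measure M"])
        also have "\<dots> \<le> measure (\<U> n) {K0<..}"
          using \<U>(1)[of n] by (intro finite_measure.finite_measure_mono)
            (auto simp: real_distribution_def prob_space_def K_def real_distribution_axioms_def)
        finally show ?thesis using K0[of n] by linarith
      qed
      have "?E ?n = (LINT \<omega>|M. (SUP u\<in>cball 0 R.
              cmod (char_fun (distr M borel (\<lambda>\<omega>'. (\<sigma> ?n * sqrt (real (N ?n \<omega>))) *\<^sub>R (stat T X ?n (N ?n \<omega>) \<omega>' - \<theta> ?n)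
                   - sqrt (real ?n / real (N ?n \<omega>)) *\<^sub>R a\<^sub>s ?n)) u
                    - of_real (exp (- (u \<bullet> (\<Sigma> *v u)) / 2)))))"
        by (intro Bochner_Integration.integral_cong refl)
           (simp add: Y_vec_closed_form[OF \<sigma> N1] fun_eq_iff[symmetric] del: of_nat_Suc cong: distr_cong)
      moreover have "(\<integral>z. exp (- s t * of_real z) \<partial>\<U> n) = (\<integral>\<omega>. exp (- s t * of_real (real ?n / real (N ?n \<omega>))) \<partial>M)"
        unfolding \<U>_def using Um[of ?n] by (subst integral_distr) (auto simp: U_def)
      ultimately show ?thesis
        using char_fun_random_size_bound[where V="\<lambda>k \<omega>. stat T X ?n k \<omega> - \<theta> ?n" and \<sigma>="\<sigma> ?n"
            and b\<^sub>n="b\<^sub>s ?n" and a\<^sub>n="a\<^sub>s ?n" and a=a,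
            OF assms(1) N[OF n1] N1[OF n1] ind[OF n1] n1 S K(1,3)] tail
        unfolding \<Z>_def Z_def[abs_def] s_def by simp
    qed
    have "(\<lambda>n. ?E (Suc n)) \<longlonglongrightarrow> 0" using LIMSEQ_Suc[OF an[OF K(2)]] .
    moreover have "(\<lambda>n. K * \<bar>t \<bullet> (a\<^sub>s (Suc n) - a)\<bar>) \<longlonglongrightarrow> K * \<bar>t \<bullet> (a - a)\<bar>"
      by (intro tendsto_intros LIMSEQ_Suc as)
    ultimately have "(\<lambda>n. ?E (Suc n) + K * \<bar>t \<bullet> (a\<^sub>s (Suc n) - a)\<bar> + 4 * (\<epsilon> / 16)) \<longlonglongrightarrow> 0 + K * \<bar>t \<bullet> (a - a)\<bar> + 4 * (\<epsilon> / 16)"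
      by (intro tendsto_add tendsto_const)
    then have "\<forall>\<^sub>F n in sequentially. ?E (Suc n) + K * \<bar>t \<bullet> (a\<^sub>s (Suc n) - a)\<bar> + 4 * (\<epsilon> / 16) < \<epsilon>"
      by (rule order_tendstoD(2)) (use \<epsilon> in simp)
    then show "\<forall>\<^sub>F n in sequentially. dist (char_fun (\<Z> n) t - iexp (- (t \<bullet> b\<^sub>s (Suc n))) * (\<integral>z. exp (- s t * of_real z) \<partial>\<U> n)) 0 < \<epsilon>"
      by eventually_elim (use bound in \<open>auto simp: dist_norm intro: le_less_trans\<close>)
  qed
  have bconv: "(\<lambda>n. iexp (- (t \<bullet> b\<^sub>s (Suc n)))) \<longlonglongrightarrow> iexp (- (t \<bullet> b))" for t
    by (intro tendsto_intros LIMSEQ_Suc bs)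

  have "weakly_converges \<Z> ?GH \<longleftrightarrow> weak_conv_m \<W> (GIG (- \<nu>) lam \<mu>)"
  proof
    assume conv: "weak_conv_m \<W> (GIG (- \<nu>) lam \<mu>)"
    have "(\<lambda>n. \<integral>z. exp (- s t * of_real z) \<partial>\<U> n) \<longlonglongrightarrow> (\<integral>z. exp (- s t * of_real z) \<partial>G)" for t
    proof -
      have "(\<integral>z. exp (- s t * of_real z) \<partial>\<U> n) = (\<integral>x. exp (- s t * of_real (1 / x)) \<partial>\<W> n)" for n
      proof -
        have "(\<integral>z. exp (- s t * of_real z) \<partial>\<U> n) = (\<integral>\<omega>. exp (- s t * of_real (U (Suc n) \<omega>)) \<partial>M)"
          unfolding \<U>_def using Um[of "Suc n"] by (subst integral_distr) auto
        moreover have "(\<integral>x. exp (- s t * of_real (1 / x)) \<partial>\<W> n) = (\<integral>\<omega>. exp (- s t * of_real (1 / W (Suc n) \<omega>)) \<partial>M)"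
          unfolding \<W>_def using Wm[of "Suc n"] by (subst integral_distr) auto
        ultimately show ?thesis by (simp only: UW)
      qed
      moreover have "(\<integral>z. exp (- s t * of_real z) \<partial>G) = (\<integral>x. exp (- s t * of_real (1 / x)) \<partial>GIG (- \<nu>) lam \<mu>)"
        unfolding G_def GIG_reciprocal[OF p, symmetric] by (subst integral_distr) auto
      ultimately show ?thesis
        using weak_conv_m_reciprocal_imp_exp_tendsto[OF \<W> RD AE_GIG_pos conv s0, of t] by simp
    qed
    then have "(\<lambda>n. (char_fun (\<Z> n) t - iexp (- (t \<bullet> b\<^sub>s (Suc n))) * (\<integral>z. exp (- s t * of_real z) \<partial>\<U> n))
        + iexp (- (t \<bullet> b\<^sub>s (Suc n))) * (\<integral>z. exp (- s t * of_real z) \<partial>\<U> n))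
        \<longlonglongrightarrow> 0 + iexp (- (t \<bullet> b)) * (\<integral>z. exp (- s t * of_real z) \<partial>G)" for t
      by (intro tendsto_add tendsto_mult asymp bconv)
    then have "(\<lambda>n. char_fun (\<Z> n) t) \<longlonglongrightarrow> char_fun ?GH t" for t
      unfolding chGH by simp
    then show "weakly_converges \<Z> ?GH"
      by (rule char_fun_tendsto_imp_weakly_converges[OF \<Z> GHP])
  next
    assume conv: "weakly_converges \<Z> ?GH"
    have lim: "(\<lambda>n. \<integral>z. exp (- s t * of_real z) \<partial>\<U> n) \<longlonglongrightarrow> (\<integral>z. exp (- s t * of_real z) \<partial>G)" for t
    proof -
      have "(\<lambda>n. char_fun (\<Z> n) t) \<longlonglongrightarrow> char_fun ?GH t"
        by (rule weakly_converges_imp_char_fun_tendsto[OF conv \<Z> GHP])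
      then have "(\<lambda>n. (char_fun (\<Z> n) t - (char_fun (\<Z> n) t - iexp (- (t \<bullet> b\<^sub>s (Suc n))) * (\<integral>z. exp (- s t * of_real z) \<partial>\<U> n)))
          / iexp (- (t \<bullet> b\<^sub>s (Suc n)))) \<longlonglongrightarrow> (char_fun ?GH t - 0) / iexp (- (t \<bullet> b))"
        by (intro tendsto_divide tendsto_diff asymp bconv) auto
      then show ?thesis unfolding chGH by simp
    qed
    \<comment> \<open>Any nonzero direction will do for the ray.\<close>
    define e :: "real ^ 'm" where "e = 1"
    have e: "0 < e \<bullet> (\<Sigma> *v e) / 2" using S by (auto simp: pos_def_matrix_def e_def)
    have "weak_conv_m \<U> G"
    proof (rule laplace_parabola_tendsto_imp_weak_conv_m[OF \<U> upper GD G(3) e, where c="- (e \<bullet> a)"])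
      fix r :: real assume "0 < r"
      have "s (r *\<^sub>R e) = Complex (e \<bullet> (\<Sigma> *v e) / 2 * r\<^sup>2) (- (e \<bullet> a) * r)"
        by (simp add: s_def matrix_vector_mult_scaleR power2_eq_square)
      then show "(\<lambda>n. \<integral>z. exp (- Complex (e \<bullet> (\<Sigma> *v e) / 2 * r\<^sup>2) (- (e \<bullet> a) * r) * of_real z) \<partial>\<U> n)
         \<longlonglongrightarrow> (\<integral>z. exp (- Complex (e \<bullet> (\<Sigma> *v e) / 2 * r\<^sup>2) (- (e \<bullet> a) * r) * of_real z) \<partial>G)"
        using lim[of "r *\<^sub>R e"] by simp
    qed
    then have "weak_conv_m (\<lambda>n. distr (\<U> n) borel (\<lambda>x. 1 / x)) (distr G borel (\<lambda>x. 1 / x))"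
      by (intro weak_conv_m_reciprocal \<U>(1) GD Gpos)
    then show "weak_conv_m \<W> (GIG (- \<nu>) lam \<mu>)" by (simp add: Grec flip: rec)
  qed
  then show ?thesis
    unfolding GH
    using weakly_converges_Suc[of "\<lambda>n. distr M borel (Z n)" ?GH]
      weak_conv_m_Suc[of "\<lambda>n. distr M borel (W n)" "GIG (- \<nu>) lam \<mu>"]
    by (simp add: \<Z>_def[abs_def] \<W>_def[abs_def] Z_def[abs_def] W_def[abs_def])
qed

end
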